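(* Let $q$ be a prime power, let $\mathscr{H}$ be the Hermitian curve over $\mathbb{F}_{q^2}$, let $P$ be a place of degree $3$ of $\mathbb{F}_{q^2}(\mathscr{H})$, and let $D$ be the sum of all $\mathbb{F}_{q^2}$-rational points of $\mathscr{H}$ other than $P_\infty$. Let $u$ be an integer with $q+1\le 6u\le 2(q+1)$. Let $m=(2u-1)q-u-1=m_1(q+1)+m_0$ with $0\le m_0\le q$. Then the minimum distance of the differential code $C_\Omega(D,mP)$ is at least $$\delta+3(q+1-3u)=\delta+3m_0,$$ where $\delta=3m-q^2+q+2$ is the designed minimum distance of the code.
   Context: The Hermitian curve is $\mathscr{H}: X^{q+1}-Y^qZ-YZ^q=0$ over $\mathbb{F}_{q^2}$, with genus $q(q-1)/2$, and $P_\infty=(0:1:0)$; it has $q^3+1$ points over $\mathbb{F}_{q^2}$, identified with the degree one places of $\mathbb{F}_{q^2}(\mathscr{H})$. For $D=Q_1+\dots+Q_n$ a sum of distinct degree one places and a divisor $G$ with support disjoint from that of $D$, the differential code is $C_\Omega(D,G)=\{(\mathrm{res}_{Q_1}(\omega),\dots,\mathrm{res}_{Q_n}(\omega))\mid \omega\in\Omega(G-D)\}\subseteq \mathbb{F}_{q^2}^n$, where $\Omega(A)$ is the space of differentials $\omega$ with $\omega=0$ or $\mathrm{Div}(\omega)\succeq A$. Equivalently, it is the dual of the functional code $C_L(D,G)=\{(f(Q_1),\dots,f(Q_n))\mid f\in\mathscr{L}(G)\}$. *)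

theory Defs
  imports "HOL-Library.FuncSet" "HOL-Computational_Algebra.Polynomial"
    "HOL-Number_Theory.Prime_Powers"
begin

text \<open>
  Function fields: the function field is (the whole of) a type \<open>'f\<close> of class \<open>field\<close>, and
  the field of constants is a subset \<open>K\<close> of it.
\<close>

definition is_subfield :: "'f::field set \<Rightarrow> bool" where
  "is_subfield L \<longleftrightarrow> 1 \<in> L \<and>
     (\<forall>a\<in>L. \<forall>b\<in>L. a - b \<in> L \<and> a * b \<in> L) \<and> (\<forall>a\<in>L. inverse a \<in> L)"

definition transcendental_over :: "'f::field set \<Rightarrow> 'f \<Rightarrow> bool" where
  "transcendental_over K z \<longleftrightarrow>
     (\<forall>p::'f poly. (\<forall>i. coeff p i \<in> K) \<and> poly p z = 0 \<longrightarrow> p = 0)"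

text \<open>
  The function field \<open>K(x, y)\<close> of the curve \<open>X^(q+1) - Y^q Z - Y Z^q = 0\<close> over the field \<open>K\<close>
  with \<open>q\<^sup>2\<close> elements, where \<open>x = X/Z\<close> and \<open>y = Y/Z\<close>. As the polynomial
  \<open>T^q + T - x^(q+1)\<close> is irreducible over the rational function field \<open>K(x)\<close>, these conditions
  determine the field together with \<open>K\<close>, \<open>x\<close>, \<open>y\<close> up to isomorphism.
\<close>

definition hermitian_function_field ::
    "nat \<Rightarrow> 'f::field set \<Rightarrow> 'f \<Rightarrow> 'f \<Rightarrow> bool" where
  "hermitian_function_field q K x y \<longleftrightarrow>
     is_subfield K \<and> card K = q ^ 2 \<and>
     transcendental_over K x \<and>
     x ^ (q + 1) - y ^ q - y = 0 \<and>
     (\<forall>L. is_subfield L \<and> K \<subseteq> L \<and> x \<in> L \<and> y \<in> L \<longrightarrow> L = UNIV)"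

text \<open>
  A place is given by its normalized discrete valuation. The value at \<open>0\<close> (really
  \<open>\<infinity>\<close>) is set to \<open>0\<close> by convention, so that distinct functions are distinct places.
\<close>

type_synonym 'f place = "'f \<Rightarrow> int"

definition is_place :: "'f::field set \<Rightarrow> 'f place \<Rightarrow> bool" where
  "is_place K v \<longleftrightarrow>
     v 0 = 0 \<and>
     (\<forall>a\<in>K. v a = 0) \<and>
     (\<forall>f g. f \<noteq> 0 \<and> g \<noteq> 0 \<longrightarrow> v (f * g) = v f + v g) \<and>
     (\<forall>f g. f \<noteq> 0 \<and> g \<noteq> 0 \<and> f + g \<noteq> 0 \<longrightarrow> min (v f) (v g) \<le> v (f + g)) \<and>
     (\<exists>t. v t = 1)"

definition valuation_ring :: "'f::field place \<Rightarrow> 'f set" where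
  "valuation_ring v = {f. f = 0 \<or> 0 \<le> v f}"

definition valuation_ideal :: "'f::field place \<Rightarrow> 'f set" where
  "valuation_ideal v = {f. f = 0 \<or> 1 \<le> v f}"

text \<open>
  The degree of a place is the dimension over \<open>K\<close> of its residue field, the valuation ring
  modulo its maximal ideal; \<open>B\<close> is a set of representatives of a basis.
\<close>

definition place_of_degree :: "'f::field set \<Rightarrow> nat \<Rightarrow> 'f place \<Rightarrow> bool" where
  "place_of_degree K n v \<longleftrightarrow> is_place K v \<and>
     (\<exists>B \<subseteq> valuation_ring v. finite B \<and> card B = n \<and>
        (\<forall>z\<in>valuation_ring v.
           \<exists>!c. c \<in> B \<rightarrow>\<^sub>E K \<and> z - (\<Sum>b\<in>B. c b * b) \<in> valuation_ideal v))"

text \<open>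
  The place centred at \<open>(0:1:0)\<close>: there \<open>(x:y:1) = (x/y : 1 : 1/y)\<close> reduces to \<open>(0:1:0)\<close>.
\<close>

definition P_infinity :: "'f::field set \<Rightarrow> 'f \<Rightarrow> 'f \<Rightarrow> 'f place" where
  "P_infinity K x y =
     (THE v. is_place K v \<and> x / y \<in> valuation_ideal v \<and> 1 / y \<in> valuation_ideal v)"

type_synonym 'f divisor = "'f place \<Rightarrow> int"

definition place_multiple :: "int \<Rightarrow> 'f place \<Rightarrow> 'f divisor" where
  "place_multiple m P = (\<lambda>Q. if Q = P then m else 0)"

definition places_sum :: "'f place set \<Rightarrow> 'f divisor" where
  "places_sum S = (\<lambda>Q. if Q \<in> S then 1 else 0)"

text \<open>
  Differentials of the function field are the linear functionals on the space of its
  derivations over \<open>K\<close>; the differential \<open>f dg\<close> is the functional \<open>\<delta> \<mapsto> f \<cdot> \<delta> g\<close>.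
  In a function field of one variable over a perfect field \<open>K\<close> the space of derivations is
  one-dimensional, and its dual is the module of Kaehler differentials.
\<close>

definition derivations :: "'f::field set \<Rightarrow> ('f \<Rightarrow> 'f) set" where
  "derivations K = {\<delta>. (\<forall>a\<in>K. \<delta> a = 0) \<and>
     (\<forall>f g. \<delta> (f + g) = \<delta> f + \<delta> g) \<and> (\<forall>f g. \<delta> (f * g) = f * \<delta> g + g * \<delta> f)}"

definition differentials :: "'f::field set \<Rightarrow> (('f \<Rightarrow> 'f) \<Rightarrow> 'f) set" where
  "differentials K = {\<omega> \<in> extensional (derivations K).
     (\<forall>\<delta>\<in>derivations K. \<forall>\<epsilon>\<in>derivations K. \<omega> (\<lambda>z. \<delta> z + \<epsilon> z) = \<omega> \<delta> + \<omega> \<epsilon>) \<and>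
     (\<forall>f. \<forall>\<delta>\<in>derivations K. \<omega> (\<lambda>z. f * \<delta> z) = f * \<omega> \<delta>)}"

definition differential :: "'f::field set \<Rightarrow> 'f \<Rightarrow> 'f \<Rightarrow> (('f \<Rightarrow> 'f) \<Rightarrow> 'f)" where
  "differential K f g = (\<lambda>\<delta>\<in>derivations K. f * \<delta> g)"

definition zero_differential :: "'f::field set \<Rightarrow> (('f \<Rightarrow> 'f) \<Rightarrow> 'f)" where
  "zero_differential K = (\<lambda>\<delta>\<in>derivations K. 0)"

text \<open>
  The coefficient of a nonzero differential at the place \<open>v\<close> in its divisor: the valuation of
  \<open>f\<close> in \<open>\<omega> = f dt\<close>, where \<open>t\<close> is a local parameter. It does not depend on \<open>t\<close>.
\<close>

definition order_at :: "'f::field set \<Rightarrow> (('f \<Rightarrow> 'f) \<Rightarrow> 'f) \<Rightarrow> 'f place \<Rightarrow> int" where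
  "order_at K \<omega> v = (THE n. \<exists>t f. v t = 1 \<and> \<omega> = differential K f t \<and> n = v f)"

definition Omega :: "'f::field set \<Rightarrow> 'f divisor \<Rightarrow> (('f \<Rightarrow> 'f) \<Rightarrow> 'f) set" where
  "Omega K A = {\<omega> \<in> differentials K.
     \<omega> = zero_differential K \<or> (\<forall>v. is_place K v \<longrightarrow> A v \<le> order_at K \<omega> v)}"

text \<open>
  The residue at a place \<open>v\<close> of degree one: if \<open>\<omega> = f dt\<close> for a local parameter \<open>t\<close>, it is the
  coefficient of \<open>t^(-1)\<close> in the expansion of \<open>f\<close> as a Laurent series in \<open>t\<close> over \<open>K\<close>. Below,
  \<open>a i\<close> is the coefficient of \<open>t^(-i)\<close>, and the sum is the principal part of \<open>f\<close>. The residue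
  does not depend on \<open>t\<close>.
\<close>

definition residue_at :: "'f::field set \<Rightarrow> 'f place \<Rightarrow> (('f \<Rightarrow> 'f) \<Rightarrow> 'f) \<Rightarrow> 'f" where
  "residue_at K v \<omega> = (THE r. \<exists>t f (a :: nat \<Rightarrow> 'f) n.
     v t = 1 \<and> \<omega> = differential K f t \<and> 1 \<le> n \<and> (\<forall>i\<in>{1..n}. a i \<in> K) \<and>
     f - (\<Sum>i=1..n. a i / t ^ i) \<in> valuation_ring v \<and> r = a 1)"

text \<open>
  A code of length \<open>n\<close> is a set of words indexed by a set of \<open>n\<close> positions. The positions of the
  differential code are the places in \<open>S\<close>, where \<open>D\<close> is the sum of the places in \<open>S\<close>.
\<close>

definition differential_code ::
    "'f::field set \<Rightarrow> 'f place set \<Rightarrow> 'f divisor \<Rightarrow> ('f place \<Rightarrow> 'f) set" where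
  "differential_code K S G =
     (\<lambda>\<omega>. \<lambda>Q\<in>S. residue_at K Q \<omega>) ` Omega K (\<lambda>v. G v - places_sum S v)"

definition hamming_distance :: "'i set \<Rightarrow> ('i \<Rightarrow> 'a) \<Rightarrow> ('i \<Rightarrow> 'a) \<Rightarrow> nat" where
  "hamming_distance S a b = card {i \<in> S. a i \<noteq> b i}"

definition minimum_distance :: "'i set \<Rightarrow> ('i \<Rightarrow> 'a) set \<Rightarrow> nat" where
  "minimum_distance S C = Inf {hamming_distance S a b | a b. a \<in> C \<and> b \<in> C \<and> a \<noteq> b}"

end

theory Submission
  imports Defs
begin

text \<open>
  A differential is \<open>h dx\<close> with a function \<open>h\<close>, and its order is that of \<open>h\<close> at the affine places
  and is larger by \<open>(q - 2) (q + 1)\<close> at \<open>P\<^sub>\<infinity>\<close>. As the tangent line at a point \<open>p\<close> of the curve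
  intersects it in \<open>q p\<close> and in the image of \<open>p\<close> under the Frobenius map over \<open>K\<close>, the product \<open>N\<close>
  of the tangent lines at the three conjugate points below \<open>P\<close> is a cubic over \<open>K\<close> with divisor
  \<open>(q + 1) P - 3 (q + 1) P\<^sub>\<infinity>\<close>.

  Put \<open>k = u - 1\<close> and \<open>e = m\<^sub>0\<close>, so that \<open>q = 3 k + e + 2\<close> and \<open>m = 2 k (q + 1) + e\<close>. Let \<open>h dx\<close> be a
  nonzero differential in \<open>\<Omega>(m P - D)\<close>, let \<open>S\<close> be the set of its poles, and let \<open>h\<^sub>1 = h / N^(2 k)\<close>.
  For polynomials \<open>F\<close>, \<open>G\<close> of degree at most \<open>3 k\<close> the residue theorem, applied to \<open>h\<^sub>1 F G dx\<close>,
  shows that the values of the polynomials of degree at most \<open>3 k\<close> on \<open>S\<close> form an isotropic space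
  for a nondegenerate diagonal bilinear form; its dimension is thus at most \<open>|S| / 2\<close>. If \<open>F\<close>
  vanishes on \<open>S\<close>, then \<open>F h\<^sub>1\<close> is a polynomial of degree at most \<open>e\<close> and of order at least \<open>e\<close> at
  \<open>P\<close>. For \<open>e \<ge> 1\<close> such a polynomial is a multiple of \<open>N\<close>, which leaves \<open>(e - 1) (e - 2) / 2\<close>
  dimensions. Hence \<open>|S| \<ge> (3 k + 1) (3 k + 2) - (e - 1) (e - 2) = \<delta> + 3 m\<^sub>0\<close>.
\<close>

section \<open>Spans over the constants\<close>

text \<open>The conjugate points below \<open>P\<close> are not defined over \<open>K\<close> and
  are never constructed. Powers of \<open>x\<close> and \<open>y\<close> with exponents
  \<open>q ^ i\<close> stand in for them: modulo the maximal ideal of \<open>P\<close>, raising to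
  the power \<open>q ^ 2\<close> is the Frobenius map, and the power \<open>q ^ 6\<close> fixes
  residues while it turns a congruence into one of order \<open>q ^ 6\<close>. Places come from
  nonzero prime ideals of K[x, y], whose quotients by nonzero elements are finite; dimensions over
  \<open>K\<close> are compared by counting elements; the residue theorem becomes a power sum over
  the points.

  The constants fit as follows. \<open>N\<close> has pole order 3(q + 1) at infinity, so dividing by
  its power 2k compensates exactly the poles of F and G, of order at most 3k(q + 1) each; this fixes
  the degree 3k. The same division leaves F h1 with pole order at most (q - 2 - 3k)(q + 1) = e(q +
  1), and for e < q a regular function with such a pole is a polynomial of degree at most e. For e =
  0 only constants remain, which is one dimension, again (e - 1)(e - 2) / 2.\<close>

inductive_set lspan :: "'f::field set \<Rightarrow> 'f set \<Rightarrow> 'f set" for K E where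
  zero [simp, intro]: "0 \<in> lspan K E"
| step: "c \<in> K \<Longrightarrow> e \<in> E \<Longrightarrow> z \<in> lspan K E \<Longrightarrow> c * e + z \<in> lspan K E"

context
  fixes K :: "'f::field set"
  assumes K: "is_subfield K"
begin

lemma subfield_closed:
  shows subfield_0: "0 \<in> K" and subfield_1: "1 \<in> K"
    and subfield_diff: "a \<in> K \<Longrightarrow> b \<in> K \<Longrightarrow> a - b \<in> K"
    and subfield_uminus: "a \<in> K \<Longrightarrow> - a \<in> K"
    and subfield_add: "a \<in> K \<Longrightarrow> b \<in> K \<Longrightarrow> a + b \<in> K"
    and subfield_mult: "a \<in> K \<Longrightarrow> b \<in> K \<Longrightarrow> a * b \<in> K"
    and subfield_inverse: "a \<in> K \<Longrightarrow> inverse a \<in> K"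
    and subfield_divide: "a \<in> K \<Longrightarrow> b \<in> K \<Longrightarrow> a / b \<in> K"
proof -
  have d: "a - b \<in> K" "a * b \<in> K" "inverse a \<in> K" if "a \<in> K" "b \<in> K" for a b
    using K that unfolding is_subfield_def by auto
  show one: "1 \<in> K" using K unfolding is_subfield_def by auto
  show zero: "0 \<in> K" using d(1)[OF one one] by simp
  have u: "- a \<in> K" if "a \<in> K" for a using d(1)[OF zero that] by simp
  show "a \<in> K \<Longrightarrow> b \<in> K \<Longrightarrow> a - b \<in> K" by (rule d)
  show "a \<in> K \<Longrightarrow> - a \<in> K" by (rule u)
  show "a \<in> K \<Longrightarrow> b \<in> K \<Longrightarrow> a + b \<in> K" using d(1)[OF _ u] by fastforce
  show "a \<in> K \<Longrightarrow> b \<in> K \<Longrightarrow> a * b \<in> K" by (rule d)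
  show "a \<in> K \<Longrightarrow> inverse a \<in> K" by (rule d(3))
  show "a \<in> K \<Longrightarrow> b \<in> K \<Longrightarrow> a / b \<in> K" using d by (simp add: divide_inverse)
qed

lemma subfield_power: "a \<in> K \<Longrightarrow> a ^ n \<in> K"
  by (induction n) (auto intro: subfield_closed)

lemma subfield_sum: "(\<And>i. i \<in> I \<Longrightarrow> f i \<in> K) \<Longrightarrow> sum f I \<in> K"
  by (induction I rule: infinite_finite_induct) (auto intro: subfield_closed)

lemma lspan_add: "z \<in> lspan K E \<Longrightarrow> w \<in> lspan K E \<Longrightarrow> z + w \<in> lspan K E"
  by (induction z rule: lspan.induct) (auto simp: add.assoc intro: lspan.step)

lemma lspan_scale:
  assumes c: "c \<in> K" and "z \<in> lspan K E"
  shows "c * z \<in> lspan K E"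
  using assms(2)
proof induction
  case (step a e z)
  have "c * (a * e + z) = (c * a) * e + c * z" by (simp add: algebra_simps)
  then show ?case using step c by (auto intro!: lspan.step subfield_mult)
qed auto

lemma lspan_base: "e \<in> E \<Longrightarrow> e \<in> lspan K E"
  using lspan.step[of 1 K e E 0] subfield_1 by simp

lemma lspan_base_scale: "c \<in> K \<Longrightarrow> e \<in> E \<Longrightarrow> c * e \<in> lspan K E"
  using lspan.step[of c K e E 0] by simp

lemma lspan_uminus: "z \<in> lspan K E \<Longrightarrow> - z \<in> lspan K E"
  using lspan_scale[of "- 1" z E] subfield_uminus[OF subfield_1] by simp

lemma lspan_diff: "z \<in> lspan K E \<Longrightarrow> w \<in> lspan K E \<Longrightarrow> z - w \<in> lspan K E"
  using lspan_add[of z E "- w"] lspan_uminus by simp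

lemma lspan_sum: "(\<And>i. i \<in> I \<Longrightarrow> f i \<in> lspan K E) \<Longrightarrow> sum f I \<in> lspan K E"
  by (induction I rule: infinite_finite_induct) (auto intro: lspan_add)

lemma lspan_mult_map:
  assumes "\<And>e. e \<in> E \<Longrightarrow> a * e \<in> lspan K E'" and "z \<in> lspan K E"
  shows "a * z \<in> lspan K E'"
  using assms(2)
proof induction
  case (step c e z)
  have "a * (c * e + z) = c * (a * e) + a * z" by (simp add: algebra_simps)
  then show ?case using lspan_add[OF lspan_scale[OF step(1) assms(1)[OF step(2)]] step.IH] by simp
qed auto

lemma lspan_subset: "E \<subseteq> lspan K E' \<Longrightarrow> lspan K E \<subseteq> lspan K E'"
  using lspan_mult_map[of E 1 E'] by auto

lemma lspan_mono: "E \<subseteq> E' \<Longrightarrow> lspan K E \<subseteq> lspan K E'"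
  by (rule lspan_subset) (auto intro: lspan_base)

lemma lspan_mult:
  assumes "\<And>e e'. e \<in> E \<Longrightarrow> e' \<in> E' \<Longrightarrow> e * e' \<in> lspan K E''"
    and z: "z \<in> lspan K E" and w: "w \<in> lspan K E'"
  shows "z * w \<in> lspan K E''"
proof -
  have "w * e \<in> lspan K E''" if "e \<in> E" for e
    using lspan_mult_map[of E' e E'' w] assms(1)[OF that] w by (simp add: mult.commute[of w])
  then show ?thesis using lspan_mult_map[of E w E'' z] z by (simp add: mult.commute)
qed

lemma lspan_image_rep:
  assumes "finite I" "z \<in> lspan K (e ` I)"
  obtains c where "\<And>i. i \<in> I \<Longrightarrow> c i \<in> K" "z = (\<Sum>i\<in>I. c i * e i)"
proof -
  have "\<exists>c. (\<forall>i\<in>I. c i \<in> K) \<and> z = (\<Sum>i\<in>I. c i * e i)"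
    using assms(2)
  proof induction
    case zero
    then show ?case using subfield_0 by (intro exI[of _ "\<lambda>_. 0"]) auto
  next
    case (step a f z)
    then obtain c j where c: "\<forall>i\<in>I. c i \<in> K" "z = (\<Sum>i\<in>I. c i * e i)" and j: "j \<in> I" "f = e j"
      by auto
    let ?c = "c(j := c j + a)"
    have "(\<Sum>i\<in>I. ?c i * e i) = (\<Sum>i\<in>I. c i * e i + (if i = j then a * e i else 0))"
      by (intro sum.cong) (auto simp: algebra_simps)
    also have "\<dots> = z + a * f" using assms(1) j c by (simp add: sum.distrib)
    finally show ?case using c step j
      by (intro exI[of _ ?c]) (auto simp: add.commute intro: subfield_add)
  qed
  then show ?thesis using that by blast
qed

text \<open>Dimensions are measured by cardinalities. This is the bound from above by the number of
  generators; \<open>card_V_ge\<close> is the matching bound from below.\<close>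

lemma card_lspan_image:
  assumes "finite K" "finite I"
  shows finite_lspan_image: "finite (lspan K (e ` I))"
    and card_lspan_image_le: "card (lspan K (e ` I)) \<le> card K ^ card I"
proof -
  have sub: "lspan K (e ` I) \<subseteq> (\<lambda>c. \<Sum>i\<in>I. c i * e i) ` (I \<rightarrow>\<^sub>E K)"
  proof
    fix z assume "z \<in> lspan K (e ` I)"
    then obtain c where c: "\<And>i. i \<in> I \<Longrightarrow> c i \<in> K" "z = (\<Sum>i\<in>I. c i * e i)"
      using assms(2) lspan_image_rep by metis
    have "z = (\<Sum>i\<in>I. restrict c I i * e i)" using c by simp
    moreover have "restrict c I \<in> I \<rightarrow>\<^sub>E K" using c by auto
    ultimately show "z \<in> (\<lambda>c. \<Sum>i\<in>I. c i * e i) ` (I \<rightarrow>\<^sub>E K)" by (rule image_eqI)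
  qed
  have fin: "finite (I \<rightarrow>\<^sub>E K)" using assms by (simp add: finite_PiE)
  then show "finite (lspan K (e ` I))" using sub by (meson finite_imageI finite_subset)
  have "card (lspan K (e ` I)) \<le> card (I \<rightarrow>\<^sub>E K)"
    using sub fin by (meson card_image_le card_mono finite_imageI le_trans)
  then show "card (lspan K (e ` I)) \<le> card K ^ card I"
    using assms by (simp add: card_PiE)
qed

lemma finite_lspan:
  assumes "finite K" "finite E"
  shows "finite (lspan K E)"
  using finite_lspan_image[OF assms, of id] by simp

end

text \<open>Pigeonhole principle, applied to powers or Frobenius iterates modulo something finite: a
  collision yields an inverse, a period or a contradiction.\<close>

lemma infinite_orbit_collision:
  fixes f :: "nat \<Rightarrow> 'a"
  assumes "finite (range f)"
  obtains i j where "i < j" "f i = f j"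
proof -
  have "\<not> inj f" using assms finite_imageD by blast
  then show ?thesis using that unfolding inj_def by (metis linorder_neqE_nat)
qed

section \<open>Fermat's theorem modulo an ideal\<close>

lemma prod_cong_ideal:
  fixes f g :: "'a \<Rightarrow> 'f::comm_ring_1"
  assumes "finite I" and O: "\<And>a b. a \<in> O' \<Longrightarrow> b \<in> O' \<Longrightarrow> a * b \<in> O'" "1 \<in> O'"
    and m: "\<And>a b. a \<in> m \<Longrightarrow> b \<in> m \<Longrightarrow> a + b \<in> m" "0 \<in> m"
      "\<And>a b. a \<in> O' \<Longrightarrow> b \<in> m \<Longrightarrow> a * b \<in> m"
    and fg: "\<And>i. i \<in> I \<Longrightarrow> f i \<in> O' \<and> g i \<in> O' \<and> f i - g i \<in> m"
  shows "prod f I - prod g I \<in> m \<and> prod f I \<in> O' \<and> prod g I \<in> O'"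
  using assms(1) fg
proof (induction I)
  case (insert i I)
  have "f i * prod f I - g i * prod g I = f i * (prod f I - prod g I) + prod g I * (f i - g i)"
    by (simp add: algebra_simps)
  then show ?case using insert O m by auto
qed (use O m in auto)

text \<open>No quotient is formed: \<open>T\<close> represents \<open>O'\<close> modulo
  \<open>m\<close>, multiplication by \<open>z\<close> permutes the nonzero representatives, and
  their product, which lies outside the prime ideal \<open>m\<close>, cancels. It serves for
  \<open>K\<close> with \<open>m = {0}\<close> and for the residue field of a place of degree
  three.\<close>

lemma fermat_mod_ideal:
  fixes T O' m :: "'f::comm_ring_1 set"
  assumes T: "finite T" "T \<subseteq> O'" "\<And>z. z \<in> O' \<Longrightarrow> \<exists>!t. t \<in> T \<and> z - t \<in> m"
    and O: "\<And>a b. a \<in> O' \<Longrightarrow> b \<in> O' \<Longrightarrow> a - b \<in> O'"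
      "\<And>a b. a \<in> O' \<Longrightarrow> b \<in> O' \<Longrightarrow> a * b \<in> O'" "1 \<in> O'"
    and m: "\<And>a b. a \<in> m \<Longrightarrow> b \<in> m \<Longrightarrow> a + b \<in> m" "0 \<in> m"
      "\<And>a b. a \<in> O' \<Longrightarrow> b \<in> m \<Longrightarrow> a * b \<in> m"
    and prm: "\<And>a b. a \<in> O' \<Longrightarrow> b \<in> O' \<Longrightarrow> a * b \<in> m \<Longrightarrow> a \<in> m \<or> b \<in> m" "1 \<notin> m"
    and z: "z \<in> O'"
  shows "z ^ card T - z \<in> m"
proof -
  have zero: "0 \<in> O'" using O(1)[OF O(3) O(3)] by simp
  have neg: "- b \<in> m" if "b \<in> m" for b
    using m(3)[OF O(1)[OF zero O(3)] that] by simp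
  have sub: "a - b \<in> m" if "a \<in> m" "b \<in> m" for a b using m(1)[OF that(1) neg[OF that(2)]] by simp
  have pow: "z ^ n \<in> O'" for n by (induction n) (use O z in auto)
  obtain t0 where t0: "t0 \<in> T" "0 - t0 \<in> m" using T(3)[OF zero] by auto
  have t0m: "t0 \<in> m" using neg[OF t0(2)] by simp
  have T0: "t = t0" if "t \<in> T" "t \<in> m" for t using T(3)[OF zero] t0 that neg[of t] by auto
  let ?U = "T - {t0}"
  have card: "card T = Suc (card ?U)" using t0 T(1) by (metis card_Suc_Diff1)
  show ?thesis
  proof (cases "z \<in> m")
    case True
    then have "z ^ Suc (card ?U) \<in> m" using m(3)[OF pow True, of "card ?U"] by (simp add: mult.commute)
    then show ?thesis using sub True card by metis
  next
    case False
    define \<phi> where "\<phi> t = (THE s. s \<in> T \<and> z * t - s \<in> m)" for t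
    have \<phi>: "\<phi> t \<in> T" "z * t - \<phi> t \<in> m" if "t \<in> T" for t
      using theI'[OF T(3)[of "z * t"]] O z T(2) that unfolding \<phi>_def by auto
    have nm: "t \<notin> m" if "t \<in> ?U" for t using that T0 by auto
    have \<phi>U: "\<phi> t \<in> ?U" if t: "t \<in> ?U" for t
    proof -
      have "\<phi> t \<noteq> t0"
      proof
        assume "\<phi> t = t0"
        then have "z * t \<in> m" using m(1)[OF \<phi>(2)[of t] t0m] t by simp
        then show False using prm(1)[OF z, of t] False nm[OF t] t T(2) by auto
      qed
      then show ?thesis using \<phi> t by auto
    qed
    have inj: "inj_on \<phi> ?U"
    proof
      fix s t assume st: "s \<in> ?U" "t \<in> ?U" "\<phi> s = \<phi> t"
      have "z * (s - t) \<in> m" using sub[OF \<phi>(2)[of s] \<phi>(2)[of t]] st by (simp add: algebra_simps)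
      then have "s - t \<in> m" using prm(1)[OF z] False O(1)[of s t] st T(2) by blast
      moreover have "s - s \<in> m" using m by simp
      ultimately show "s = t" using T(3)[of s] st T(2) by blast
    qed
    have fin: "finite ?U" using T by simp
    have im: "\<phi> ` ?U = ?U" using inj \<phi>U fin by (metis card_image card_subset_eq image_subsetI)
    have "(\<Prod>t\<in>?U. z * t) - (\<Prod>t\<in>?U. \<phi> t) \<in> m \<and> (\<Prod>t\<in>?U. z * t) \<in> O' \<and> (\<Prod>t\<in>?U. \<phi> t) \<in> O'"
      by (rule prod_cong_ideal[OF fin O(2,3) m]) (use O z T(2) \<phi> in auto)
    moreover have "(\<Prod>t\<in>?U. \<phi> t) = \<Prod>?U" using prod.reindex[OF inj, of id] im by simp
    ultimately have *: "(z ^ card ?U - 1) * \<Prod>?U \<in> m" "\<Prod>?U \<in> O'"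
      by (simp_all add: prod.distrib algebra_simps)
    have "\<Prod>V \<in> O' \<and> \<Prod>V \<notin> m" if "finite V" "V \<subseteq> ?U" for V
      using that
    proof (induction V)
      case (insert t V)
      then show ?case using prm(1)[of t "\<Prod>V"] O(2) nm[of t] T(2) by auto
    qed (use O prm in auto)
    from this[OF fin order_refl] have "\<Prod>?U \<notin> m" by simp
    then have "z ^ card ?U - 1 \<in> m" using prm(1)[OF O(1)[OF pow O(3)] *(2)] * by blast
    then have "z * (z ^ card ?U - 1) \<in> m" using m(3) z by blast
    then show ?thesis by (simp add: card algebra_simps)
  qed
qed

section \<open>Valuations\<close>

text \<open>Membership in the fractional ideals; \<open>0\<close> has to be treated separately, as \<open>v 0 = 0\<close>.\<close>

definition vge :: "'f::field place \<Rightarrow> int \<Rightarrow> 'f \<Rightarrow> bool" where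
  "vge v n f \<longleftrightarrow> f = 0 \<or> n \<le> v f"

lemma in_valuation_ring_iff: "f \<in> valuation_ring v \<longleftrightarrow> vge v 0 f"
  and in_valuation_ideal_iff: "f \<in> valuation_ideal v \<longleftrightarrow> vge v 1 f"
  unfolding valuation_ring_def valuation_ideal_def vge_def by auto

lemma vge_0 [simp]: "vge v n 0" by (simp add: vge_def)

lemma vge_mono: "vge v n f \<Longrightarrow> k \<le> n \<Longrightarrow> vge v k f" by (auto simp: vge_def)

locale place =
  fixes K :: "'f::field set" and v :: "'f place"
  assumes K: "is_subfield K" and v: "is_place K v"
begin

lemma v_0 [simp]: "v 0 = 0" and v_const: "a \<in> K \<Longrightarrow> v a = 0"
  and v_mult: "f \<noteq> 0 \<Longrightarrow> g \<noteq> 0 \<Longrightarrow> v (f * g) = v f + v g"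
  and v_add: "f \<noteq> 0 \<Longrightarrow> g \<noteq> 0 \<Longrightarrow> f + g \<noteq> 0 \<Longrightarrow> min (v f) (v g) \<le> v (f + g)"
  and ex_uniformizer: "\<exists>t. v t = 1"
  using v unfolding is_place_def by auto

lemma v_1 [simp]: "v 1 = 0" using v_const subfield_1[OF K] by blast

lemma v_minus [simp]: "v (- f) = v f"
proof (cases "f = 0")
  case False
  then have "v (- 1 * f) = v (- 1) + v f" by (intro v_mult) auto
  then show ?thesis using v_const[OF subfield_uminus[OF K subfield_1[OF K]]] by simp
qed auto

lemma v_power: "f \<noteq> 0 \<Longrightarrow> v (f ^ n) = int n * v f"
  by (induction n) (auto simp: v_mult algebra_simps)

lemma v_divide: "f \<noteq> 0 \<Longrightarrow> g \<noteq> 0 \<Longrightarrow> v (f / g) = v f - v g"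
  using v_mult[of "f / g" g] by simp

lemma v_inverse: "f \<noteq> 0 \<Longrightarrow> v (inverse f) = - v f"
  using v_divide[of 1 f] by (simp add: divide_inverse)

lemma v_powi: "f \<noteq> 0 \<Longrightarrow> v (f powi n) = n * v f"
  by (cases "n \<ge> 0") (auto simp: power_int_def v_power v_inverse)

lemma vge_const [simp]: "a \<in> K \<Longrightarrow> vge v 0 a" by (simp add: vge_def v_const)

lemma vge_1 [simp]: "vge v 0 1" by (simp add: vge_def)

lemma not_vge_1: "\<not> vge v 1 1" by (simp add: vge_def)

lemma vge_const_1: "a \<in> K \<Longrightarrow> vge v 1 a \<Longrightarrow> a = 0" by (auto simp: vge_def v_const)

lemma vge_add: "vge v n f \<Longrightarrow> vge v n g \<Longrightarrow> vge v n (f + g)"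
  using v_add[of f g] by (cases "f = 0"; cases "g = 0"; cases "f + g = 0") (auto simp: vge_def)

lemma vge_uminus [simp]: "vge v n (- f) \<longleftrightarrow> vge v n f" by (auto simp: vge_def)

lemma vge_diff: "vge v n f \<Longrightarrow> vge v n g \<Longrightarrow> vge v n (f - g)"
  using vge_add[of n f "- g"] by simp

lemma vge_minus_commute: "vge v n (f - g) \<longleftrightarrow> vge v n (g - f)"
  using vge_uminus[of n "f - g"] by simp

lemma vge_mult: "vge v n f \<Longrightarrow> vge v k g \<Longrightarrow> vge v (n + k) (f * g)"
  by (cases "f = 0"; cases "g = 0") (auto simp: vge_def v_mult)

lemma vge_mult0: "vge v 0 f \<Longrightarrow> vge v n g \<Longrightarrow> vge v n (f * g)"
  using vge_mult[of 0 f n g] by simp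

lemma vge_mult0': "vge v n f \<Longrightarrow> vge v 0 g \<Longrightarrow> vge v n (f * g)"
  using vge_mult[of n f 0 g] by simp

lemma vge_power: "vge v n f \<Longrightarrow> vge v (int k * n) (f ^ k)"
  by (cases "f = 0"; cases "k = 0") (auto simp: vge_def v_power mult_left_mono)

lemma vge_power0: "vge v 0 f \<Longrightarrow> vge v 0 (f ^ k)"
  using vge_power[of 0 f k] by simp

lemma vge_sum: "(\<And>i. i \<in> I \<Longrightarrow> vge v n (f i)) \<Longrightarrow> vge v n (sum f I)"
  by (induction I rule: infinite_finite_induct) (auto intro: vge_add)

lemma vge_cancel: "vge v n (f * g) \<Longrightarrow> g \<noteq> 0 \<Longrightarrow> vge v (n - v g) f"
  by (cases "f = 0") (auto simp: vge_def v_mult)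

lemma vge_unit_cancel: "vge v n (f * g) \<Longrightarrow> v g = 0 \<Longrightarrow> g \<noteq> 0 \<Longrightarrow> vge v n f"
  using vge_cancel[of n f g] by simp

lemma vge_prime: "vge v 0 f \<Longrightarrow> vge v 0 g \<Longrightarrow> vge v 1 (f * g) \<Longrightarrow> vge v 1 f \<or> vge v 1 g"
  by (cases "f = 0"; cases "g = 0") (auto simp: vge_def v_mult)

lemma vge_power_1: "vge v 0 f \<Longrightarrow> vge v 1 (f ^ k) \<Longrightarrow> vge v 1 f"
proof (induction k)
  case (Suc k)
  then show ?case using vge_prime[of f "f ^ k"] vge_power0[of f k] by auto
qed (simp add: not_vge_1)

lemma v_eq_0_iff: "vge v 0 f \<Longrightarrow> \<not> vge v 1 f \<longleftrightarrow> f \<noteq> 0 \<and> v f = 0"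
  by (auto simp: vge_def)

lemma v_add_eq:
  assumes "f \<noteq> 0" "vge v (v f + 1) g"
  shows "v (f + g) = v f" "f + g \<noteq> 0"
proof -
  show nz: "f + g \<noteq> 0"
  proof
    assume "f + g = 0"
    then have "g = - f" by (simp add: eq_neg_iff_add_eq_0 add.commute)
    then show False using assms by (auto simp: vge_def)
  qed
  have ge: "v f \<le> v (f + g)" if "g \<noteq> 0"
    using v_add[OF assms(1) that nz] assms(2) that unfolding vge_def by simp
  have "v (f + g) \<le> v f" if "g \<noteq> 0"
    using v_add[of "f + g" "- g"] nz that assms unfolding vge_def by simp
  then show "v (f + g) = v f" using ge by (cases "g = 0") simp_all
qed

lemma vge_lspan:
  assumes "\<And>e. e \<in> E \<Longrightarrow> vge v n e" and "z \<in> lspan K E"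
  shows "vge v n z"
  using assms(2)
proof induction
  case (step c e z)
  then show ?case using vge_add[OF vge_mult0[OF vge_const[OF step(1)] assms(1)[OF step(2)]]] by blast
qed auto

text \<open>The term of least valuation is unique, so the others cannot cancel it.\<close>

lemma sum_distinct_valuations:
  assumes "finite I" "I \<noteq> {}" and nz: "\<And>i. i \<in> I \<Longrightarrow> f i \<noteq> 0" and inj: "inj_on (\<lambda>i. v (f i)) I"
  shows "sum f I \<noteq> 0 \<and> (\<exists>i\<in>I. v (sum f I) = v (f i) \<and> (\<forall>j\<in>I. v (f i) \<le> v (f j)))"
proof -
  obtain i where i: "i \<in> I" "\<And>j. j \<in> I \<Longrightarrow> v (f i) \<le> v (f j)"
    using arg_min_if_finite(1)[OF assms(1,2), of "\<lambda>i. v (f i)"] arg_min_least[OF assms(1,2), of _ "\<lambda>i. v (f i)"]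
    by metis
  have "vge v (v (f i) + 1) (sum f (I - {i}))"
  proof (rule vge_sum)
    fix j assume j: "j \<in> I - {i}"
    then have "v (f i) \<noteq> v (f j)" using inj i unfolding inj_on_def by blast
    then show "vge v (v (f i) + 1) (f j)" using i(2)[of j] j by (auto simp: vge_def)
  qed
  from v_add_eq[OF nz[OF i(1)] this] show ?thesis
    using i sum.remove[OF assms(1) i(1), of f] by auto
qed

end

section \<open>The Hermitian function field\<close>

lemma add_power_CHAR:
  fixes a b :: "'f::field"
  assumes "prime p" "CHAR('f) = p"
  shows "(a + b) ^ p = a ^ p + b ^ p"
proof -
  have p: "p > 1" using assms(1) prime_gt_1_nat by blast
  have z: "of_nat (p choose k) * a ^ k * b ^ (p - k) = 0" if "k \<in> {1..<p}" for k
  proof -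
    have "p dvd (p choose k)" using that assms(1) by (intro dvd_choose_prime) auto
    then have "of_nat (p choose k) = (0::'f)" using assms(2) by (simp add: of_nat_eq_0_iff_char_dvd)
    then show ?thesis by simp
  qed
  have "(a + b) ^ p = (\<Sum>k\<le>p. of_nat (p choose k) * a ^ k * b ^ (p - k))"
    by (rule binomial_ring)
  also have "{..p} = insert 0 (insert p {1..<p})" using p by auto
  also have "(\<Sum>k\<in>\<dots>. of_nat (p choose k) * a ^ k * b ^ (p - k)) = b ^ p + (a ^ p + 0)"
    using p z by (simp add: sum.neutral)
  finally show ?thesis by (simp add: add.commute)
qed

locale hermitian =
  fixes q :: nat and K :: "'f::field set" and x y :: 'f
  assumes primepow_q: "primepow q" and hff: "hermitian_function_field q K x y"
begin

lemma K: "is_subfield K" and card_K: "card K = q ^ 2" and transcendental_x: "transcendental_over K x"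
  and curve: "x ^ (q + 1) = y ^ q + y"
  and generated: "is_subfield L \<Longrightarrow> K \<subseteq> L \<Longrightarrow> x \<in> L \<Longrightarrow> y \<in> L \<Longrightarrow> L = UNIV"
  using hff unfolding hermitian_function_field_def by (auto simp: algebra_simps)

lemmas K_closed = subfield_0[OF K] subfield_1[OF K] subfield_diff[OF K] subfield_uminus[OF K]
  subfield_add[OF K] subfield_mult[OF K] subfield_inverse[OF K] subfield_divide[OF K]
  subfield_power[OF K] subfield_sum[OF K]

lemma q_gt_1: "q > 1" using primepow_gt_Suc_0[OF primepow_q] by simp

lemma finite_K: "finite K" using card_K q_gt_1 by (metis card.infinite power_eq_0_iff not_one_less_zero)

lemma CHAR_prime_power: obtains p n where "prime p" "CHAR('f) = p" "q = p ^ n" "n > 0"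
proof -
  obtain p n where p: "prime p" "n > 0" "q = p ^ n" using primepow_q unfolding primepow_def by auto
  \<comment> \<open>Translation by 1 permutes \<open>K\<close>; comparing the sums gives
    \<open>card K = 0\<close> in the field, so the characteristic divides
    \<open>q ^ 2\<close>.\<close>
  have "(\<Sum>a\<in>K. a) = (\<Sum>a\<in>K. a + 1)"
    by (rule sum.reindex_bij_witness[of _ "\<lambda>a. a + 1" "\<lambda>a. a - 1"]) (auto intro: K_closed)
  then have "of_nat (card K) = (0::'f)" by (simp add: sum.distrib)
  then have "CHAR('f) dvd p ^ (n * 2)" using card_K unfolding p(3) by (simp only: of_nat_eq_0_iff_char_dvd power_mult)
  then obtain i where i: "CHAR('f) = p ^ i" using divides_primepow_nat[OF p(1)] by auto
  have "CHAR('f) > 0" using i p prime_gt_0_nat by simp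
  then have "prime CHAR('f)" by (rule prime_CHAR_semidom)
  then have "i = 1" using i by (metis prime_power_iff)
  then show ?thesis using that p i by simp
qed

lemma of_nat_q: "of_nat q = (0::'f)"
  by (rule CHAR_prime_power) (simp add: of_nat_eq_0_iff_char_dvd dvd_power)

lemma add_power_q: "(a + b :: 'f) ^ (q ^ k) = a ^ (q ^ k) + b ^ (q ^ k)"
proof (rule CHAR_prime_power)
  fix p n assume p: "prime p" "CHAR('f) = p" "q = p ^ n" "n > 0"
  have "(a + b) ^ (p ^ j) = a ^ (p ^ j) + b ^ (p ^ j)" for j
  proof (induction j)
    case (Suc j)
    have "(a + b) ^ (p ^ Suc j) = ((a + b) ^ (p ^ j)) ^ p" by (simp add: power_mult[symmetric] mult.commute)
    then show ?case using Suc add_power_CHAR[OF p(1,2)] by (simp add: power_mult[symmetric] mult.commute)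
  qed simp
  then show ?thesis using p by (simp add: power_mult[symmetric])
qed

lemma q_power_pos [simp]: "q ^ k > 0" using q_gt_1 by simp

lemma zero_power_q [simp]: "(0::'f) ^ (q ^ k) = 0" using q_power_pos[of k] by (simp only: zero_power)

lemma minus_power_q: "(- a :: 'f) ^ (q ^ k) = - (a ^ (q ^ k))"
proof -
  have "a ^ (q ^ k) + (- a) ^ (q ^ k) = 0" using add_power_q[of a "- a" k] by simp
  then show ?thesis by (metis add.commute eq_neg_iff_add_eq_0)
qed

lemma diff_power_q: "(a - b :: 'f) ^ (q ^ k) = a ^ (q ^ k) - b ^ (q ^ k)"
  using add_power_q[of a "- b" k] by (simp add: minus_power_q)

lemma sum_power_q: "(\<Sum>i\<in>I. f i :: 'f) ^ (q ^ k) = (\<Sum>i\<in>I. f i ^ (q ^ k))"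
  by (induction I rule: infinite_finite_induct) (auto simp: add_power_q)

lemmas frob1 = add_power_q[of _ _ 1, simplified] diff_power_q[of _ _ 1, simplified]

lemma K_frob: assumes "a \<in> K" shows "a ^ (q ^ (2 * k)) = a"
proof -
  have "a ^ card K - a \<in> {0}"
    by (rule fermat_mod_ideal[where O' = K]) (use finite_K assms in \<open>auto intro: K_closed\<close>)
  then have *: "a ^ (q ^ 2) = a" using card_K by simp
  show ?thesis
  proof (induction k)
    case (Suc k)
    have "a ^ (q ^ (2 * Suc k)) = (a ^ (q ^ 2)) ^ (q ^ (2 * k))"
      by (simp only: power_mult[symmetric] power_add[symmetric]) simp
    then show ?case using Suc * by simp
  qed simp
qed

lemma K_frob1: "a \<in> K \<Longrightarrow> a ^ q\<^sup>2 = a" using K_frob[of a 1] by simp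

text \<open>Powers with exponent \<open>q ^ (2 * k)\<close> are \<open>K\<close>-linear ring endomorphisms.\<close>

lemma frob_power: "((a::'f) ^ (q ^ i)) ^ (q ^ j) = a ^ (q ^ (i + j))"
  by (simp add: power_mult[symmetric] power_add)

text \<open>This is the form in which the transcendence of \<open>x\<close> enters: it makes
  \<open>R\<close> infinite, from which the independence of the reduced monomials follows.\<close>

lemma x_power_inj: "inj (\<lambda>k::nat. x ^ k)"
proof
  fix k l :: nat assume "x ^ k = x ^ l"
  then have "poly (monom 1 k - monom 1 l) x = 0" by (simp add: poly_monom)
  moreover have "\<forall>i. coeff (monom 1 k - monom (1::'f) l) i \<in> K" by (auto intro: K_closed)
  ultimately have "monom 1 k - monom (1::'f) l = 0"
    using transcendental_x unfolding transcendental_over_def by blast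
  then have "monom (1::'f) k = monom 1 l" by simp
  then show "k = l" by (metis degree_monom_eq one_neq_zero)
qed

lemma x_nz [simp]: "x \<noteq> 0"
proof
  assume "x = 0"
  then have "x ^ 1 = x ^ 2" by simp
  then show False using x_power_inj unfolding inj_def by fastforce
qed

lemma y_nz [simp]: "y \<noteq> 0" using curve q_gt_1 x_nz
  by (metis add_0 less_nat_zero_code power_0_left power_eq_0_iff)

section \<open>The affine coordinate ring and its filtration by pole order at infinity\<close>

definition R :: "'f set" where "R = lspan K {x ^ i * y ^ j | i j. True}"
text \<open>\<open>q * i + (q + 1) * j\<close> is the pole order of \<open>x ^ i * y ^ j\<close> at
  infinity, and \<open>j < q\<close> picks at most one monomial for each order. The inequality is
  strict so that \<open>S (wt i j)\<close> collects the terms below a leading monomial.\<close>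

definition S :: "nat \<Rightarrow> 'f set" where
  "S n = lspan K {x ^ i * y ^ j | i j. j < q \<and> q * i + (q + 1) * j < n}"

lemma R_mult: "z \<in> R \<Longrightarrow> w \<in> R \<Longrightarrow> z * w \<in> R"
  unfolding R_def
proof (rule lspan_mult[OF K])
  fix e e' assume "e \<in> {x ^ i * y ^ j | i j. True}" "e' \<in> {x ^ i * y ^ j | i j. True}"
  then obtain i j i' j' where "e * e' = x ^ (i + i') * y ^ (j + j')"
    by (auto simp: power_add mult_ac)
  then show "e * e' \<in> lspan K {x ^ i * y ^ j |i j. True}" by (auto intro!: lspan_base[OF K])
qed

lemma R_mon: "x ^ i * y ^ j \<in> R" unfolding R_def by (rule lspan_base[OF K]) auto

lemma R_K: "a \<in> K \<Longrightarrow> a \<in> R"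
proof -
  assume a: "a \<in> K"
  have "x ^ 0 * y ^ 0 \<in> {x ^ i * y ^ j | i j. True}" by blast
  from lspan_base_scale[OF K a this] show ?thesis unfolding R_def by simp
qed

lemma R_x [simp, intro]: "x \<in> R" and R_y [simp, intro]: "y \<in> R"
  and R_1 [simp, intro]: "1 \<in> R" and R_0 [simp, intro]: "0 \<in> R"
  using R_mon[of 1 0] R_mon[of 0 1] R_K K_closed(1,2) by simp_all

lemma R_add: "z \<in> R \<Longrightarrow> w \<in> R \<Longrightarrow> z + w \<in> R" unfolding R_def by (rule lspan_add[OF K])
lemma R_diff: "z \<in> R \<Longrightarrow> w \<in> R \<Longrightarrow> z - w \<in> R" unfolding R_def by (rule lspan_diff[OF K])
lemma R_uminus: "z \<in> R \<Longrightarrow> - z \<in> R" unfolding R_def by (rule lspan_uminus[OF K])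
lemma R_sum: "(\<And>i. i \<in> I \<Longrightarrow> f i \<in> R) \<Longrightarrow> sum f I \<in> R" unfolding R_def by (rule lspan_sum[OF K])
lemma R_power: "z \<in> R \<Longrightarrow> z ^ n \<in> R" by (induction n) (auto intro: R_mult)

lemmas R_closed = R_x R_y R_1 R_0 R_add R_diff R_uminus R_sum R_power R_mult

lemma R_induct [consumes 1, case_names const x y add mult]:
  assumes "z \<in> R" "\<And>a. a \<in> K \<Longrightarrow> Pr a" "Pr x" "Pr y"
    "\<And>z w. z \<in> R \<Longrightarrow> w \<in> R \<Longrightarrow> Pr z \<Longrightarrow> Pr w \<Longrightarrow> Pr (z + w)"
    "\<And>z w. z \<in> R \<Longrightarrow> w \<in> R \<Longrightarrow> Pr z \<Longrightarrow> Pr w \<Longrightarrow> Pr (z * w)"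
  shows "Pr z"
proof -
  have pow: "Pr (w ^ i)" if "Pr w" "w \<in> R" for w i
    by (induction i) (use assms that K_closed(2) in \<open>auto intro!: assms(6) R_power\<close>)
  have mon: "Pr (x ^ i * y ^ j)" for i j by (intro assms(6) pow assms(3,4) R_power) auto
  have "z \<in> lspan K {x ^ i * y ^ j | i j. True}" using assms(1) R_def by simp
  then show ?thesis
  proof induction
    case zero
    then show ?case using assms(2) K_closed(1) by simp
  next
    case (step c e z)
    then obtain i j where e: "e = x ^ i * y ^ j" by auto
    have "Pr (c * e)" unfolding e by (intro assms(6) assms(2) mon R_K R_mon step)
    have "z \<in> R" using step(3) unfolding R_def .
    then show ?case using step R_mult[OF R_K[OF step(1)] R_mon[of i j]] \<open>Pr (c * e)\<close> unfolding e
      by (intro assms(5)) auto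
  qed
qed

lemma fractions: obtains z w where "z \<in> R" "w \<in> R" "w \<noteq> 0" "f = z / w"
proof -
  let ?L = "{z / w | z w. z \<in> R \<and> w \<in> R \<and> w \<noteq> 0}"
  have LI: "z / w \<in> ?L" if "z \<in> R" "w \<in> R" "w \<noteq> 0" for z w using that by blast
  have "is_subfield ?L"
    unfolding is_subfield_def
  proof (intro conjI ballI)
    show "1 \<in> ?L" using LI[of 1 1] by simp
    fix a b assume "a \<in> ?L" "b \<in> ?L"
    then obtain z w z' w' where *: "z \<in> R" "w \<in> R" "w \<noteq> 0" "a = z / w" "z' \<in> R" "w' \<in> R" "w' \<noteq> 0" "b = z' / w'"
      by blast
    have e: "a - b = (z * w' - z' * w) / (w * w')" "a * b = (z * z') / (w * w')"
      unfolding *(4,8) using * by (simp_all add: diff_frac_eq)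
    have R: "z * w' - z' * w \<in> R" "z * z' \<in> R" "w * w' \<in> R" "w * w' \<noteq> 0"
      using * by (auto intro: R_diff R_mult)
    show "a - b \<in> ?L" unfolding e by (rule LI[OF R(1,3,4)])
    show "a * b \<in> ?L" unfolding e by (rule LI[OF R(2,3,4)])
  next
    fix a assume "a \<in> ?L"
    then obtain z w where *: "z \<in> R" "w \<in> R" "w \<noteq> 0" "a = z / w" by blast
    show "inverse a \<in> ?L"
    proof (cases "z = 0")
      case True
      then show ?thesis using * LI[of 0 1] by simp
    next
      case False
      then have "inverse a = w / z" using * by simp
      then show ?thesis using LI[of w z] * False by simp
    qed
  qed
  moreover have "R \<subseteq> ?L"
  proof
    fix z assume "z \<in> R"
    then show "z \<in> ?L" using LI[of z 1] by simp
  qed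
  ultimately have "?L = UNIV" using generated[of ?L] R_K R_x R_y by blast
  then have "f \<in> ?L" by blast
  then show ?thesis using that by blast
qed

section \<open>Weights and reduction\<close>

abbreviation wt :: "nat \<Rightarrow> nat \<Rightarrow> nat" where "wt i j \<equiv> q * i + (q + 1) * j"

lemma wt_inj: assumes "wt i j = wt i' j'" "j < q" "j' < q" shows "i = i' \<and> j = j'"
proof -
  have "j = wt i j mod q" "j' = wt i' j' mod q"
    using assms(2,3) by (simp_all add: add_mult_distrib mult.commute[of q])
  then have "j = j'" using assms(1) by metis
  then show ?thesis using assms q_gt_1 by simp
qed

text \<open>The semigroup generated by \<open>q\<close> and \<open>q + 1\<close> has no gaps from
  \<open>q * (q - 1)\<close> on; the simpler bound \<open>q ^ 2\<close> is enough here. Necessarily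
  \<open>j = n mod q\<close>.\<close>

lemma wt_ex: assumes "n \<ge> q\<^sup>2" obtains i j where "j < q" "n = wt i j"
proof -
  define j where "j = n mod q"
  have j: "j < q" using q_gt_1 j_def by simp
  have "(q + 1) * j \<le> (q + 1) * (q - 1)" using j by (intro mult_left_mono) auto
  also have "\<dots> \<le> q\<^sup>2" using q_gt_1 by (cases q) (auto simp: power2_eq_square)
  finally have le: "(q + 1) * j \<le> n" using assms by simp
  have "(n - j) mod q = 0" unfolding j_def by (simp add: minus_mod_eq_mult_div)
  moreover have "n - (q + 1) * j = (n - j) - q * j" by simp
  moreover have "q dvd q * j" "q dvd n - j" using calculation(1) by auto
  ultimately have "q dvd n - (q + 1) * j" by (metis dvd_diff_nat)
  then obtain i where "n - (q + 1) * j = q * i" by auto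
  then show ?thesis using that[of j i] j le by simp
qed

lemma S_mono: "n \<le> k \<Longrightarrow> S n \<subseteq> S k" unfolding S_def by (rule lspan_mono[OF K]) fastforce

lemma S_mon: "j < q \<Longrightarrow> wt i j < n \<Longrightarrow> x ^ i * y ^ j \<in> S n"
  unfolding S_def by (rule lspan_base[OF K]) auto

lemma S_0 [simp]: "0 \<in> S n" unfolding S_def by simp
lemma S_add: "z \<in> S n \<Longrightarrow> w \<in> S n \<Longrightarrow> z + w \<in> S n" unfolding S_def by (rule lspan_add[OF K])
lemma S_diff: "z \<in> S n \<Longrightarrow> w \<in> S n \<Longrightarrow> z - w \<in> S n" unfolding S_def by (rule lspan_diff[OF K])
lemma S_scale: "a \<in> K \<Longrightarrow> w \<in> S n \<Longrightarrow> a * w \<in> S n" unfolding S_def by (rule lspan_scale[OF K])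
lemma S_sum: "(\<And>i. i \<in> I \<Longrightarrow> f i \<in> S n) \<Longrightarrow> sum f I \<in> S n" unfolding S_def by (rule lspan_sum[OF K])

lemma S_R: "S n \<subseteq> R" unfolding S_def R_def by (rule lspan_mono[OF K]) auto

lemma finite_S: "finite (S n)"
proof -
  have "{x ^ i * y ^ j | i j. j < q \<and> wt i j < n} \<subseteq> (\<lambda>(i, j). x ^ i * y ^ j) ` ({..n} \<times> {..<q})"
  proof
    fix e assume "e \<in> {x ^ i * y ^ j | i j. j < q \<and> wt i j < n}"
    then obtain i j where e: "e = x ^ i * y ^ j" "j < q" "wt i j < n" by auto
    have "i \<le> q * i" using q_gt_1 by simp
    then have "i \<le> n" using e by linarith
    then show "e \<in> (\<lambda>(i, j). x ^ i * y ^ j) ` ({..n} \<times> {..<q})" using e by auto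
  qed
  then show ?thesis unfolding S_def by (meson finite_lspan[OF K finite_K] finite_subset finite_imageI finite_SigmaI finite_atMost finite_lessThan)
qed

lemma mon_reduce:
  assumes "q \<le> j"
  shows "x ^ i * y ^ j = x ^ (i + q + 1) * y ^ (j - q) - x ^ i * y ^ (j - q + 1)"
proof -
  have "y ^ j = y ^ (j - q) * y ^ q" using assms by (simp add: power_add[symmetric])
  also have "y ^ q = x ^ (q + 1) - y" using curve by simp
  finally have "x ^ i * y ^ j = x ^ i * (y ^ (j - q) * (x ^ (q + 1) - y))" by simp
  then show ?thesis by (simp add: algebra_simps power_add)
qed

text \<open>Replacing \<open>y ^ q\<close> by \<open>x ^ (q + 1) - y\<close> keeps the weight in the
  first term and lowers it in the second. The bound \<open>j < 2 * q - 1\<close> covers a product of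
  two reduced monomials, for which one replacement suffices.\<close>

lemma mon_leading:
  assumes "j < 2 * q - 1" "wt i j = n"
  obtains i' j' z where "j' < q" "wt i' j' = n" "z \<in> S n" "x ^ i * y ^ j = x ^ i' * y ^ j' + z"
proof (cases "j < q")
  case True
  then show ?thesis using that[of j i 0] assms by simp
next
  case False
  then obtain k where k: "j = q + k" by (metis le_Suc_ex not_le)
  have w: "wt (i + q + 1) k = n" using assms(2) unfolding k by (simp add: algebra_simps)
  have "n = wt i (k + 1) + (q + 1) * (q - 1)" using assms(2) q_gt_1 unfolding k
    by (cases q) (simp_all add: algebra_simps)
  then have "wt i (k + 1) < n" using q_gt_1 by simp
  then have "- (x ^ i * y ^ (k + 1)) \<in> S n"
    using S_diff[OF S_0 S_mon[of "k + 1" i n]] assms(1) k by simp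
  then show ?thesis using that[of k "i + q + 1" "- (x ^ i * y ^ (k + 1))"] w mon_reduce[of j i] assms(1) k
    by simp
qed

lemma S_mult_mon:
  assumes "b < q" "z \<in> S k"
  shows "x ^ a * y ^ b * z \<in> S (k + wt a b)"
  using assms(2) unfolding S_def[of k]
proof (rule lspan_mult_map[OF K, where E' = "{x ^ i * y ^ j | i j. j < q \<and> wt i j < k + wt a b}", folded S_def, rotated])
  fix e assume "e \<in> {x ^ i * y ^ j | i j. j < q \<and> wt i j < k}"
  then obtain i j where e: "e = x ^ i * y ^ j" "j < q" "wt i j < k" by auto
  have "j + b < 2 * q - 1" using e assms(1) by simp
  from mon_leading[OF this refl, of "i + a"]
  obtain i' j' z where *: "j' < q" "wt i' j' = wt (i + a) (j + b)" "z \<in> S (wt (i + a) (j + b))"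
    "x ^ (i + a) * y ^ (j + b) = x ^ i' * y ^ j' + z" by blast
  have lt: "wt (i + a) (j + b) < k + wt a b" using e by (simp add: algebra_simps)
  have "x ^ a * y ^ b * e = x ^ (i + a) * y ^ (j + b)" using e by (simp add: power_add algebra_simps)
  also have "\<dots> \<in> S (k + wt a b)" unfolding *(4)
    using S_mon[OF *(1), of i'] *(2,3) lt S_mono[of "wt (i + a) (j + b)" "k + wt a b"]
    by (intro S_add) (auto simp del: add_mult_distrib add_mult_distrib2)
  finally show "x ^ a * y ^ b * e \<in> S (k + wt a b)" .
qed

lemma R_eq_reduced: "R = lspan K {x ^ i * y ^ j | i j. j < q}"
proof
  show "lspan K {x ^ i * y ^ j | i j. j < q} \<subseteq> R" unfolding R_def by (rule lspan_mono[OF K]) auto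
  have "x ^ i * y ^ j \<in> lspan K {x ^ i * y ^ j | i j. j < q}" for i j
  proof (induction j arbitrary: i rule: less_induct)
    case (less j)
    show ?case
    proof (cases "j < q")
      case False
      have "x ^ i * y ^ j = x ^ (i + q + 1) * y ^ (j - q) - x ^ i * y ^ (j - q + 1)"
        using False by (intro mon_reduce) simp
      also have "\<dots> \<in> lspan K {x ^ i * y ^ j | i j. j < q}"
        using False q_gt_1 by (intro lspan_diff[OF K] less) auto
      finally show ?thesis .
    qed (auto intro: lspan_base[OF K])
  qed
  then show "R \<subseteq> lspan K {x ^ i * y ^ j | i j. j < q}" unfolding R_def by (intro lspan_subset[OF K]) auto
qed

lemma R_S: assumes "z \<in> R" obtains n where "z \<in> S n"
proof -
  have "z \<in> lspan K {x ^ i * y ^ j | i j. j < q}" using assms R_eq_reduced by simp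
  then have "\<exists>n. z \<in> S n"
  proof induction
    case (step c e z)
    then obtain n i j where "z \<in> S n" "e = x ^ i * y ^ j" "j < q" by auto
    have "x ^ i * y ^ j \<in> S (max n (wt i j + 1))" by (rule S_mon[OF \<open>j < q\<close>]) simp
    then have "c * e + z \<in> S (max n (wt i j + 1))"
      using step(1) S_mono[of n "max n (wt i j + 1)"] \<open>z \<in> S n\<close> unfolding \<open>e = x ^ i * y ^ j\<close>
      by (intro S_add S_scale[OF step(1)]) auto
    then show ?case by blast
  qed auto
  then show ?thesis using that by blast
qed

text \<open>The monomials \<open>x ^ a * y ^ b\<close> times \<open>z\<close> have all large weights, so that they
  allow to eliminate the monomials of large weight from elements of \<open>R\<close>. For \<open>z = 0\<close> this shows
  that \<open>R\<close> would be finite.\<close>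

lemma reduce_modulo:
  assumes z: "z = c * (x ^ i0 * y ^ j0) + s" "c \<in> K" "c \<noteq> 0" "j0 < q" "s \<in> S (wt i0 j0)" and r: "r \<in> R"
  obtains t w where "t \<in> S (wt i0 j0 + q\<^sup>2)" "w \<in> R" "r = t + z * w"
proof -
  let ?c = "wt i0 j0 + q\<^sup>2"
  define A where "A = {t + z * w | t w. t \<in> S ?c \<and> w \<in> R}"
  have A_add: "f + g \<in> A" if "f \<in> A" "g \<in> A" for f g
  proof -
    obtain t w t' w' where *: "f = t + z * w" "g = t' + z * w'" "t \<in> S ?c" "w \<in> R" "t' \<in> S ?c" "w' \<in> R"
      using \<open>f \<in> A\<close> \<open>g \<in> A\<close> unfolding A_def by blast
    have "f + g = (t + t') + z * (w + w')" using * by (simp add: algebra_simps)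
    then show ?thesis unfolding A_def using * by (blast intro: S_add R_add)
  qed
  have A_scale: "a * f \<in> A" if "f \<in> A" "a \<in> K" for a f
  proof -
    obtain t w where *: "f = t + z * w" "t \<in> S ?c" "w \<in> R"
      using \<open>f \<in> A\<close> unfolding A_def by blast
    have "a * f = (a * t) + z * (a * w)" using * by (simp add: algebra_simps)
    then show ?thesis unfolding A_def using * that by (blast intro: S_scale R_mult R_K)
  qed
  have zA: "z * w \<in> A" if "w \<in> R" for w
  proof -
    have "z * w = 0 + z * w" by simp
    then show ?thesis unfolding A_def using that S_0 by blast
  qed
  have SA: "S n \<subseteq> A" for n
  proof (induction n)
    case 0
    have "S 0 \<subseteq> S ?c" by (rule S_mono) simp
    moreover have "t = t + z * 0" for t by simp
    ultimately show ?case unfolding A_def using R_0 by blast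
  next
    case (Suc n)
    have "x ^ i * y ^ j \<in> A" if ij: "j < q" "wt i j \<le> n" for i j
    proof (cases "wt i j < ?c")
      case True
      moreover have "t = t + z * 0" for t by simp
      ultimately show ?thesis unfolding A_def using R_0 S_mon[OF ij(1)] by blast
    next
      case False
      show ?thesis
      proof (cases "wt i j < n")
        case True
        then show ?thesis using Suc S_mon[OF ij(1)] by blast
      next
        case F: False
        then have n: "wt i j = n" using ij by simp
        \<comment> \<open>The gap to the leading weight of \<open>z\<close> is itself a weight, so
          some \<open>x ^ a * y ^ b * z\<close> has the leading monomial
          \<open>x ^ i * y ^ j\<close>; subtracting a multiple of it leaves terms of weight below
          \<open>n\<close>.\<close>
        have "n - wt i0 j0 \<ge> q\<^sup>2" using False n by simp
        from wt_ex[OF this] obtain a b where b: "b < q" "n - wt i0 j0 = wt a b" by blast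
        then have n2: "n = wt i0 j0 + wt a b" using False n by simp
        have "j0 + b < 2 * q - 1" using z b by simp
        from mon_leading[OF this refl, of "i0 + a"]
        obtain i' j' z' where *: "j' < q" "wt i' j' = wt (i0 + a) (j0 + b)" "z' \<in> S (wt (i0 + a) (j0 + b))"
          "x ^ (i0 + a) * y ^ (j0 + b) = x ^ i' * y ^ j' + z'" by blast
        have n3: "wt (i0 + a) (j0 + b) = n" using n2 by (simp add: algebra_simps)
        then have "i' = i" "j' = j" using wt_inj[of i' j' i j] * ij n by auto
        then have "x ^ i * y ^ j = x ^ (i0 + a) * y ^ (j0 + b) - z'" using *(4) by simp
        also have "x ^ (i0 + a) * y ^ (j0 + b) = z * (inverse c * (x ^ a * y ^ b)) + (- inverse c) * (x ^ a * y ^ b * s)"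
          unfolding z(1) using z(3) by (simp add: algebra_simps power_add)
        also have "\<dots> - z' = z * (inverse c * (x ^ a * y ^ b)) + ((- inverse c) * (x ^ a * y ^ b * s) - z')" by simp
        finally have e: "x ^ i * y ^ j = \<dots>" .
        have "x ^ a * y ^ b * s \<in> S n" using S_mult_mon[OF b(1) z(5), of a] n2 by simp
        moreover have "z' \<in> S n" using *(3) n3 by simp
        ultimately have "(- inverse c) * (x ^ a * y ^ b * s) - z' \<in> S n"
          using S_scale[OF K_closed(4)[OF K_closed(7)[OF z(2)]]] by (intro S_diff) auto
        then show ?thesis unfolding e using Suc z(2) K_closed(7) by (intro A_add zA R_mult R_K R_mon) auto
      qed
    qed
    then have mon: "e \<in> A" if "e \<in> {x ^ i * y ^ j | i j. j < q \<and> wt i j < Suc n}" for e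
      using that by auto
    show ?case
    proof
      fix f assume "f \<in> S (Suc n)"
      then show "f \<in> A" unfolding S_def
      proof induction
        case zero
        have "0 = 0 + z * 0" by simp
        then show ?case unfolding A_def using S_0 R_0 by blast
      next
        case (step a e f)
        then show ?case using mon A_add A_scale by blast
      qed
    qed
  qed
  obtain n where "r \<in> S n" using R_S[OF r] .
  then show ?thesis using SA that unfolding A_def by blast
qed

lemma infinite_R: "infinite R"
proof
  assume "finite R"
  moreover have "range (\<lambda>k::nat. x ^ k) \<subseteq> R" by (auto intro: R_closed)
  ultimately have "finite (range (\<lambda>k::nat. x ^ k))" by (rule finite_subset[rotated])
  then show False using x_power_inj finite_imageD by blast
qed

lemma leading_monomial:
  assumes "finite I" and I: "\<forall>(i, j)\<in>I. j < q \<and> c i j \<in> K"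
    and "(i1, j1) \<in> I" "c i1 j1 \<noteq> 0"
  shows "\<exists>i0 j0 s. (i0, j0) \<in> I \<and> c i0 j0 \<noteq> 0 \<and> s \<in> S (wt i0 j0) \<and>
    (\<Sum>(i, j)\<in>I. c i j * (x ^ i * y ^ j)) = c i0 j0 * (x ^ i0 * y ^ j0) + s"
proof -
  let ?I = "{p \<in> I. c (fst p) (snd p) \<noteq> 0}" and ?w = "\<lambda>p. wt (fst p) (snd p)"
  have fin: "finite ?I" and ne: "?I \<noteq> {}" using assms by auto
  obtain p where p: "p \<in> ?I" "\<And>r. r \<in> ?I \<Longrightarrow> ?w r \<le> ?w p"
    using Max_in[of "?w ` ?I"] Max_ge[of "?w ` ?I"] fin ne
    by (smt (verit) finite_imageI image_iff image_is_empty)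
  obtain i0 j0 where ij: "p = (i0, j0)" by (cases p)
  have "(\<Sum>(i, j)\<in>I. c i j * (x ^ i * y ^ j)) = (\<Sum>(i, j)\<in>?I. c i j * (x ^ i * y ^ j))"
    by (rule sum.mono_neutral_right) (use assms(1) in auto)
  also have "\<dots> = c i0 j0 * (x ^ i0 * y ^ j0) + (\<Sum>(i, j)\<in>?I - {p}. c i j * (x ^ i * y ^ j))"
    using p ij fin by (simp add: sum.remove[of ?I p])
  finally have eq: "(\<Sum>(i, j)\<in>I. c i j * (x ^ i * y ^ j)) = \<dots>" .
  have "(\<Sum>(i, j)\<in>?I - {p}. c i j * (x ^ i * y ^ j)) \<in> S (wt i0 j0)"
  proof (intro S_sum)
    fix r assume r: "r \<in> ?I - {p}"
    obtain i j where rij: "r = (i, j)" by (cases r)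
    have "wt i j \<noteq> wt i0 j0" using wt_inj[of i j i0 j0] r p ij rij bspec[OF I, of r] bspec[OF I, of p] by auto
    then have "wt i j < wt i0 j0" using p(2)[of r] r rij ij by auto
    then have "c i j * (x ^ i * y ^ j) \<in> S (wt i0 j0)"
      using r rij assms(1) I by (intro S_scale S_mon) auto
    then show "(case r of (i, j) \<Rightarrow> c i j * (x ^ i * y ^ j)) \<in> S (wt i0 j0)" using rij by simp
  qed
  then show ?thesis using eq p ij by auto
qed

text \<open>This plays the part of the irreducibility of \<open>T ^ q + T - x ^ (q + 1)\<close>: a
  nontrivial relation exhibits 0 as an element with a leading monomial, and reduction modulo 0 would
  make \<open>R\<close> finite.\<close>

lemma reduced_independent:
  assumes I: "finite I" "\<forall>(i, j)\<in>I. j < q \<and> c i j \<in> K"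
    and z: "(\<Sum>(i, j)\<in>I. c i j * (x ^ i * y ^ j)) = 0" and ij: "(i, j) \<in> I"
  shows "c i j = 0"
proof (rule ccontr)
  assume "c i j \<noteq> 0"
  from leading_monomial[of I c i j, OF I ij this] obtain i0 j0 s where *: "(i0, j0) \<in> I" "c i0 j0 \<noteq> 0" "s \<in> S (wt i0 j0)"
    "(\<Sum>(i, j)\<in>I. c i j * (x ^ i * y ^ j)) = c i0 j0 * (x ^ i0 * y ^ j0) + s" by blast
  have c0: "c i0 j0 \<in> K" "j0 < q" using I *(1) by auto
  have z0: "0 = c i0 j0 * (x ^ i0 * y ^ j0) + s" using *(4) z by simp
  have "R \<subseteq> S (wt i0 j0 + q\<^sup>2)"
  proof
    fix r assume "r \<in> R"
    from reduce_modulo[OF z0 c0(1) *(2) c0(2) *(3) this]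
    show "r \<in> S (wt i0 j0 + q\<^sup>2)" by auto
  qed
  then show False using finite_S infinite_R finite_subset by blast
qed

lemma R_rep:
  assumes "z \<in> R"
  obtains I c where "finite I" "\<forall>(i, j)\<in>I. j < q \<and> c i j \<in> K"
    "z = (\<Sum>(i, j)\<in>I. c i j * (x ^ i * y ^ j))"
proof -
  obtain n where "z \<in> S n" using R_S[OF assms] .
  let ?I = "{(i, j). j < q \<and> wt i j < n}"
  have fin: "finite ?I"
  proof (rule finite_subset)
    show "?I \<subseteq> {..n} \<times> {..<q}"
    proof clarify
      fix i j assume *: "j < q" "wt i j < n"
      have "i \<le> q * i" using q_gt_1 by simp
      then have "i \<le> n" using *(2) by linarith
      then show "i \<in> {..n} \<and> j \<in> {..<q}" using * by auto
    qed
  qed simp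
  have "{x ^ i * y ^ j | i j. j < q \<and> wt i j < n} = (\<lambda>(i, j). x ^ i * y ^ j) ` ?I" by auto
  then have "z \<in> lspan K ((\<lambda>(i, j). x ^ i * y ^ j) ` ?I)" using \<open>z \<in> S n\<close> unfolding S_def by simp
  from lspan_image_rep[OF K fin this] obtain c where c: "\<And>p. p \<in> ?I \<Longrightarrow> c p \<in> K"
    "z = (\<Sum>p\<in>?I. c p * (case p of (i, j) \<Rightarrow> x ^ i * y ^ j))" by blast
  show ?thesis
    by (rule that[of ?I "\<lambda>i j. c (i, j)"]) (use fin c in \<open>auto simp: case_prod_unfold\<close>)
qed

lemma R_leading:
  assumes "z \<in> R" "z \<noteq> 0"
  obtains c i j s where "c \<in> K" "c \<noteq> 0" "j < q" "s \<in> S (wt i j)" "z = c * (x ^ i * y ^ j) + s"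
proof -
  obtain I c where I: "finite I" "\<forall>(i, j)\<in>I. j < q \<and> c i j \<in> K"
    "z = (\<Sum>(i, j)\<in>I. c i j * (x ^ i * y ^ j))" by (rule R_rep[OF assms(1)])
  have "\<exists>i j. (i, j) \<in> I \<and> c i j \<noteq> 0"
  proof (rule ccontr)
    assume "\<not> ?thesis"
    then have "(\<Sum>(i, j)\<in>I. c i j * (x ^ i * y ^ j)) = 0" by (intro sum.neutral) auto
    then show False using I assms by simp
  qed
  then obtain i1 j1 where ij: "(i1, j1) \<in> I" "c i1 j1 \<noteq> 0" by blast
  from leading_monomial[of I c i1 j1, OF I(1,2) ij] obtain i0 j0 s where
    *: "(i0, j0) \<in> I" "c i0 j0 \<noteq> 0" "s \<in> S (wt i0 j0)"
    "(\<Sum>(i, j)\<in>I. c i j * (x ^ i * y ^ j)) = c i0 j0 * (x ^ i0 * y ^ j0) + s" by blast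
  then show ?thesis using that[of "c i0 j0" j0 s i0] I by auto
qed

text \<open>This finiteness takes the place of Noetherian arguments: it gives the Frobenius
  exponents of the residue fields and the finiteness of orders at a prime.\<close>

lemma finite_quotient:
  assumes "z \<in> R" "z \<noteq> 0"
  obtains T where "finite T" "T \<subseteq> R" "\<forall>r\<in>R. \<exists>t\<in>T. \<exists>w\<in>R. r = t + z * w"
proof -
  obtain c i j s where *: "c \<in> K" "c \<noteq> 0" "j < q" "s \<in> S (wt i j)" "z = c * (x ^ i * y ^ j) + s"
    by (rule R_leading[OF assms])
  show ?thesis
  proof (rule that[of "S (wt i j + q\<^sup>2)"])
    have "\<exists>t\<in>S (wt i j + q\<^sup>2). \<exists>w\<in>R. r = t + z * w" if "r \<in> R" for r
      using reduce_modulo[OF *(5,1,2,3,4) that] by blast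
    then show "\<forall>r\<in>R. \<exists>t\<in>S (wt i j + q\<^sup>2). \<exists>w\<in>R. r = t + z * w" by blast
  qed (use finite_S S_R in auto)
qed

end

section \<open>Places and prime ideals of the affine coordinate ring\<close>

context hermitian
begin

text \<open>The zero ideal is excluded, so these are the maximal ideals of \<open>R\<close>; they
  correspond to the places where \<open>x\<close> has no pole.\<close>

definition prime_ideal :: "'f set \<Rightarrow> bool" where
  "prime_ideal \<pp> \<longleftrightarrow> \<pp> \<subseteq> R \<and> (\<exists>z\<in>\<pp>. z \<noteq> 0) \<and> 1 \<notin> \<pp> \<and> (\<forall>a\<in>\<pp>. \<forall>b\<in>\<pp>. a + b \<in> \<pp>) \<and>
     (\<forall>a\<in>R. \<forall>b\<in>\<pp>. a * b \<in> \<pp>) \<and> (\<forall>a\<in>R. \<forall>b\<in>R. a * b \<in> \<pp> \<longrightarrow> a \<in> \<pp> \<or> b \<in> \<pp>)"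

lemma x_frob_nz: assumes "k > 0" shows "x ^ q ^ (2 * k) - x \<noteq> 0"
proof
  assume "x ^ q ^ (2 * k) - x = 0"
  then have "x ^ q ^ (2 * k) = x ^ 1" by simp
  then have "q ^ (2 * k) = 1" using x_power_inj unfolding inj_def by blast
  then show False using q_gt_1 assms by simp
qed

context
  fixes \<pp>
  assumes pp: "prime_ideal \<pp>"
begin

lemma p_subset: "a \<in> \<pp> \<Longrightarrow> a \<in> R" and p_1: "1 \<notin> \<pp>" and p_add: "a \<in> \<pp> \<Longrightarrow> b \<in> \<pp> \<Longrightarrow> a + b \<in> \<pp>"
  and p_mult: "a \<in> R \<Longrightarrow> b \<in> \<pp> \<Longrightarrow> a * b \<in> \<pp>" and p_mult': "b \<in> \<pp> \<Longrightarrow> a \<in> R \<Longrightarrow> b * a \<in> \<pp>"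
  and p_prime: "a \<in> R \<Longrightarrow> b \<in> R \<Longrightarrow> a * b \<in> \<pp> \<Longrightarrow> a \<in> \<pp> \<or> b \<in> \<pp>"
  using pp unfolding prime_ideal_def by (auto simp: mult.commute)

lemma p_0: "0 \<in> \<pp>" using pp p_mult[of 0] unfolding prime_ideal_def by auto

lemma p_uminus: "a \<in> \<pp> \<Longrightarrow> - a \<in> \<pp>" using p_mult[of "- 1" a] R_uminus[OF R_1] by simp

lemma p_diff: "a \<in> \<pp> \<Longrightarrow> b \<in> \<pp> \<Longrightarrow> a - b \<in> \<pp>" using p_add[of a "- b"] p_uminus by simp

lemma p_power: "a \<in> R \<Longrightarrow> a ^ n \<in> \<pp> \<Longrightarrow> a \<in> \<pp>"
proof (induction n)
  case (Suc n)
  then show ?case using p_prime[of a "a ^ n"] R_power by auto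
qed (use p_1 in simp)

lemma p_power_in: "a \<in> \<pp> \<Longrightarrow> n > 0 \<Longrightarrow> a ^ n \<in> \<pp>"
  using p_mult[OF R_power[OF p_subset], of a a "n - 1"] power_minus_mult[of n a] by simp

text \<open>Modulo the prime, the Frobenius iterates of \<open>x\<close> and \<open>y\<close> take
  finitely many values, so two of them, with numbers \<open>i < j\<close>, agree on both. The
  difference is the \<open>q ^ (2 * i)\<close>-th power of \<open>w ^ q ^ (2 * k) - w\<close> with
  \<open>k = j - i\<close>, so the prime contains the base; induction extends this from the
  generators to \<open>R\<close>.\<close>

lemma frobenius_exponent: obtains k where "k > 0" "\<forall>z\<in>R. z ^ q ^ (2 * k) - z \<in> \<pp>"
proof -
  obtain z where z: "z \<in> \<pp>" "z \<noteq> 0" using pp unfolding prime_ideal_def by blast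
  obtain T where T: "finite T" "T \<subseteq> R" "\<forall>r\<in>R. \<exists>t\<in>T. \<exists>w\<in>R. r = t + z * w"
    by (rule finite_quotient[OF p_subset[OF z(1)] z(2)])
  have "\<forall>r\<in>R. \<exists>t\<in>T. r - t \<in> \<pp>"
  proof
    fix r assume "r \<in> R"
    then obtain t w where tw: "t \<in> T" "w \<in> R" "r = t + z * w" using T(3) by blast
    then have "r - t \<in> \<pp>" using p_mult'[OF z(1) tw(2)] by simp
    then show "\<exists>t\<in>T. r - t \<in> \<pp>" using tw(1) by blast
  qed
  then obtain \<rho> where \<rho>: "\<And>r. r \<in> R \<Longrightarrow> \<rho> r \<in> T \<and> r - \<rho> r \<in> \<pp>" by metis
  define f where "f i = (\<rho> (x ^ q ^ (2 * i)), \<rho> (y ^ q ^ (2 * i)))" for i :: nat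
  have "range f \<subseteq> T \<times> T" using \<rho> unfolding f_def by (auto intro: R_power)
  then have "finite (range f)" using T(1) finite_subset by blast
  then obtain i j where ij: "i < j" "f i = f j" by (rule infinite_orbit_collision)
  define k where "k = j - i"
  have j: "2 * k + 2 * i = 2 * j" using ij k_def by simp
  have main: "w ^ q ^ (2 * k) - w \<in> \<pp>" if "w \<in> R" "\<rho> (w ^ q ^ (2 * i)) = \<rho> (w ^ q ^ (2 * j))" for w
  proof -
    have "(w ^ q ^ (2 * j) - \<rho> (w ^ q ^ (2 * j))) - (w ^ q ^ (2 * i) - \<rho> (w ^ q ^ (2 * i))) \<in> \<pp>"
      using \<rho>[OF R_power[OF that(1)]] by (intro p_diff[of "w ^ q ^ (2 * j) - _"]) auto
    then have "w ^ q ^ (2 * j) - w ^ q ^ (2 * i) \<in> \<pp>" using that by simp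
    also have "w ^ q ^ (2 * j) - w ^ q ^ (2 * i) = (w ^ q ^ (2 * k) - w) ^ q ^ (2 * i)"
      by (simp only: diff_power_q frob_power j)
    finally show ?thesis using p_power[rotated] that by (auto intro: R_diff R_power)
  qed
  have "z ^ q ^ (2 * k) - z \<in> \<pp>" if "z \<in> R" for z
    using that
  proof (induction rule: R_induct)
    case (const a)
    then show ?case using K_frob p_0 by simp
  next
    case (add z w)
    then show ?case using p_add[of "z ^ q ^ (2 * k) - z" "w ^ q ^ (2 * k) - w"]
      by (simp add: add_power_q algebra_simps)
  next
    case (mult z w)
    have "(z * w) ^ q ^ (2 * k) - z * w = z ^ q ^ (2 * k) * (w ^ q ^ (2 * k) - w) + w * (z ^ q ^ (2 * k) - z)"
      by (simp add: power_mult_distrib algebra_simps)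
    then show ?case using mult by (auto intro: p_add p_mult R_power)
  qed (use main[of x] main[of y] ij in \<open>auto simp: f_def\<close>)
  then show ?thesis using that[of k] ij k_def by simp
qed

context
  fixes k :: nat
  assumes k: "k > 0" and frob: "\<And>z. z \<in> R \<Longrightarrow> z ^ q ^ (2 * k) - z \<in> \<pp>"
begin

text \<open>The element \<open>x ^ q ^ (2 * k) - x\<close> is a uniformizer at \<open>\<pp>\<close>, as its derivative is \<open>- 1\<close>.\<close>

lemma p_local_generator:
  assumes "z \<in> \<pp>"
  obtains s w where "s \<in> R" "s \<notin> \<pp>" "w \<in> R" "s * z = (x ^ q ^ (2 * k) - x) * w"
proof -
  let ?Q = "q ^ (2 * k)" and ?t = "x ^ q ^ (2 * k) - x"
  \<comment> \<open>\<open>J\<close> is the ideal generated by \<open>?t\<close> in the localisation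
    at the prime, intersected with \<open>R\<close>; \<open>J_cancel\<close> removes factors that
    are units there.\<close>
  define J where "J = {z \<in> R. \<exists>s w. s \<in> R \<and> s \<notin> \<pp> \<and> w \<in> R \<and> s * z = ?t * w}"
  have J_add: "a + b \<in> J" if ab: "a \<in> J" "b \<in> J" for a b
  proof -
    obtain s w s' w' where *: "s \<in> R" "s \<notin> \<pp>" "w \<in> R" "s * a = ?t * w" "s' \<in> R" "s' \<notin> \<pp>" "w' \<in> R"
      "s' * b = ?t * w'" "a \<in> R" "b \<in> R" using ab unfolding J_def by blast
    have "(s * s') * (a + b) = s' * (s * a) + s * (s' * b)" by (simp add: algebra_simps)
    also have "\<dots> = ?t * (s' * w + s * w')" unfolding *(4,8) by (simp add: algebra_simps)
    finally have "(s * s') * (a + b) = ?t * (s' * w + s * w')" .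
    moreover have "s * s' \<notin> \<pp>" using * p_prime by blast
    moreover have "s * s' \<in> R" "s' * w + s * w' \<in> R" "a + b \<in> R" using * by (auto intro: R_closed)
    ultimately show ?thesis unfolding J_def by blast
  qed
  have J_mult: "a * b \<in> J" if ab: "a \<in> R" "b \<in> J" for a b
  proof -
    obtain s w where *: "s \<in> R" "s \<notin> \<pp>" "w \<in> R" "s * b = ?t * w" "b \<in> R"
      using ab unfolding J_def by blast
    have "s * (a * b) = a * (s * b)" by (simp add: algebra_simps)
    also have "\<dots> = ?t * (a * w)" unfolding *(4) by (simp add: algebra_simps)
    finally have "s * (a * b) = ?t * (a * w)" .
    moreover have "a * w \<in> R" "a * b \<in> R" using * ab by (auto intro: R_closed)
    ultimately show ?thesis unfolding J_def using * by blast
  qed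
  have J_cancel: "b \<in> J" if ab: "a \<in> R" "a \<notin> \<pp>" "b \<in> R" "a * b \<in> J" for a b
  proof -
    obtain s w where *: "s \<in> R" "s \<notin> \<pp>" "w \<in> R" "s * (a * b) = ?t * w"
      using ab unfolding J_def by blast
    then have "(s * a) * b = ?t * w" by (simp add: mult.assoc)
    moreover have "s * a \<in> R" "s * a \<notin> \<pp>" using * ab p_prime by (auto intro: R_closed)
    ultimately show ?thesis unfolding J_def using * ab by blast
  qed
  have tR: "?t \<in> R" by (auto intro!: R_closed)
  have tJ: "?t \<in> J" unfolding J_def using tR p_1 R_1 by fastforce
  have J_neg: "- a \<in> J" if "a \<in> J" for a using J_mult[OF R_uminus[OF R_1] that] by simp
  have main: "z ^ ?Q - z \<in> J" if "z \<in> R" for z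
    using that
  proof (induction rule: R_induct)
    case (const a)
    then show ?case using K_frob J_mult[OF R_0 tJ] by simp
  next
    case (add z w)
    then show ?case using J_add[of "z ^ ?Q - z" "w ^ ?Q - w"]
      by (simp add: add_power_q algebra_simps)
  next
    case (mult z w)
    have "(z * w) ^ ?Q - z * w = z ^ ?Q * (w ^ ?Q - w) + w * (z ^ ?Q - z)"
      by (simp add: power_mult_distrib algebra_simps)
    then show ?case using mult by (auto intro: J_add J_mult R_power)
  next
    case y
    let ?s = "y ^ ?Q - y"
    have sR: "?s \<in> R" by (auto intro!: R_closed)
    \<comment> \<open>Raising the curve equation to the power \<open>?Q\<close> shows that
      \<open>?s ^ q + ?s\<close> is divisible by \<open>?t\<close>. The cofactor
      \<open>1 + ?s ^ (q - 1)\<close> is a unit at the prime, since \<open>?s\<close> lies in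
      it.\<close>
    have "?s * (1 + ?s ^ (q - 1)) = ?s + ?s ^ q"
      using q_gt_1 by (cases q) (auto simp: algebra_simps)
    also have "?s ^ q = (y ^ q) ^ ?Q - y ^ q"
      by (simp add: frob1 power_mult[symmetric] mult.commute)
    also have "?s + \<dots> = (y ^ q + y) ^ ?Q - (y ^ q + y)" by (simp add: add_power_q)
    also have "\<dots> = (x ^ ?Q) ^ (q + 1) - x ^ (q + 1)" unfolding curve[symmetric]
      by (simp only: power_mult[symmetric] mult.commute)
    also have "\<dots> = (\<Sum>i<Suc q. (x ^ ?Q) ^ i * x ^ (q - i)) * ?t"
      using diff_power_eq_sum[of "x ^ ?Q" q x] by (simp only: mult.commute Suc_eq_plus1)
    finally have eq: "?s * (1 + ?s ^ (q - 1)) = \<dots>" .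
    have "\<dots> \<in> J" by (intro J_mult tJ R_sum R_mult R_power R_x)
    then have J1: "(1 + ?s ^ (q - 1)) * ?s \<in> J" unfolding eq[symmetric] by (simp add: mult.commute)
    have "?s ^ (q - 1) \<in> \<pp>" using frob[OF R_y] q_gt_1 by (intro p_power_in) auto
    then have "1 + ?s ^ (q - 1) \<notin> \<pp>" using p_diff[of "1 + ?s ^ (q - 1)" "?s ^ (q - 1)"] p_1 by auto
    then show ?case using J_cancel[OF R_add[OF R_1 R_power[OF sR]] _ sR J1] by blast
  next
    case x
    then show ?case by (rule tJ)
  qed
  have zR: "z \<in> R" using assms p_subset by blast
  have Q: "?Q > 1" using one_less_power[OF q_gt_1, of "2 * k"] k by simp
  \<comment> \<open>For \<open>z\<close> in the prime the factor \<open>1 - z ^ (?Q - 1)\<close> is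
    a unit there, so \<open>z\<close> itself belongs to \<open>J\<close>.\<close>
  have "(1 - z ^ (?Q - 1)) * z = - (z ^ ?Q - z)"
    using power_minus_mult[of ?Q z] Q q_gt_1 by (simp add: left_diff_distrib)
  then have "(1 - z ^ (?Q - 1)) * z \<in> J" using J_neg[OF main[OF zR]] by simp
  moreover have "z ^ (?Q - 1) \<in> \<pp>" using assms Q by (intro p_power_in) auto
  then have "1 - z ^ (?Q - 1) \<notin> \<pp>" using p_add[of "1 - z ^ (?Q - 1)" "z ^ (?Q - 1)"] p_1 by auto
  ultimately have "z \<in> J" using J_cancel[OF R_diff[OF R_1 R_power[OF zR]] _ zR] by blast
  then show ?thesis using that unfolding J_def by blast
qed

text \<open>Write t for the uniformizer. If \<open>z\<close> were divisible by all powers of t at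
  the prime, a collision of t^i and t^j modulo \<open>z\<close> would make t^i (1 - t^(j - i))
  divisible by t^(i + 1), although the second factor is a unit.\<close>

lemma p_order_exists:
  assumes "z \<in> R" "z \<noteq> 0"
  obtains n s w where "s \<in> R" "s \<notin> \<pp>" "w \<in> R" "w \<notin> \<pp>" "s * z = (x ^ q ^ (2 * k) - x) ^ n * w"
proof (rule ccontr)
  assume "\<not> thesis"
  note contr = this
  let ?t = "x ^ q ^ (2 * k) - x"
  have tp: "?t \<in> \<pp>" by (rule frob) simp
  have tnz: "?t \<noteq> 0" by (rule x_frob_nz[OF k])
  have all: "\<exists>s w. s \<in> R \<and> s \<notin> \<pp> \<and> w \<in> R \<and> s * z = ?t ^ n * w" for n
  proof (induction n)
    case 0
    then show ?case using assms p_1 by (intro exI[of _ 1] exI[of _ z]) auto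
  next
    case (Suc n)
    then obtain s w where *: "s \<in> R" "s \<notin> \<pp>" "w \<in> R" "s * z = ?t ^ n * w" by blast
    then have "w \<in> \<pp>" using contr that[of s w n] by blast
    then obtain s' w' where **: "s' \<in> R" "s' \<notin> \<pp>" "w' \<in> R" "s' * w = ?t * w'"
      by (rule p_local_generator)
    have "(s' * s) * z = ?t ^ n * (s' * w)" using *(4) by (simp add: mult_ac)
    also have "\<dots> = ?t ^ Suc n * w'" unfolding **(4) by (simp add: mult_ac)
    finally have "(s' * s) * z = ?t ^ Suc n * w'" .
    moreover have "s' * s \<notin> \<pp>" "s' * s \<in> R" using * ** p_prime by (auto intro: R_mult)
    ultimately show ?case using **(3) by blast
  qed
  obtain T where T: "finite T" "T \<subseteq> R" "\<forall>r\<in>R. \<exists>t\<in>T. \<exists>w\<in>R. r = t + z * w"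
    by (rule finite_quotient[OF assms])
  have tR: "?t \<in> R" using p_subset tp by blast
  have "\<forall>n. \<exists>t\<in>T. \<exists>w\<in>R. ?t ^ n = t + z * w" using T(3) R_power[OF tR] by blast
  then obtain f g where f: "\<And>n. f n \<in> T \<and> g n \<in> R \<and> ?t ^ n = f n + z * g n" by metis
  have "finite (range f)" using T(1) f by (meson finite_subset image_subsetI)
  then obtain i j where ij: "i < j" "f i = f j" by (rule infinite_orbit_collision)
  obtain s w where *: "s \<in> R" "s \<notin> \<pp>" "w \<in> R" "s * z = ?t ^ Suc i * w" using all by blast
  have "?t ^ i - ?t ^ j = z * (g i - g j)" using f[of i] f[of j] ij by (simp add: algebra_simps)
  then have "s * (?t ^ i - ?t ^ j) = ?t ^ Suc i * w * (g i - g j)" using *(4) by (simp add: mult.assoc[symmetric])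
  moreover have "?t ^ j = ?t ^ i * ?t ^ (j - i)" using ij by (simp add: power_add[symmetric])
  ultimately have "?t ^ i * (s * (1 - ?t ^ (j - i))) = ?t ^ i * (?t * (w * (g i - g j)))"
    by (simp add: algebra_simps)
  then have "s * (1 - ?t ^ (j - i)) = ?t * (w * (g i - g j))" using tnz by simp
  also have "\<dots> \<in> \<pp>" using tp * f by (intro p_mult' R_mult R_diff) auto
  finally have "1 - ?t ^ (j - i) \<in> \<pp>" using p_prime[OF *(1) R_diff[OF R_1 R_power[OF tR]]] *(2) by blast
  from p_add[OF this p_power_in[OF tp, of "j - i"]] show False using ij p_1 by simp
qed

abbreviation "unit_at_p s \<equiv> s \<in> R \<and> s \<notin> \<pp>"

lemma unit_mult: "unit_at_p s \<Longrightarrow> unit_at_p s' \<Longrightarrow> unit_at_p (s * s')"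
  using p_prime R_mult by blast

lemma unit_nz: "unit_at_p s \<Longrightarrow> s \<noteq> 0" using p_0 by auto

lemma p_rep_exists:
  assumes "f \<noteq> 0"
  obtains n s w where "unit_at_p s" "unit_at_p w" "f * s = (x ^ q ^ (2 * k) - x) powi n * w"
proof -
  let ?t = "x ^ q ^ (2 * k) - x"
  obtain z d where f: "z \<in> R" "d \<in> R" "d \<noteq> 0" "f = z / d" by (rule fractions)
  then have "z \<noteq> 0" using assms by auto
  from p_order_exists[OF f(1) this] obtain n s w where 1: "s \<in> R" "s \<notin> \<pp>" "w \<in> R" "w \<notin> \<pp>" "s * z = ?t ^ n * w" .
  from p_order_exists[OF f(2,3)] obtain n' s' w' where 2: "s' \<in> R" "s' \<notin> \<pp>" "w' \<in> R" "w' \<notin> \<pp>" "s' * d = ?t ^ n' * w'" .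
  have tnz: "?t \<noteq> 0" by (rule x_frob_nz[OF k])
  have nz: "s \<noteq> 0" "w \<noteq> 0" "s' \<noteq> 0" "w' \<noteq> 0" using 1 2 unit_nz by blast+
  have z: "z = ?t ^ n * w / s" "d = ?t ^ n' * w' / s'" using 1(5) 2(5) nz by (simp_all add: field_simps)
  have "f * (s * w') = (?t ^ n / ?t ^ n') * (w * s')"
    unfolding f(4) z using nz tnz by (simp add: field_simps)
  also have "?t ^ n / ?t ^ n' = ?t powi (int n - int n')" using tnz by (simp add: power_int_diff)
  finally show ?thesis using that[of "s * w'" "w * s'"] 1 2 unit_mult by blast
qed

text \<open>\<open>s'\<close> is only asked to lie in \<open>R\<close>. Thus one comparison gives
  the uniqueness of the exponent, the ultrametric inequality, non-negativity on \<open>R\<close> and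
  positivity on the prime.\<close>

lemma p_rep_compare:
  assumes "unit_at_p s" "unit_at_p w" "f * s = (x ^ q ^ (2 * k) - x) powi n * w"
    and "s' \<in> R" "unit_at_p w'" "f * w' = (x ^ q ^ (2 * k) - x) powi n' * s'"
  shows "n' \<le> n"
proof (rule ccontr)
  let ?t = "x ^ q ^ (2 * k) - x"
  assume "\<not> n' \<le> n"
  then obtain d where d: "n' = n + int (Suc d)" by (metis zless_iff_Suc_zadd not_le)
  have tnz: "?t \<noteq> 0" by (rule x_frob_nz[OF k])
  have "?t powi n * (w * w') = f * s * w'" unfolding assms(3) by (simp add: mult.assoc)
  also have "\<dots> = ?t powi n' * s' * s" using assms(6) by (simp add: mult_ac)
  also have "?t powi n' = ?t powi n * ?t ^ Suc d" unfolding d power_int_add[OF disjI1[OF tnz]] by (simp only: power_int_of_nat)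
  finally have "w * w' = ?t * (?t ^ d * s' * s)" using tnz by (simp add: mult_ac)
  also have "\<dots> \<in> \<pp>" using assms frob[OF R_x] by (intro p_mult' R_mult R_power) (auto intro: R_closed)
  finally show False using unit_mult[OF assms(2,5)] by blast
qed

definition p_val :: "'f \<Rightarrow> int" where
  "p_val f = (if f = 0 then 0 else THE n. \<exists>s w. unit_at_p s \<and> unit_at_p w \<and> f * s = (x ^ q ^ (2 * k) - x) powi n * w)"

lemma p_val_eqI:
  assumes "unit_at_p s" "unit_at_p w" "f * s = (x ^ q ^ (2 * k) - x) powi n * w"
  shows "p_val f = n"
proof -
  have "f \<noteq> 0" using assms unit_nz x_frob_nz[OF k] by auto
  moreover have "(THE n. \<exists>s w. unit_at_p s \<and> unit_at_p w \<and> f * s = (x ^ q ^ (2 * k) - x) powi n * w) = n"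
  proof (rule the_equality)
    fix n' assume "\<exists>s w. unit_at_p s \<and> unit_at_p w \<and> f * s = (x ^ q ^ (2 * k) - x) powi n' * w"
    then obtain s' w' where *: "unit_at_p s'" "unit_at_p w'" "f * s' = (x ^ q ^ (2 * k) - x) powi n' * w'" by blast
    show "n' = n" using p_rep_compare[OF assms _ *(1,3)] p_rep_compare[OF * _ assms(1,3)] assms * by auto
  qed (use assms in blast)
  ultimately show ?thesis unfolding p_val_def by simp
qed

lemma p_val_rep:
  assumes "f \<noteq> 0"
  obtains s w where "unit_at_p s" "unit_at_p w" "f * s = (x ^ q ^ (2 * k) - x) powi (p_val f) * w"
proof -
  obtain n s w where *: "unit_at_p s" "unit_at_p w" "f * s = (x ^ q ^ (2 * k) - x) powi n * w"
    by (rule p_rep_exists[OF assms])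
  then show ?thesis using that[OF *(1,2)] p_val_eqI[OF *] by simp
qed

lemma p_val_unit: "unit_at_p s \<Longrightarrow> p_val s = 0"
  by (rule p_val_eqI[of 1 s]) (use p_1 in auto)

lemma p_val_place: "is_place K p_val"
proof -
  let ?t = "x ^ q ^ (2 * k) - x"
  have tnz: "?t \<noteq> 0" by (rule x_frob_nz[OF k])
  have tR: "?t \<in> R" using p_subset frob[OF R_x] by blast
  have 1: "p_val a = 0" if "a \<in> K" for a
  proof (cases "a = 0")
    case False
    have "a \<notin> \<pp>"
    proof
      assume "a \<in> \<pp>"
      then have "inverse a * a \<in> \<pp>" using that by (intro p_mult) (auto intro: R_K K_closed)
      then show False using False p_1 by simp
    qed
    then show ?thesis using p_val_unit R_K[OF that] by blast
  qed (simp add: p_val_def)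
  have 2: "p_val (f * g) = p_val f + p_val g" if nz: "f \<noteq> 0" "g \<noteq> 0" for f g
  proof -
    from p_val_rep[OF nz(1)] obtain s w where f: "unit_at_p s" "unit_at_p w" "f * s = ?t powi (p_val f) * w" .
    from p_val_rep[OF nz(2)] obtain s' w' where g: "unit_at_p s'" "unit_at_p w'" "g * s' = ?t powi (p_val g) * w'" .
    have "(f * g) * (s * s') = (f * s) * (g * s')" by (simp add: mult_ac)
    also have "\<dots> = ?t powi (p_val f + p_val g) * (w * w')"
      unfolding f(3) g(3) power_int_add[OF disjI1[OF tnz]] by (simp add: mult_ac)
    finally show ?thesis by (rule p_val_eqI[OF unit_mult[OF f(1) g(1)] unit_mult[OF f(2) g(2)]])
  qed
  have 3: "min (p_val f) (p_val g) \<le> p_val (f + g)" if nz: "f \<noteq> 0" "g \<noteq> 0" "f + g \<noteq> 0" for f g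
  proof -
    let ?n = "min (p_val f) (p_val g)"
    from p_val_rep[OF nz(1)] obtain s w where f: "unit_at_p s" "unit_at_p w" "f * s = ?t powi (p_val f) * w" .
    from p_val_rep[OF nz(2)] obtain s' w' where g: "unit_at_p s'" "unit_at_p w'" "g * s' = ?t powi (p_val g) * w'" .
    from p_val_rep[OF nz(3)] obtain s'' w'' where fg: "unit_at_p s''" "unit_at_p w''" "(f + g) * s'' = ?t powi (p_val (f + g)) * w''" .
    have pw: "?t powi i = ?t powi ?n * ?t ^ nat (i - ?n)" if "?n \<le> i" for i
    proof -
      have "i = ?n + int (nat (i - ?n))" using that by simp
      then show ?thesis by (metis power_int_add[OF disjI1[OF tnz]] power_int_of_nat)
    qed
    have "(f + g) * (s * s') = (f * s) * s' + (g * s') * s" by (simp add: algebra_simps)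
    also have "\<dots> = ?t powi ?n * (?t ^ nat (p_val f - ?n) * w * s' + ?t ^ nat (p_val g - ?n) * w' * s)"
      unfolding f(3) g(3) using pw[of "p_val f"] pw[of "p_val g"] by (simp add: algebra_simps)
    finally have eq: "(f + g) * (s * s') = \<dots>" .
    show ?thesis
      by (rule p_rep_compare[OF fg _ unit_mult[OF f(1) g(1)] eq]) (use f g tR in \<open>auto intro!: R_closed\<close>)
  qed
  have "p_val ?t = 1" by (rule p_val_eqI[of 1 1]) (use p_1 in auto)
  moreover have "p_val 0 = 0" by (simp add: p_val_def)
  ultimately show ?thesis unfolding is_place_def using 1 2 3 by blast
qed

lemma p_val_nonneg: assumes "z \<in> R" "z \<noteq> 0" shows "0 \<le> p_val z"
proof -
  from p_val_rep[OF assms(2)] obtain s w where f: "unit_at_p s" "unit_at_p w" "z * s = (x ^ q ^ (2 * k) - x) powi (p_val z) * w" .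
  show ?thesis by (rule p_rep_compare[OF f, where s' = z and w' = 1]) (use assms p_1 in auto)
qed

lemma p_val_pos_iff: assumes "z \<in> R" "z \<noteq> 0" shows "1 \<le> p_val z \<longleftrightarrow> z \<in> \<pp>"
proof
  assume "z \<in> \<pp>"
  then obtain s w where *: "s \<in> R" "s \<notin> \<pp>" "w \<in> R" "s * z = (x ^ q ^ (2 * k) - x) * w" by (rule p_local_generator)
  from p_val_rep[OF assms(2)] obtain s' w' where f: "unit_at_p s'" "unit_at_p w'" "z * s' = (x ^ q ^ (2 * k) - x) powi (p_val z) * w'" .
  show "1 \<le> p_val z" by (rule p_rep_compare[OF f, where s' = w and w' = s]) (use * in \<open>auto simp: mult.commute\<close>)
qed (use p_val_unit assms in force)

end

end

definition center :: "'f place \<Rightarrow> 'f set" where "center v = {z \<in> R. vge v 1 z}"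

lemma place_of_prime:
  assumes "prime_ideal \<pp>"
  obtains v where "is_place K v" "vge v 0 x" "center v = \<pp>"
proof -
  obtain k where k0: "k > 0" "\<forall>z\<in>R. z ^ q ^ (2 * k) - z \<in> \<pp>"
    by (rule frobenius_exponent[OF assms])
  note k = k0(1) bspec[OF k0(2)]
  let ?v = "p_val \<pp> k"
  have "center ?v = \<pp>"
  proof (intro set_eqI iffI)
    fix z assume "z \<in> center ?v"
    then show "z \<in> \<pp>" using p_val_pos_iff[OF assms k, of z] p_0[OF assms] unfolding center_def vge_def by auto
  next
    fix z assume "z \<in> \<pp>"
    then show "z \<in> center ?v" using p_val_pos_iff[OF assms k, of z] p_subset[OF assms, of z] unfolding center_def vge_def by auto
  qed
  then show ?thesis
    using that[of ?v] p_val_place[OF assms k] p_val_nonneg[OF assms k, of x] unfolding vge_def by auto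
qed

end

section \<open>Affine places and their centers\<close>

locale affine_place = hermitian q K x y + place K v for q and K :: "'f::field set" and x y :: 'f and v +
  assumes vx: "vge v 0 x"
begin

lemma vy: "vge v 0 y"
proof (rule ccontr)
  assume "\<not> vge v 0 y"
  then have *: "v y < 0" by (auto simp: vge_def)
  have "v (y ^ q) = int q * v y" by (simp add: v_power)
  moreover have "int q * v y \<le> 2 * v y" using * q_gt_1 by (intro mult_right_mono_neg) auto
  ultimately have "v (y ^ q) + 1 \<le> v y" using * by linarith
  then have "v (y ^ q + y) = v (y ^ q)" by (intro v_add_eq) (auto simp: vge_def)
  then have "v (x ^ (q + 1)) = int q * v y" unfolding curve by (simp add: v_power)
  moreover have "vge v 0 (x ^ (q + 1))" using vx by (rule vge_power0)
  ultimately show False using * q_gt_1 by (auto simp: vge_def zero_le_mult_iff)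
qed

lemma vge_R: "z \<in> R \<Longrightarrow> vge v 0 z"
  by (induction rule: R_induct) (use vx vy in \<open>auto intro: vge_add vge_mult0\<close>)

lemma prime_center: "prime_ideal (center v)"
  unfolding prime_ideal_def
proof (intro conjI ballI impI)
  obtain t where t: "v t = 1" using ex_uniformizer by blast
  obtain z w where f: "z \<in> R" "w \<in> R" "w \<noteq> 0" "t = z / w" by (rule fractions)
  have "z \<noteq> 0" using f t by auto
  moreover have "v z = 1 + v w" using f t v_divide[OF \<open>z \<noteq> 0\<close> f(3)] by simp
  moreover have "0 \<le> v w" using vge_R[OF f(2)] f(3) by (simp add: vge_def)
  ultimately show "\<exists>z\<in>center v. z \<noteq> 0" using f unfolding center_def vge_def by force
next
  fix a b assume "a \<in> R" "b \<in> R" "a * b \<in> center v"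
  then show "a \<in> center v \<or> b \<in> center v" using vge_prime[OF vge_R vge_R, of a b] unfolding center_def by blast
next
  fix a b assume "a \<in> R" "b \<in> center v"
  then show "a * b \<in> center v" using vge_mult0[OF vge_R, of a 1 b] R_mult unfolding center_def by blast
next
  fix a b assume "a \<in> center v" "b \<in> center v"
  then show "a + b \<in> center v" using vge_add R_add unfolding center_def by blast
qed (use not_vge_1 in \<open>auto simp: center_def\<close>)

lemma unit_iff: "s \<in> R \<Longrightarrow> s \<notin> center v \<longleftrightarrow> s \<noteq> 0 \<and> v s = 0"
  using vge_R[of s] unfolding center_def vge_def by auto

text \<open>Every nonzero \<open>f\<close> is a power of \<open>x ^ q ^ (2 * k) - x\<close> times a
  unit, so the value of that element divides all values of \<open>v\<close>. As \<open>v\<close> is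
  normalised, it is 1, and \<open>v\<close> is the valuation constructed from its center.\<close>

lemma uniformizer:
  assumes k: "k > 0" and frob: "\<And>z. z \<in> R \<Longrightarrow> vge v 1 (z ^ q ^ (2 * k) - z)"
  shows uniformizer_val: "v (x ^ q ^ (2 * k) - x) = 1"
    and uniformizer_rep: "f \<noteq> 0 \<Longrightarrow> \<exists>s w. s \<in> R \<and> w \<in> R \<and> s \<noteq> 0 \<and> w \<noteq> 0 \<and> v s = 0 \<and> v w = 0 \<and>
      f * s = (x ^ q ^ (2 * k) - x) powi (v f) * w"
    and val_eq_p_val: "v = p_val (center v) k"
proof -
  let ?t = "x ^ q ^ (2 * k) - x"
  have frob': "z ^ q ^ (2 * k) - z \<in> center v" if "z \<in> R" for z
    using frob[OF that] that unfolding center_def by (auto intro: R_diff R_power)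
  note P = prime_center k frob'
  have tnz: "?t \<noteq> 0" by (rule x_frob_nz[OF k])
  let ?p = "p_val (center v) k"
  have rep: "\<exists>s w. s \<in> R \<and> w \<in> R \<and> s \<noteq> 0 \<and> w \<noteq> 0 \<and> v s = 0 \<and> v w = 0 \<and> f * s = ?t powi (?p f) * w \<and> v f = ?p f * v ?t"
    if "f \<noteq> 0" for f
  proof -
    from p_val_rep[OF P that] obtain s w where *: "s \<in> R \<and> s \<notin> center v" "w \<in> R \<and> w \<notin> center v"
      "f * s = ?t powi (?p f) * w" by blast
    then have nz: "s \<noteq> 0" "w \<noteq> 0" "v s = 0" "v w = 0" using unit_iff by auto
    have "v (f * s) = v (?t powi (?p f) * w)" unfolding *(3) ..
    then have "v f = ?p f * v ?t" using that nz tnz by (simp add: v_mult v_powi power_int_eq_0_iff)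
    then show ?thesis using * nz by blast
  qed
  obtain f0 where f: "v f0 = 1" using ex_uniformizer by blast
  then have "f0 \<noteq> 0" by auto
  from rep[OF this] f have 1: "?p f0 * v ?t = 1" by metis
  moreover have "v ?t \<ge> 1" using frob[OF R_x] tnz by (simp add: vge_def)
  ultimately show vt: "v ?t = 1" by (metis abs_of_pos mult.commute zdvd1_eq dvd_triv_left zero_less_one order_less_le_trans)
  show eq: "v = ?p"
  proof
    fix f show "v f = ?p f" using rep[of f] vt by (cases "f = 0") (auto simp: p_val_def[OF P])
  qed
  show "\<exists>s w. s \<in> R \<and> w \<in> R \<and> s \<noteq> 0 \<and> w \<noteq> 0 \<and> v s = 0 \<and> v w = 0 \<and>
      f * s = ?t powi (v f) * w" if "f \<noteq> 0" using rep[OF that] eq by metis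
qed

lemma frobenius_ex: obtains k where "k > 0" "\<forall>z\<in>R. vge v 1 (z ^ q ^ (2 * k) - z)"
proof -
  obtain k where "k > 0" "\<forall>z\<in>R. z ^ q ^ (2 * k) - z \<in> center v"
    by (rule frobenius_exponent[OF prime_center])
  then show ?thesis using that[of k] unfolding center_def by blast
qed

lemma vge_0_rep:
  assumes "vge v 0 f"
  obtains z s where "z \<in> R" "s \<in> R" "s \<noteq> 0" "v s = 0" "f * s = z"
proof (cases "f = 0")
  case True
  then show ?thesis using that[of 0 1] by simp
next
  case False
  obtain k where k0: "k > 0" "\<forall>z\<in>R. vge v 1 (z ^ q ^ (2 * k) - z)" by (rule frobenius_ex)
  note k = k0(1) bspec[OF k0(2)]
  from uniformizer_rep[OF k False] obtain s w where *: "s \<in> R" "w \<in> R" "s \<noteq> 0" "v s = 0"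
      "f * s = (x ^ q ^ (2 * k) - x) powi (v f) * w" by blast
  have "(x ^ q ^ (2 * k) - x) powi (v f) = (x ^ q ^ (2 * k) - x) ^ nat (v f)"
    using assms False by (auto simp: vge_def power_int_def)
  then show ?thesis using that[of "f * s" s] * by (auto intro!: R_closed)
qed

text \<open>The residue field is already the residue field of \<open>R\<close>.\<close>

lemma residue_rep:
  assumes "vge v 0 f"
  obtains z where "z \<in> R" "vge v 1 (f - z)"
proof -
  obtain z s where *: "z \<in> R" "s \<in> R" "s \<noteq> 0" "v s = 0" "f * s = z" by (rule vge_0_rep[OF assms])
  obtain k where k0: "k > 0" "\<forall>z\<in>R. vge v 1 (z ^ q ^ (2 * k) - z)" by (rule frobenius_ex)
  note k = k0(1) bspec[OF k0(2)]
  let ?Q = "q ^ (2 * k)"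
  have "?Q > 1" using one_less_power[OF q_gt_1, of "2 * k"] k by simp
  then have n: "?Q = Suc (Suc (?Q - 2))" by simp
  \<comment> \<open>\<open>s ^ n\<close> is an inverse of \<open>s\<close> modulo the maximal ideal,
    so the fraction \<open>z / s\<close> is congruent to \<open>z * s ^ n\<close>.\<close>
  define n where "n = ?Q - 2"
  have n: "?Q = Suc (Suc n)" using n n_def by simp
  have "vge v 1 (f * (s ^ ?Q - s))" using vge_mult0[OF assms k(2)[OF *(2)]] .
  also have "f * (s ^ ?Q - s) = (f * s ^ Suc n - f) * s" unfolding n by (simp add: algebra_simps)
  finally have "vge v 1 (f * s ^ Suc n - f)" using * vge_unit_cancel by blast
  then have "vge v 1 (f - z * s ^ n)" by (subst vge_minus_commute) (simp add: *(5)[symmetric] mult_ac)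
  then show ?thesis using that[of "z * s ^ n"] * by (auto intro: R_closed)
qed

end

section \<open>Uniqueness of the place with a given center, and functions without affine
  poles\<close>

context hermitian
begin

lemma affine_placeI: "is_place K v \<Longrightarrow> vge v 0 x \<Longrightarrow> affine_place q K x y v"
  using K by unfold_locales

text \<open>An inclusion suffices because nonzero primes are maximal: for \<open>z\<close> in the
  larger center only, \<open>z * (z ^ Suc n - 1)\<close> lies in the smaller one, and then the
  larger one would contain both \<open>z\<close> and \<open>z ^ Suc n - 1\<close>.\<close>

lemma affine_place_eqI:
  assumes v: "is_place K v" "vge v 0 x" and w: "is_place K w" "vge w 0 x" and eq: "center v \<subseteq> center w"
  shows "v = w"
proof -
  interpret v: affine_place q K x y v by (rule affine_placeI[OF v])
  interpret w: affine_place q K x y w by (rule affine_placeI[OF w])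
  obtain k where k0: "k > 0" "\<forall>z\<in>R. vge v 1 (z ^ q ^ (2 * k) - z)" by (rule v.frobenius_ex)
  note k = k0(1) bspec[OF k0(2)]
  have k': "vge w 1 (z ^ q ^ (2 * k) - z)" if "z \<in> R" for z
  proof -
    have "z ^ q ^ (2 * k) - z \<in> center v" using k(2)[OF that] that unfolding center_def by (auto intro: R_diff R_power)
    then show ?thesis using eq unfolding center_def by blast
  qed
  obtain n where n: "q ^ (2 * k) = Suc (Suc n)"
  proof -
    have "q ^ (2 * k) > 1" using one_less_power[OF q_gt_1, of "2 * k"] k(1) by simp
    then show ?thesis using that[of "q ^ (2 * k) - 2"] by simp
  qed
  have "center w \<subseteq> center v"
  proof
    fix z assume z: "z \<in> center w"
    then have zR: "z \<in> R" by (simp add: center_def)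
    show "z \<in> center v"
    proof (rule ccontr)
      assume "z \<notin> center v"
      moreover have "vge v 1 (z * (z ^ Suc n - 1))" using k(2)[OF zR] unfolding n by (simp add: algebra_simps)
      ultimately have "vge v 1 (z ^ Suc n - 1)"
        using v.vge_prime[of z "z ^ Suc n - 1"] v.vge_R[OF zR] v.vge_R[OF R_diff[OF R_power[OF zR] R_1]] zR
        unfolding center_def by blast
      then have "z ^ Suc n - 1 \<in> center v" using R_diff[OF R_power[OF zR] R_1] unfolding center_def by blast
      then have "vge w 1 (z ^ Suc n - 1)" using eq unfolding center_def by blast
      moreover have "vge w 1 (z ^ Suc n)" using z w.vge_mult0'[of 1 z "z ^ n"] w.vge_R R_power[OF zR]
        unfolding center_def by auto
      ultimately show False using w.vge_diff[of 1 "z ^ Suc n" "z ^ Suc n - 1"] w.not_vge_1 by simp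
    qed
  qed
  then have "center v = center w" using eq by blast
  then show ?thesis using v.val_eq_p_val[OF k] w.val_eq_p_val[OF k(1) k'] by metis
qed

lemma prime_above:
  assumes I: "I \<subseteq> R" "z \<in> I" "z \<noteq> 0" "1 \<notin> I" "\<And>a b. a \<in> I \<Longrightarrow> b \<in> I \<Longrightarrow> a + b \<in> I"
    "\<And>a b. a \<in> R \<Longrightarrow> b \<in> I \<Longrightarrow> a * b \<in> I"
  obtains \<pp> where "prime_ideal \<pp>" "I \<subseteq> \<pp>"
proof -
  define Id where "Id M \<longleftrightarrow> I \<subseteq> M \<and> M \<subseteq> R \<and> 1 \<notin> M \<and>
    (\<forall>a\<in>M. \<forall>b\<in>M. a + b \<in> M) \<and> (\<forall>a\<in>R. \<forall>b\<in>M. a * b \<in> M)" for M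
  have IdD: "I \<subseteq> M" "M \<subseteq> R" "1 \<notin> M" "a \<in> M \<Longrightarrow> b \<in> M \<Longrightarrow> a + b \<in> M" "a \<in> R \<Longrightarrow> b \<in> M \<Longrightarrow> a * b \<in> M"
    if "Id M" for M a b using that unfolding Id_def by auto
  have IdI: "Id M" if "I \<subseteq> M" "M \<subseteq> R" "1 \<notin> M" "\<And>a b. a \<in> M \<Longrightarrow> b \<in> M \<Longrightarrow> a + b \<in> M"
    "\<And>a b. a \<in> R \<Longrightarrow> b \<in> M \<Longrightarrow> a * b \<in> M" for M using that unfolding Id_def by auto
  have "\<exists>M\<in>Collect Id. \<forall>X\<in>Collect Id. M \<subseteq> X \<longrightarrow> X = M"
  proof (rule subset_Zorn_nonempty)
    show "Collect Id \<noteq> {}" using IdI[OF subset_refl I(1,4,5,6)] by blast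
    fix C assume C: "C \<noteq> {}" "subset.chain (Collect Id) C"
    then have CA: "\<And>X. X \<in> C \<Longrightarrow> Id X" and ch: "\<And>X Y. X \<in> C \<Longrightarrow> Y \<in> C \<Longrightarrow> X \<subseteq> Y \<or> Y \<subseteq> X"
      unfolding subset.chain_def by auto
    have "Id (\<Union>C)"
    proof (rule IdI)
      obtain X where "X \<in> C" using C(1) by blast
      then show "I \<subseteq> \<Union>C" using IdD(1)[OF CA] by blast
      show "\<Union>C \<subseteq> R" using IdD(2)[OF CA] by blast
      show "1 \<notin> \<Union>C" using IdD(3)[OF CA] by blast
    next
      fix a b assume ab: "a \<in> \<Union>C" "b \<in> \<Union>C"
      then obtain X Y where XY: "X \<in> C" "a \<in> X" "Y \<in> C" "b \<in> Y" by blast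
      then have "a + b \<in> X \<or> a + b \<in> Y" using IdD(4)[OF CA] ch[OF XY(1,3)] by blast
      then show "a + b \<in> \<Union>C" using XY by blast
    next
      fix a b assume ab: "a \<in> R" "b \<in> \<Union>C"
      then obtain Y where Y: "Y \<in> C" "b \<in> Y" by blast
      then show "a * b \<in> \<Union>C" using IdD(5)[OF CA[OF Y(1)] ab(1) Y(2)] by blast
    qed
    then show "\<Union>C \<in> Collect Id" by simp
  qed
  then obtain M where IdM: "Id M" and max: "\<And>X. Id X \<Longrightarrow> M \<subseteq> X \<Longrightarrow> X = M" by auto
  note M = IdD[OF IdM]
  have "b \<in> M" if ab: "a \<in> R" "b \<in> R" "a * b \<in> M" "a \<notin> M" for a b
  proof -
    let ?X = "{m + a * r | m r. m \<in> M \<and> r \<in> R}"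
    have XI: "m + a * r \<in> ?X" if "m \<in> M" "r \<in> R" for m r using that by blast
    have M0: "0 \<in> M" using M(5)[OF R_0] I M(1) by (metis mult_zero_left subsetD)
    have MX: "M \<subseteq> ?X"
    proof
      fix m assume "m \<in> M"
      then show "m \<in> ?X" using XI[OF _ R_0] by simp
    qed
    have "a \<in> ?X" using XI[OF M0 R_1] by simp
    then have "?X \<noteq> M" using ab by blast
    then have nA: "\<not> Id ?X" using max[OF _ MX] by blast
    have X1: "?X \<subseteq> R" using M(2) ab by (auto intro!: R_closed)
    have X2: "c + d \<in> ?X" if cd: "c \<in> ?X" "d \<in> ?X" for c d
    proof -
      obtain m r m' r' where *: "c = m + a * r" "m \<in> M" "r \<in> R" "d = m' + a * r'" "m' \<in> M" "r' \<in> R"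
        using cd by blast
      have "c + d = (m + m') + a * (r + r')" using * by (simp add: algebra_simps)
      then show ?thesis using XI[OF M(4)[OF *(2,5)] R_add[OF *(3,6)]] by simp
    qed
    have X3: "c * d \<in> ?X" if cd: "c \<in> R" "d \<in> ?X" for c d
    proof -
      obtain m r where *: "d = m + a * r" "m \<in> M" "r \<in> R" using cd by blast
      have "c * d = c * m + a * (c * r)" using * by (simp add: algebra_simps)
      then show ?thesis using XI[OF M(5)[OF cd(1) *(2)] R_mult[OF cd(1) *(3)]] by simp
    qed
    have "1 \<in> ?X"
    proof (rule ccontr)
      assume "1 \<notin> ?X"
      then have "Id ?X" by (rule IdI[OF order_trans[OF M(1) MX] X1 _ X2 X3])
      then show False using nA by contradiction
    qed
    then obtain m r where *: "1 = m + a * r" "m \<in> M" "r \<in> R" by blast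
    have "b = b * 1" by simp
    also have "\<dots> = b * m + r * (a * b)" unfolding *(1) by (simp add: algebra_simps)
    also have "\<dots> \<in> M" by (intro M(4)[OF M(5)[OF ab(2) *(2)] M(5)[OF *(3) ab(3)]])
    finally show ?thesis .
  qed
  then have "prime_ideal M" unfolding prime_ideal_def using M I(2,3) by blast
  then show ?thesis using that M(1) by blast
qed

text \<open>Otherwise the ideal of denominators would be contained in the center of a place.\<close>

lemma regular_in_R:
  assumes reg: "\<And>v. is_place K v \<Longrightarrow> vge v 0 x \<Longrightarrow> vge v 0 f"
  shows "f \<in> R"
proof (rule ccontr)
  assume "f \<notin> R"
  let ?I = "{z \<in> R. z * f \<in> R}"
  obtain z w where f: "z \<in> R" "w \<in> R" "w \<noteq> 0" "f = z / w" by (rule fractions)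
  have wf: "w * f = z" using f by simp
  have I: "?I \<subseteq> R" "w \<in> ?I" "w \<noteq> 0" "1 \<notin> ?I" "\<And>a b. a \<in> ?I \<Longrightarrow> b \<in> ?I \<Longrightarrow> a + b \<in> ?I"
    "\<And>a b. a \<in> R \<Longrightarrow> b \<in> ?I \<Longrightarrow> a * b \<in> ?I"
    using f(1-3) wf \<open>f \<notin> R\<close> by (auto simp: distrib_right mult.assoc intro: R_add R_mult)
  from prime_above[OF this] obtain \<pp> where p: "prime_ideal \<pp>" "?I \<subseteq> \<pp>" .
  from place_of_prime[OF p(1)] obtain w where w: "is_place K w" "vge w 0 x" "center w = \<pp>" .
  interpret affine_place q K x y w by (rule affine_placeI[OF w(1,2)])
  obtain z s where *: "z \<in> R" "s \<in> R" "s \<noteq> 0" "w s = 0" "f * s = z"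
    by (rule vge_0_rep[OF reg[OF w(1,2)]])
  then have "s \<in> ?I" by (auto simp: mult.commute)
  then have "s \<in> center w" using p w by blast
  then show False using unit_iff *(2-4) by blast
qed

end

section \<open>Rational points and the point at infinity\<close>

text \<open>Used contrapositively, to see that after a change of coordinates the new
  \<open>x\<close> is again transcendental: otherwise monomials with bounded exponents would span a
  finite ring containing all generators.\<close>

lemma finite_of_algebraic_generator:
  fixes K :: "'f::field set"
  assumes K: "is_subfield K" "finite K" and q: "q > 1" and curve: "x ^ (q + 1) = y ^ q + y"
    and gen: "\<And>L. is_subfield L \<Longrightarrow> K \<subseteq> L \<Longrightarrow> x \<in> L \<Longrightarrow> y \<in> L \<Longrightarrow> L = UNIV"
    and alg: "\<not> transcendental_over K x"
  shows "finite (UNIV :: 'f set)"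
proof -
  obtain p where p: "\<And>i. coeff p i \<in> K" "poly p x = 0" "p \<noteq> 0"
    using alg unfolding transcendental_over_def by blast
  let ?d = "degree p"
  have d: "?d > 0"
  proof (rule ccontr)
    assume "\<not> ?thesis"
    then obtain c where "p = [:c:]" using degree_eq_zeroE by blast
    then show False using p by simp
  qed
  let ?E = "{x ^ i * y ^ j | i j. i < ?d \<and> j < q}"
  define T where "T = lspan K ?E"
  have TE: "x ^ i * y ^ j \<in> T" if "i < ?d" "j < q" for i j
    unfolding T_def by (rule lspan_base[OF K(1)]) (use that in blast)
  have lc: "lead_coeff p \<noteq> 0" using p by simp
  have "lead_coeff p * x ^ ?d = - (\<Sum>i<?d. coeff p i * x ^ i)"
    using p(2) unfolding poly_altdef lessThan_Suc_atMost[symmetric] by (simp add: eq_neg_iff_add_eq_0 add.commute)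
  then have "x ^ ?d = - inverse (lead_coeff p) * (\<Sum>i<?d. coeff p i * x ^ i)"
    using lc by (simp add: field_simps)
  also have "\<dots> = (\<Sum>i<?d. (- inverse (lead_coeff p) * coeff p i) * x ^ i)"
    by (simp add: sum_distrib_left mult.assoc)
  finally have xd: "x ^ ?d = \<dots>" .
  have xT: "x * z \<in> T" if "z \<in> T" for z
    unfolding T_def
  proof (rule lspan_mult_map[OF K(1), of ?E])
    fix e assume "e \<in> ?E"
    then obtain i j where e: "e = x ^ i * y ^ j" "i < ?d" "j < q" by blast
    show "x * e \<in> lspan K ?E"
    proof (cases "i + 1 < ?d")
      case True
      then show ?thesis using TE[of "i + 1" j] e unfolding T_def by (simp add: mult.assoc)
    next
      case False
      then have "x * e = x ^ ?d * y ^ j" using e by (simp add: Suc_eq_plus1[symmetric] le_less_Suc_eq flip: power_Suc mult.assoc) (metis Suc_lessI)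
      also have "\<dots> = (\<Sum>i<?d. (- inverse (lead_coeff p) * coeff p i) * (x ^ i * y ^ j))"
        unfolding xd by (simp add: sum_distrib_right mult.assoc)
      also have "\<dots> \<in> lspan K ?E"
      proof (intro lspan_sum[OF K(1)] lspan_base_scale[OF K(1)])
        fix i assume "i \<in> {..<?d}"
        then show "x ^ i * y ^ j \<in> ?E" using e by blast
      qed (use p K in \<open>auto intro: subfield_closed\<close>)
      finally show ?thesis .
    qed
  qed (use that T_def in simp)
  have xnT: "x ^ n * z \<in> T" if "z \<in> T" for n z
    by (induction n) (use that xT in \<open>auto simp: mult.assoc\<close>)
  have yT: "y * z \<in> T" if "z \<in> T" for z
    unfolding T_def
  proof (rule lspan_mult_map[OF K(1), of ?E])
    fix e assume "e \<in> ?E"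
    then obtain i j where e: "e = x ^ i * y ^ j" "i < ?d" "j < q" by blast
    show "y * e \<in> lspan K ?E"
    proof (cases "j + 1 < q")
      case True
      then show ?thesis using TE[of i "j + 1"] e unfolding T_def by (simp add: mult_ac)
    next
      case False
      then have "q = Suc j" using e by simp
      then have "y * e = x ^ i * y ^ q" using e by (simp add: mult_ac)
      also have "y ^ q = x ^ (q + 1) - y" using curve by simp
      also have "x ^ i * \<dots> = x ^ (q + 1) * (x ^ i * y ^ 0) - x ^ i * y ^ 1" by (simp add: algebra_simps)
      also have "\<dots> \<in> T"
        using lspan_diff[OF K(1) xnT[OF TE[OF e(2), of 0], of "q + 1", unfolded T_def] TE[OF e(2), of 1, unfolded T_def]] q
        unfolding T_def by simp
      finally show ?thesis unfolding T_def .
    qed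
  qed (use that T_def in simp)
  have ynT: "y ^ n * z \<in> T" if "z \<in> T" for n z
    by (induction n) (use that yT in \<open>auto simp: mult.assoc\<close>)
  have multT: "z * w \<in> T" if "z \<in> T" "w \<in> T" for z w
  proof -
    have "w * e \<in> lspan K ?E" if eE: "e \<in> ?E" for e
    proof -
      obtain i j where e: "e = x ^ i * y ^ j" using eE by blast
      have "w * e = x ^ i * (y ^ j * w)" using e by (simp add: mult_ac)
      then show ?thesis using xnT ynT \<open>w \<in> T\<close> T_def by metis
    qed
    then have "w * z \<in> lspan K ?E"
      by (rule lspan_mult_map[OF K(1), of ?E w ?E z, OF _ \<open>z \<in> T\<close>[unfolded T_def]])
    then show ?thesis unfolding T_def by (simp add: mult.commute)
  qed
  have "?E \<subseteq> (\<lambda>(i, j). x ^ i * y ^ j) ` ({..<?d} \<times> {..<q})" by auto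
  then have "finite ?E" by (meson finite_subset finite_imageI finite_SigmaI finite_lessThan)
  then have fin: "finite T" unfolding T_def by (rule finite_lspan[OF K])
  have T1: "1 \<in> T" using TE[OF d, of 0] q by simp
  have TK: "c \<in> T" if "c \<in> K" for c using lspan_scale[OF K(1) that, of 1 ?E] T1 unfolding T_def by simp
  have powT: "z ^ n \<in> T" if "z \<in> T" for z n by (induction n) (use T1 multT that in auto)
  have "is_subfield T"
    unfolding is_subfield_def
  proof (intro conjI ballI)
    fix a assume a: "a \<in> T"
    show "inverse a \<in> T"
    proof (cases "a = 0")
      case True
      then show ?thesis unfolding T_def by simp
    next
      case False
      \<comment> \<open>Two powers of a nonzero element of a finite domain coincide, which exhibits
        the inverse as a power.\<close>
      have "finite (range (\<lambda>n. a ^ n))" using fin powT[OF a] by (meson finite_subset image_subsetI)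
      then obtain i j where ij: "i < j" "a ^ i = a ^ j" by (rule infinite_orbit_collision)
      have "a ^ j = a ^ i * (a * a ^ (j - i - 1))"
        using ij(1) by (simp flip: power_add power_Suc)
      then have "a * a ^ (j - i - 1) = 1" using ij(2) False by simp
      then have "inverse a = a ^ (j - i - 1)" by (rule inverse_unique)
      then show ?thesis using powT[OF a] by simp
    qed
  next
    fix a b assume "a \<in> T" "b \<in> T"
    then show "a - b \<in> T" "a * b \<in> T" using multT lspan_diff[OF K(1)] unfolding T_def by auto
  qed (rule T1)
  then have "T = UNIV" using gen[of T] TK xT[OF T1] yT[OF T1] by auto
  then show ?thesis using fin by simp
qed

lemma place_of_degreeD:
  assumes "place_of_degree K n v"
  obtains B where "B \<subseteq> valuation_ring v" "finite B" "card B = n"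
    "\<forall>z\<in>valuation_ring v. \<exists>!c. c \<in> B \<rightarrow>\<^sub>E K \<and> z - (\<Sum>b\<in>B. c b * b) \<in> valuation_ideal v"
  using assms unfolding place_of_degree_def by (elim conjE exE) (rule that; assumption)

lemma lspan_finite_support:
  assumes K: "is_subfield K" and "z \<in> lspan K (e ` I)"
  obtains J where "finite J" "J \<subseteq> I" "z \<in> lspan K (e ` J)"
proof -
  have "\<exists>J. finite J \<and> J \<subseteq> I \<and> z \<in> lspan K (e ` J)"
    using assms(2)
  proof induction
    case zero
    then show ?case by (intro exI[of _ "{}"]) simp
  next
    case (step c f z)
    then obtain J i where J: "finite J" "J \<subseteq> I" "z \<in> lspan K (e ` J)" "i \<in> I" "f = e i" by auto
    have "z \<in> lspan K (e ` insert i J)" using lspan_mono[OF K, of "e ` J" "e ` insert i J"] J(3) by auto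
    then have "c * f + z \<in> lspan K (e ` insert i J)" using step(1) J(5) by (intro lspan.step) auto
    then show ?case using J by (intro exI[of _ "insert i J"]) simp
  qed
  then show ?thesis using that by blast
qed

context hermitian
begin

text \<open>New generators with the same equation make the whole theory available again. This moves
  a rational point, or the point at infinity, to the origin.\<close>

lemma hermitianI:
  assumes "x' ^ (q + 1) = y' ^ q + y'"
    and gen: "\<And>L. is_subfield L \<Longrightarrow> K \<subseteq> L \<Longrightarrow> x' \<in> L \<Longrightarrow> y' \<in> L \<Longrightarrow> x \<in> L \<and> y \<in> L"
  shows "hermitian q K x' y'"
proof
  have gen': "L = UNIV" if "is_subfield L" "K \<subseteq> L" "x' \<in> L" "y' \<in> L" for L
    using generated[OF that(1,2)] gen[OF that] by blast
  have "transcendental_over K x'"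
  proof (rule ccontr)
    assume "\<not> transcendental_over K x'"
    with K finite_K q_gt_1 assms(1) gen' have "finite (UNIV :: 'f set)"
      by (rule finite_of_algebraic_generator)
    then show False using infinite_R finite_subset[OF subset_UNIV] by blast
  qed
  then show "hermitian_function_field q K x' y'"
    unfolding hermitian_function_field_def using K card_K assms(1) gen' by (auto simp: algebra_simps)
qed (rule primepow_q)

text \<open>The nonconstant reduced monomials span the ideal \<open>(x, y)\<close>, since the curve
  equation has no constant term. It is proper because 1 is independent of them, and prime because
  \<open>R\<close> modulo it consists of constants.\<close>

lemma origin_place: obtains v where "is_place K v" "vge v 1 x" "vge v 1 y"
proof -
  let ?I = "{(i, j). j < q \<and> (i, j) \<noteq> (0, 0)}" and ?m = "\<lambda>(i, j). x ^ i * y ^ j"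
  define \<pp> where "\<pp> = lspan K (?m ` ?I)"
  have pI: "x ^ i * y ^ j \<in> \<pp>" if "j < q" "(i, j) \<noteq> (0, 0)" for i j
    unfolding \<pp>_def by (rule lspan_base[OF K]) (use that in force)
  have px: "x \<in> \<pp>" "y \<in> \<pp>" using pI[of 0 1] pI[of 1 0] q_gt_1 by auto
  have padd: "a + b \<in> \<pp>" if "a \<in> \<pp>" "b \<in> \<pp>" for a b using that unfolding \<pp>_def by (rule lspan_add[OF K])
  have diff: "a - b \<in> \<pp>" if "a \<in> \<pp>" "b \<in> \<pp>" for a b using that unfolding \<pp>_def by (rule lspan_diff[OF K])
  have pscale: "a * b \<in> \<pp>" if "a \<in> K" "b \<in> \<pp>" for a b using that unfolding \<pp>_def by (rule lspan_scale[OF K])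
  have xm: "x * b \<in> \<pp>" if "b \<in> \<pp>" for b
    unfolding \<pp>_def
  proof (rule lspan_mult_map[OF K, of "?m ` ?I"])
    fix e assume "e \<in> ?m ` ?I"
    then obtain i j where e: "e = x ^ i * y ^ j" "j < q" by auto
    then show "x * e \<in> lspan K (?m ` ?I)" using pI[of j "i + 1"] unfolding \<pp>_def by (simp add: mult.assoc)
  qed (use that \<pp>_def in simp)
  have ym: "y * b \<in> \<pp>" if "b \<in> \<pp>" for b
    unfolding \<pp>_def
  proof (rule lspan_mult_map[OF K, of "?m ` ?I"])
    fix e assume "e \<in> ?m ` ?I"
    then obtain i j where e: "e = x ^ i * y ^ j" "j < q" by auto
    have e2: "y * e = x ^ i * y ^ Suc j" using e by (simp add: mult_ac)
    have "y * e \<in> \<pp>"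
    proof (cases "Suc j < q")
      case True
      then show ?thesis unfolding e2 by (intro pI) auto
    next
      case False
      then have "Suc j = q" using e by simp
      then have "y * e = x ^ (i + q + 1) * y ^ 0 - x ^ i * y ^ 1" unfolding e2 using mon_reduce[of "Suc j" i] by simp
      also have "\<dots> \<in> \<pp>" using q_gt_1 by (intro diff pI) auto
      finally show ?thesis .
    qed
    then show "y * e \<in> lspan K (?m ` ?I)" unfolding \<pp>_def .
  qed (use that \<pp>_def in simp)
  have pmult: "\<forall>b\<in>\<pp>. a * b \<in> \<pp>" if "a \<in> R" for a
    using that by (induction rule: R_induct) (use xm ym pscale padd in \<open>auto simp: distrib_right mult.assoc\<close>)
  have const: "\<exists>c\<in>K. a - c \<in> \<pp>" if "a \<in> R" for a
    using that
  proof (induction rule: R_induct)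
    case (const a)
    then show ?case by (intro bexI[of _ a]) (auto simp: \<pp>_def)
  next
    case (add z w)
    then obtain c d where *: "c \<in> K" "d \<in> K" "z - c \<in> \<pp>" "w - d \<in> \<pp>" by blast
    then have "(z - c) + (w - d) \<in> \<pp>" by (intro padd)
    then show ?case using * by (intro bexI[of _ "c + d"]) (auto simp: algebra_simps intro: K_closed)
  next
    case (mult z w)
    then obtain c d where *: "c \<in> K" "d \<in> K" "z - c \<in> \<pp>" "w - d \<in> \<pp>" by blast
    have "z * (w - d) + d * (z - c) \<in> \<pp>" by (rule padd[OF bspec[OF pmult[OF mult(1)] *(4)] pscale[OF *(2,3)]])
    also have "z * (w - d) + d * (z - c) = z * w - c * d" by (simp add: algebra_simps)
    finally show ?case using * by (intro bexI[of _ "c * d"]) (auto intro: K_closed)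
  qed (use px in \<open>auto intro!: bexI[of _ 0] K_closed\<close>)
  have one: "1 \<notin> \<pp>"
  proof
    assume "1 \<in> \<pp>"
    then obtain J where J: "finite J" "J \<subseteq> ?I" "1 \<in> lspan K (?m ` J)"
      unfolding \<pp>_def by (rule lspan_finite_support[OF K])
    from lspan_image_rep[OF K J(1,3)] obtain c where c: "\<And>p. p \<in> J \<Longrightarrow> c p \<in> K" "1 = (\<Sum>p\<in>J. c p * ?m p)" by blast
    let ?c = "\<lambda>i j. if (i, j) = (0, 0) then - 1 else c (i, j)"
    have "(0, 0) \<notin> J" using J(2) by auto
    then have "(\<Sum>(i, j)\<in>insert (0, 0) J. ?c i j * (x ^ i * y ^ j)) = - 1 + (\<Sum>(i, j)\<in>J. ?c i j * (x ^ i * y ^ j))"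
      using J(1) by simp
    also have "(\<Sum>(i, j)\<in>J. ?c i j * (x ^ i * y ^ j)) = (\<Sum>p\<in>J. c p * ?m p)"
      by (rule sum.cong) (use J(2) in auto)
    finally have s: "(\<Sum>(i, j)\<in>insert (0, 0) J. ?c i j * (x ^ i * y ^ j)) = 0" using c(2) by simp
    have "?c 0 0 = 0"
    proof (rule reduced_independent[OF _ _ s])
      show "\<forall>(i, j)\<in>insert (0, 0) J. j < q \<and> ?c i j \<in> K"
        using J(2) c(1) q_gt_1 K_closed(2,4) by auto
    qed (use J in auto)
    then show False by simp
  qed
  have "prime_ideal \<pp>"
    unfolding prime_ideal_def
  proof (intro conjI ballI impI)
    show "\<pp> \<subseteq> R" unfolding \<pp>_def R_def by (rule lspan_mono[OF K]) auto
    show "\<exists>z\<in>\<pp>. z \<noteq> 0" using px x_nz by blast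
    fix a b assume ab: "a \<in> R" "b \<in> R" "a * b \<in> \<pp>"
    then obtain c d where *: "c \<in> K" "d \<in> K" "a - c \<in> \<pp>" "b - d \<in> \<pp>" using const by meson
    have "a * b - (a * (b - d) + d * (a - c)) \<in> \<pp>" by (rule diff[OF ab(3) padd[OF bspec[OF pmult[OF ab(1)] *(4)] pscale[OF *(2,3)]]])
    then have cd: "c * d \<in> \<pp>" by (simp add: algebra_simps)
    have "c * d = 0"
    proof (rule ccontr)
      assume "c * d \<noteq> 0"
      then have "inverse (c * d) * (c * d) = 1" by (rule left_inverse)
      then show False using pscale[OF K_closed(7)[OF K_closed(6)[OF *(1,2)]] cd] one by (simp only:)
    qed
    then show "a \<in> \<pp> \<or> b \<in> \<pp>" using * by auto
  qed (use one padd pmult in auto)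
  then obtain v where v: "is_place K v" "vge v 0 x" "center v = \<pp>" by (rule place_of_prime)
  then show ?thesis using that[of v] px unfolding center_def by blast
qed

text \<open>\<open>y - A ^ q * x + B ^ q\<close> is the tangent at \<open>(A, B)\<close>; the
  right-hand side shows contact of order \<open>q\<close> there and a further zero at the Frobenius
  image. For \<open>A\<close> in \<open>K\<close> it says that \<open>x - A\<close> and the tangent
  satisfy the curve equation again. \<open>A\<close> and \<open>B\<close> may be nonconstant, as is
  the case at places of degree three.\<close>

lemma tangent_line:
  assumes "A ^ (q + 1) = B ^ q + B"
  shows "(y - A ^ q * x + B ^ q) ^ q + (y - A ^ q * x + B ^ q) = (x - A) ^ q * (x - A ^ q\<^sup>2)"
proof -
  have 1: "(y - A ^ q * x + B ^ q) ^ q = y ^ q - A ^ q\<^sup>2 * x ^ q + B ^ q\<^sup>2"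
    by (simp add: frob1 power_mult_distrib power_mult[symmetric] power2_eq_square)
  have "(A ^ (q + 1)) ^ q = (B ^ q + B) ^ q" using assms by simp
  then have 2: "A ^ q\<^sup>2 * A ^ q = B ^ q\<^sup>2 + B ^ q"
    by (simp add: frob1 power_mult_distrib power_mult[symmetric] power2_eq_square mult.commute)
  have "(x - A) ^ q * (x - A ^ q\<^sup>2) = x ^ (q + 1) - A ^ q\<^sup>2 * x ^ q - A ^ q * x + A ^ q\<^sup>2 * A ^ q"
    by (simp add: frob1 algebra_simps)
  then show ?thesis unfolding 1 2 curve by (simp add: algebra_simps)
qed

definition at_point :: "'f \<Rightarrow> 'f \<Rightarrow> 'f place \<Rightarrow> bool" where
  "at_point a b v \<longleftrightarrow> is_place K v \<and> a \<in> K \<and> b \<in> K \<and> vge v 1 (x - a) \<and> vge v 1 (y - b)"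

lemma at_point_affine: assumes "at_point a b v" shows "affine_place q K x y v"
proof (rule affine_placeI)
  show v: "is_place K v" using assms by (simp add: at_point_def)
  interpret place K v using K v by unfold_locales
  have "vge v 0 ((x - a) + a)" using assms unfolding at_point_def
    by (intro vge_add[of 0 "x - a" a]) (auto intro: vge_mono)
  then show "vge v 0 x" by simp
qed

lemma at_point_exists:
  assumes "a \<in> K" "b \<in> K" "a ^ (q + 1) = b ^ q + b"
  obtains v where "at_point a b v"
proof -
  let ?l = "y - a ^ q * x + b ^ q"
  interpret h: hermitian q K "x - a" ?l
  proof (rule hermitianI)
    show "(x - a) ^ (q + 1) = ?l ^ q + ?l"
      unfolding tangent_line[OF assms(3)] using K_frob1[OF assms(1)] by (simp add: mult.commute)
    fix L assume L: "is_subfield L" "K \<subseteq> L" "x - a \<in> L" "?l \<in> L"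
    have ab: "a \<in> L" "b \<in> L" using assms L(2) by auto
    have xL: "x \<in> L" using subfield_add[OF L(1,3) ab(1)] by simp
    have "?l + a ^ q * x - b ^ q \<in> L"
      by (rule subfield_diff[OF L(1) subfield_add[OF L(1,4) subfield_mult[OF L(1) subfield_power[OF L(1) ab(1)] xL]]
            subfield_power[OF L(1) ab(2)]])
    then show "x \<in> L \<and> y \<in> L" using xL by simp
  qed
  obtain v where w: "is_place K v" "vge v 1 (x - a)" "vge v 1 ?l" by (rule h.origin_place)
  interpret place K v using K w(1) by unfold_locales
  have "vge v 1 (?l + a ^ q * (x - a))"
    by (rule vge_add[OF w(3) vge_mult0[OF vge_const[OF K_closed(9)[OF assms(1)]] w(2)]])
  also have "?l + a ^ q * (x - a) = y - b" using assms(3) by (simp add: algebra_simps)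
  finally show ?thesis using that[of v] w assms unfolding at_point_def by blast
qed

text \<open>One constant serves all places at \<open>(a, b)\<close>; this uniformity is what makes
  such a place unique.\<close>

lemma R_value:
  assumes "z \<in> R" "a \<in> K" "b \<in> K"
  obtains c where "c \<in> K" "\<forall>v. at_point a b v \<longrightarrow> vge v 1 (z - c)"
proof -
  have "\<exists>c\<in>K. \<forall>v. at_point a b v \<longrightarrow> vge v 1 (z - c)"
    using assms(1)
  proof (induction rule: R_induct)
    case (add z w)
    then obtain c d where *: "c \<in> K" "d \<in> K" "\<forall>v. at_point a b v \<longrightarrow> vge v 1 (z - c)" "\<forall>v. at_point a b v \<longrightarrow> vge v 1 (w - d)" by blast
    have "vge v 1 (z + w - (c + d))" if "at_point a b v" for v
    proof -
      interpret affine_place q K x y v by (rule at_point_affine[OF that])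
      show ?thesis using vge_add[of 1 "z - c" "w - d"] * that by (simp add: algebra_simps)
    qed
    then show ?case using K_closed(5)[OF *(1,2)] by blast
  next
    case (mult z w)
    then obtain c d where *: "c \<in> K" "d \<in> K" "\<forall>v. at_point a b v \<longrightarrow> vge v 1 (z - c)" "\<forall>v. at_point a b v \<longrightarrow> vge v 1 (w - d)" by blast
    have "vge v 1 (z * w - c * d)" if "at_point a b v" for v
    proof -
      interpret affine_place q K x y v by (rule at_point_affine[OF that])
      have "vge v 1 (z * (w - d) + d * (z - c))" using * that
        by (intro vge_add vge_mult0[OF vge_R[OF mult(1)]] vge_mult0[OF vge_const[OF *(2)]]) auto
      then show ?thesis by (simp add: algebra_simps)
    qed
    then show ?case using K_closed(6)[OF *(1,2)] by blast
  next
    case x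
    then show ?case using assms at_point_def by blast
  next
    case y
    then show ?case using assms at_point_def by blast
  next
    case (const a)
    then show ?case by (intro bexI[of _ a]) auto
  qed
  then show ?thesis using that by blast
qed

lemma at_point_unique:
  assumes v: "at_point a b v" and w: "at_point a b w"
  shows "v = w"
proof -
  interpret v: affine_place q K x y v by (rule at_point_affine[OF v])
  interpret w: affine_place q K x y w by (rule at_point_affine[OF w])
  have ab: "a \<in> K" "b \<in> K" using v unfolding at_point_def by auto
  have "center v \<subseteq> center w"
  proof
    fix z assume z: "z \<in> center v"
    then obtain c where c: "c \<in> K" "\<forall>v. at_point a b v \<longrightarrow> vge v 1 (z - c)"
      using R_value[OF _ ab] unfolding center_def by blast
    have "vge v 1 (z - (z - c))" using z c(2) v v.vge_diff[of 1 z "z - c"] unfolding center_def by blast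
    then have "c = 0" using v.vge_const_1[OF c(1)] by simp
    then show "z \<in> center w" using c(2) w z unfolding center_def by auto
  qed
  then show ?thesis using affine_place_eqI v.v v.vx w.v w.vx by blast
qed

lemma at_point_curve:
  assumes "at_point a b v"
  shows "a ^ (q + 1) = b ^ q + b"
proof -
  interpret affine_place q K x y v by (rule at_point_affine[OF assms])
  have ab: "a \<in> K" "b \<in> K" "vge v 1 (x - a)" "vge v 1 (y - b)" using assms unfolding at_point_def by auto
  have 1: "vge v 1 (x ^ q * (x - a) + a * (x - a) ^ q)"
    using q_gt_1 vge_mono[OF vge_power[OF ab(3), of q], of 1]
    by (intro vge_add vge_mult0[OF vge_R[OF R_power[OF R_x]] ab(3)] vge_mult0[OF vge_const[OF ab(1)]]) simp
  have 2: "vge v 1 ((y - b) ^ q + (y - b))"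
    using vge_mono[OF vge_power[OF ab(4), of q], of 1] q_gt_1 by (intro vge_add[OF _ ab(4)]) simp
  have "vge v 1 ((x ^ q * (x - a) + a * (x - a) ^ q) - ((y - b) ^ q + (y - b)))" by (rule vge_diff[OF 1 2])
  also have "\<dots> = (x ^ (q + 1) - (y ^ q + y)) - (a ^ (q + 1) - (b ^ q + b))"
    by (simp add: frob1 algebra_simps)
  finally have "vge v 1 (- (a ^ (q + 1) - (b ^ q + b)))" using curve by simp
  then have "vge v 1 (a ^ (q + 1) - (b ^ q + b))" by (simp only: vge_uminus)
  then have "a ^ (q + 1) - (b ^ q + b) = 0" using ab by (intro vge_const_1) (auto intro!: K_closed)
  then show ?thesis by simp
qed

end

locale rational_place = affine_place q K x y v for q and K :: "'f::field set" and x y :: 'f and v +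
  fixes a b assumes at: "at_point a b v"
begin

lemma aK: "a \<in> K" and bK: "b \<in> K" and va: "vge v 1 (x - a)" and vb: "vge v 1 (y - b)"
  using at unfolding at_point_def by auto

lemma value_ex: assumes "vge v 0 f" obtains c where "c \<in> K" "vge v 1 (f - c)"
proof -
  obtain z where z: "z \<in> R" "vge v 1 (f - z)" by (rule residue_rep[OF assms])
  obtain c where c: "c \<in> K" "\<forall>v. at_point a b v \<longrightarrow> vge v 1 (z - c)" by (rule R_value[OF z(1) aK bK])
  have "vge v 1 (f - z + (z - c))" using z c at by (intro vge_add[of 1 "f - z"]) auto
  then show ?thesis using that c by simp
qed

lemma value_unique: "c \<in> K \<Longrightarrow> d \<in> K \<Longrightarrow> vge v 1 (f - c) \<Longrightarrow> vge v 1 (f - d) \<Longrightarrow> c = d"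
  using vge_diff[of 1 "f - d" "f - c"] vge_const_1[of "c - d"] K_closed(3)[of c d] by simp

lemma frob_rational: assumes "z \<in> R" shows "vge v 1 (z ^ q ^ (2 * 1) - z)"
proof -
  obtain c where c: "c \<in> K" "vge v 1 (z - c)" by (rule value_ex[OF vge_R[OF assms]])
  have "vge v 1 ((z - c) ^ q ^ (2 * 1) - (z - c))"
    using vge_mono[OF vge_power[OF c(2), of "q ^ 2"], of 1] q_power_pos[of 2]
    by (intro vge_diff[OF _ c(2)]) (simp del: of_nat_power q_power_pos)
  also have "(z - c) ^ q ^ (2 * 1) - (z - c) = z ^ q ^ (2 * 1) - z"
    using K_frob[OF c(1), of 1] by (simp add: diff_power_q)
  finally show ?thesis .
qed

lemma rational_uniformizer: "v (x ^ q\<^sup>2 - x) = 1"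
  using uniformizer_val[of 1, OF _ frob_rational] by simp

text \<open>No tangent at an affine rational point is vertical: \<open>x ^ q ^ 2 - x\<close> has
  order 1 there and equals \<open>(x - a) ^ q ^ 2 - (x - a)\<close>, so \<open>x - a\<close> cannot
  have higher order.\<close>

lemma xa_nz: "x - a \<noteq> 0" and v_xa: "v (x - a) = 1"
proof -
  have eq: "x ^ q\<^sup>2 - x = (x - a) ^ q\<^sup>2 - (x - a)"
    using K_frob1[OF aK] diff_power_q[of x a 2] by simp
  have nz: "x ^ q\<^sup>2 - x \<noteq> 0" using x_frob_nz[of 1] by simp
  show xa: "x - a \<noteq> 0"
  proof
    assume "x - a = 0"
    then show False using nz q_power_pos[of 2] unfolding eq by simp
  qed
  have q2: "q\<^sup>2 \<ge> 2" using q_gt_1 power_increasing[of 1 2 q] by simp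
  show "v (x - a) = 1"
  proof (rule ccontr)
    assume "v (x - a) \<noteq> 1"
    then have 2: "vge v 2 (x - a)" using va xa unfolding vge_def by simp
    have "vge v 2 ((x - a) ^ q\<^sup>2 - (x - a))"
      using vge_mono[OF vge_power[OF va, of "q\<^sup>2"], of 2] q2 by (intro vge_diff[OF _ 2]) (simp del: of_nat_power)
    then show False using rational_uniformizer nz unfolding eq vge_def by simp
  qed
qed

lemma degree_1: "place_of_degree K 1 v"
  unfolding place_of_degree_def
proof (intro conjI exI[of _ "{1}"] ballI)
  fix z assume "z \<in> valuation_ring v"
  then have "vge v 0 z" by (simp add: in_valuation_ring_iff)
  then obtain c where c: "c \<in> K" "vge v 1 (z - c)" by (rule value_ex)
  show "\<exists>!c. c \<in> {1} \<rightarrow>\<^sub>E K \<and> z - (\<Sum>b\<in>{1}. c b * b) \<in> valuation_ideal v"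
  proof (rule ex1I[of _ "\<lambda>b\<in>{1}. c"])
    fix d assume d: "d \<in> {1} \<rightarrow>\<^sub>E K \<and> z - (\<Sum>b\<in>{1}. d b * b) \<in> valuation_ideal v"
    then have "d 1 \<in> K" "vge v 1 (z - d 1)" by (auto simp: in_valuation_ideal_iff)
    then have "d 1 = c" using value_unique c by blast
    then show "d = (\<lambda>b\<in>{1}. c)" using d by (intro extensionalityI[of _ "{1}"]) (auto simp: PiE_def)
  qed (use c in \<open>auto simp: in_valuation_ideal_iff\<close>)
qed (use v in \<open>auto simp: in_valuation_ring_iff\<close>)

end

context hermitian
begin

lemma rational_placeI: "at_point a b v \<Longrightarrow> rational_place q K x y v a b"
  using at_point_affine by (simp add: rational_place_def rational_place_axioms_def)

text \<open>The homogeneous equation is symmetric in \<open>Y\<close> and \<open>Z\<close>;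
  exchanging them moves the point at infinity to the origin.\<close>

lemma at_infinity: "hermitian q K (x / y) (1 / y)"
proof (rule hermitianI)
  have "x ^ (q + 1) / y ^ (q + 1) = (y ^ q + y) / y ^ (q + 1)" unfolding curve ..
  also have "\<dots> = 1 / y + 1 / y ^ q" by (simp add: field_simps)
  finally show "(x / y) ^ (q + 1) = (1 / y) ^ q + 1 / y" by (simp add: power_divide)
  fix L assume L: "is_subfield L" "K \<subseteq> L" "x / y \<in> L" "1 / y \<in> L"
  have y: "y \<in> L" using subfield_inverse[OF L(1,4)] by simp
  moreover have "x \<in> L" using subfield_mult[OF L(1,3) y] by simp
  ultimately show "x \<in> L \<and> y \<in> L" by simp
qed

lemma P_infinity_rational: "rational_place q K (x / y) (1 / y) (P_infinity K x y) 0 0"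
proof -
  interpret h: hermitian q K "x / y" "1 / y" by (rule at_infinity)
  have 0: "h.at_point 0 0 v \<longleftrightarrow> is_place K v \<and> x / y \<in> valuation_ideal v \<and> 1 / y \<in> valuation_ideal v" for v
    unfolding h.at_point_def in_valuation_ideal_iff using K_closed(1) by simp
  obtain v where v: "h.at_point 0 0 v" by (rule h.at_point_exists[of 0 0]) (use K_closed(1) q_gt_1 in auto)
  have "P_infinity K x y = v" unfolding P_infinity_def
  proof (rule the_equality)
    show "is_place K v \<and> x / y \<in> valuation_ideal v \<and> 1 / y \<in> valuation_ideal v" by (rule iffD1[OF 0 v])
    fix w assume "is_place K w \<and> x / y \<in> valuation_ideal w \<and> 1 / y \<in> valuation_ideal w"
    then have "h.at_point 0 0 w" by (rule iffD2[OF 0])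
    then show "w = v" using v by (rule h.at_point_unique)
  qed
  then show ?thesis using h.rational_placeI[OF v] by simp
qed

end

text \<open>Under the prefix \<open>inf\<close> everything proved for affine rational places is
  available at infinity, in the coordinates \<open>x / y\<close> and \<open>1 / y\<close>.\<close>

locale hermitian_curve = hermitian q K x y + inf: rational_place q K "x / y" "1 / y" "P_infinity K x y" 0 0
  for q and K :: "'f::field set" and x y
begin

abbreviation "Pinf \<equiv> P_infinity K x y"

lemma v_inf_x: "Pinf x = - int q" and v_inf_y: "Pinf y = - int (q + 1)"
proof -
  have y': "vge Pinf 1 (1 / y)" using inf.vb by simp
  have x': "Pinf (x / y) = 1" using inf.v_xa by simp
  have "Pinf ((x / y) ^ (q + 1)) = int (q + 1) * Pinf (x / y)" by (rule inf.v_power) simp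
  then have 1: "Pinf ((1 / y) ^ q + 1 / y) = int (q + 1)" using x' inf.curve by simp
  have "Pinf (1 / y + (1 / y) ^ q) = Pinf (1 / y)"
  proof (rule inf.v_add_eq(1))
    have "Pinf (1 / y) \<ge> 1" using y' unfolding vge_def by simp
    moreover have "int q \<ge> 2" using q_gt_1 by simp
    ultimately have "2 * Pinf (1 / y) \<le> int q * Pinf (1 / y)" by (intro mult_right_mono) auto
    then have "Pinf (1 / y) + 1 \<le> int q * Pinf (1 / y)" using \<open>Pinf (1 / y) \<ge> 1\<close> by linarith
    then show "vge Pinf (Pinf (1 / y) + 1) ((1 / y) ^ q)"
      unfolding vge_def by (subst inf.v_power) auto
  qed simp
  then have 2: "Pinf (1 / y) = int (q + 1)" using 1 by (simp add: add.commute)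
  then show y: "Pinf y = - int (q + 1)" using inf.v_divide[of 1 y] by simp
  show "Pinf x = - int q" using inf.v_divide[of x y] x' y by simp
qed

lemma not_affine_inf: "\<not> vge Pinf 0 x" using v_inf_x q_gt_1 unfolding vge_def by simp

text \<open>If \<open>x\<close> has a pole, so has \<open>y\<close>, and
  \<open>q * v y = (q + 1) * v x\<close> makes the pole of \<open>y\<close> the larger one. Then
  \<open>x / y\<close> and \<open>1 / y\<close> vanish, which characterises the point at
  infinity.\<close>

lemma place_affine_or_inf:
  assumes v: "is_place K v"
  shows "vge v 0 x \<or> v = Pinf"
proof (rule disjCI)
  interpret place K v using K v by unfold_locales
  assume "\<not> v = Pinf"
  show "vge v 0 x"
  proof (rule ccontr)
    assume "\<not> vge v 0 x"
    then have vx: "v x < 0" by (simp add: vge_def)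
    have eq: "int (q + 1) * v x = v (y ^ q + y)" using v_power[OF x_nz, of "q + 1"] unfolding curve[symmetric] by (simp only:)
    have vy: "v y < 0"
    proof (rule ccontr)
      assume "\<not> v y < 0"
      then have "vge v 0 (y ^ q + y)" by (intro vge_add vge_power0) (auto simp: vge_def)
      then have "y ^ q + y = 0 \<or> 0 \<le> int (q + 1) * v x" unfolding eq vge_def by simp
      moreover have "y ^ q + y \<noteq> 0" unfolding curve[symmetric] by simp
      ultimately show False using vx by (simp add: zero_le_mult_iff)
    qed
    have "int q * v y \<le> 2 * v y" using vy q_gt_1 by (intro mult_right_mono_neg) auto
    then have "int q * v y + 1 \<le> v y" using vy by linarith
    then have "v (y ^ q + y) = int q * v y"
      by (subst v_add_eq(1)) (auto simp: vge_def v_power)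
    then have "int q * v y = int q * v x + v x" using eq by (simp add: algebra_simps)
    then have "int q * v y < int q * v x" using vx by simp
    then have lt: "v y < v x" using q_gt_1 by (simp add: mult_less_cancel_left)
    have "inf.at_point 0 0 v"
      unfolding inf.at_point_def using v K_closed(1) lt vy by (auto simp: vge_def v_divide)
    then have "v = Pinf" using inf.at_point_unique inf.at by blast
    then show False using \<open>\<not> v = Pinf\<close> by simp
  qed
qed

lemma degree_one_places:
  "place_of_degree K 1 v \<and> v \<noteq> Pinf \<longleftrightarrow> (\<exists>a b. at_point a b v)"
proof
  assume dg: "place_of_degree K 1 v \<and> v \<noteq> Pinf"
  then have pl: "is_place K v" by (simp add: place_of_degree_def)
  then have "vge v 0 x" using place_affine_or_inf[OF pl] dg by blast
  then interpret affine_place q K x y v using pl by (intro affine_placeI)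
  obtain B where B: "B \<subseteq> valuation_ring v" "finite B" "card B = 1"
    "\<forall>z\<in>valuation_ring v. \<exists>!c. c \<in> B \<rightarrow>\<^sub>E K \<and> z - (\<Sum>b\<in>B. c b * b) \<in> valuation_ideal v"
    by (rule place_of_degreeD[OF conjunct1[OF dg]])
  then obtain e where e: "B = {e}" by (meson card_1_singletonE)
  have ex: "\<exists>c\<in>K. vge v 1 (z - c * e)" if vz: "vge v 0 z" for z
  proof -
    obtain c where "c \<in> B \<rightarrow>\<^sub>E K" "z - (\<Sum>b\<in>B. c b * b) \<in> valuation_ideal v"
      using ex1_implies_ex[OF bspec[OF B(4), of z]] vz unfolding in_valuation_ring_iff by blast
    then show ?thesis using e by (auto simp: in_valuation_ideal_iff)
  qed
  have ve: "vge v 0 e" using B(1) e by (simp add: in_valuation_ring_iff)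
  \<comment> \<open>The basis element \<open>e\<close> need not be 1; expressing 1 through
    \<open>e\<close> allows to rescale all representatives to constants.\<close>
  obtain d where d: "d \<in> K" "vge v 1 (1 - d * e)" using ex[of 1] by auto
  have "d \<noteq> 0" using d not_vge_1 by auto
  have ex': "\<exists>c\<in>K. vge v 1 (z - c)" if z: "vge v 0 z" for z
  proof -
    obtain c where c: "c \<in> K" "vge v 1 (z - c * e)" using ex[OF z] by auto
    have "vge v 1 ((z - c * e) - c / d * (1 - d * e))"
      by (rule vge_diff[OF c(2) vge_mult0[OF vge_const[OF K_closed(8)[OF c(1) d(1)]] d(2)]])
    also have "(z - c * e) - c / d * (1 - d * e) = z - c / d" using \<open>d \<noteq> 0\<close> by (simp add: field_simps)
    finally show ?thesis using K_closed(8)[OF c(1) d(1)] by blast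
  qed
  show "\<exists>a b. at_point a b v" using ex'[OF vx] ex'[OF vy] pl unfolding at_point_def by blast
next
  assume "\<exists>a b. at_point a b v"
  then obtain a b where ab: "at_point a b v" by blast
  interpret rational_place q K x y v a b by (rule rational_placeI[OF ab])
  show "place_of_degree K 1 v \<and> v \<noteq> Pinf" using degree_1 vx not_affine_inf by auto
qed

lemma vge_inf_S: assumes "z \<in> S n" shows "vge Pinf (1 - int n) z"
proof (rule inf.vge_lspan)
  show "z \<in> lspan K {x ^ i * y ^ j | i j. j < q \<and> wt i j < n}" using assms unfolding S_def .
  fix e assume "e \<in> {x ^ i * y ^ j | i j. j < q \<and> wt i j < n}"
  then obtain i j where e: "e = x ^ i * y ^ j" "wt i j < n" by blast
  have "Pinf e = - int (wt i j)"
    unfolding e(1) by (simp add: inf.v_mult inf.v_power v_inf_x v_inf_y algebra_simps)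
  then show "vge Pinf (1 - int n) e" using e(2) unfolding vge_def by linarith
qed

text \<open>Reduced monomials have distinct pole orders, so the pole order of \<open>z\<close> is
  the weight of its leading monomial. With \<open>vge_inf_S\<close> this describes the Riemann-Roch
  spaces of multiples of the point at infinity.\<close>

lemma S_of_vge_inf:
  assumes "z \<in> R" "vge Pinf (- int n) z"
  shows "z \<in> S (n + 1)"
proof (cases "z = 0")
  case False
  obtain c i j s where *: "c \<in> K" "c \<noteq> 0" "j < q" "s \<in> S (wt i j)" "z = c * (x ^ i * y ^ j) + s"
    by (rule R_leading[OF assms(1) False])
  have v: "Pinf (c * (x ^ i * y ^ j)) = - int (wt i j)"
    using *(1,2) by (simp add: inf.v_mult inf.v_power v_inf_x v_inf_y inf.v_const algebra_simps)
  have "Pinf z = - int (wt i j)"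
    unfolding *(5) v[symmetric]
  proof (rule inf.v_add_eq)
    have "- int (wt i j) + 1 = 1 - int (wt i j)" by simp
    then show "vge Pinf (Pinf (c * (x ^ i * y ^ j)) + 1) s" using vge_inf_S[OF *(4)] unfolding v by (simp only:)
  qed (use *(2) in simp)
  then have le: "wt i j < n + 1" using assms(2) False unfolding vge_def by linarith
  show ?thesis unfolding *(5) using S_mon[OF *(3) le] S_mono[of "wt i j" "n + 1"] le *(1,4)
    by (intro S_add S_scale[OF *(1)]) auto
qed simp

end

lemma (in hermitian) hermitian_curve: "hermitian_curve q K x y"
  by (intro hermitian_curve.intro P_infinity_rational hermitian_axioms)

section \<open>Derivations and differentials\<close>

lemma poly_as_sum_le:
  fixes p :: "'a::comm_semiring_1 poly"
  assumes "\<And>i. i > n \<Longrightarrow> coeff p i = 0"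
  shows "poly p a = (\<Sum>i\<le>n. coeff p i * a ^ i)"
proof -
  have "degree p \<le> n" using assms by (intro degree_le) auto
  then show ?thesis unfolding poly_altdef
    by (intro sum.mono_neutral_left) (auto simp: coeff_eq_0)
qed

context hermitian
begin

text \<open>Every element is a polynomial in \<open>x\<close> whose coefficients are \<open>q\<close>-th powers, so that
  a derivation has to act as \<open>poly (pderiv G) x\<close>. Well-definedness uses that \<open>1, x, \<dots>, x ^ (q - 1)\<close>
  have distinct valuations modulo \<open>q\<close> at the origin.\<close>

definition q_coeffs :: "'f poly \<Rightarrow> bool" where
  "q_coeffs G \<longleftrightarrow> (\<forall>i. \<exists>c. coeff G i = c ^ q)"

lemma q_coeffs_const: "q_coeffs [:c ^ q:]"
proof -
  have "\<exists>d. coeff [:c ^ q:] i = d ^ q" for i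
    by (cases i) (use q_gt_1 in \<open>auto intro: exI[of _ 0]\<close>)
  then show ?thesis unfolding q_coeffs_def by blast
qed

lemma q_coeffs_diff: assumes "q_coeffs G" "q_coeffs H" shows "q_coeffs (G - H)"
  unfolding q_coeffs_def
proof
  fix i
  obtain c d where "coeff G i = c ^ q" "coeff H i = d ^ q" using assms unfolding q_coeffs_def by metis
  then have "coeff (G - H) i = (c - d) ^ q" by (simp add: frob1)
  then show "\<exists>c. coeff (G - H) i = c ^ q" by blast
qed

lemma q_coeffs_mult: assumes "q_coeffs G" "q_coeffs H" shows "q_coeffs (G * H)"
  unfolding q_coeffs_def
proof
  fix i
  obtain c d where "\<And>i. coeff G i = c i ^ q" "\<And>i. coeff H i = d i ^ q" using assms unfolding q_coeffs_def by metis
  then have "coeff (G * H) i = (\<Sum>j\<le>i. c j * d (i - j)) ^ q"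
    unfolding coeff_mult using sum_power_q[of "\<lambda>j. c j * d (i - j)" "{..i}" 1] by (simp add: power_mult_distrib)
  then show "\<exists>c. coeff (G * H) i = c ^ q" by blast
qed

lemma q_coeffs_X: "q_coeffs [:0, 1:]"
proof -
  have "\<exists>d. coeff [:0, 1::'f:] i = d ^ q" for i
    using q_gt_1 by (cases i; cases "i - 1") (auto intro: exI[of _ 0] exI[of _ 1])
  then show ?thesis unfolding q_coeffs_def by blast
qed

text \<open>The field is generated by \<open>x\<close> over its \<open>q\<close>-th powers: a
  constant \<open>a\<close> is \<open>(a ^ q) ^ q\<close>, the curve equation gives \<open>y\<close>
  as \<open>x ^ (q + 1) - y ^ q\<close>, and an inverse is \<open>a ^ (q - 1)\<close> times the
  \<open>q\<close>-th power of the inverse.\<close>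

lemma q_coeffs_surj: obtains G where "q_coeffs G" "poly G x = z"
proof -
  let ?L = "{poly G x | G. q_coeffs G}"
  have LI: "poly G x \<in> ?L" if "q_coeffs G" for G using that by blast
  have xL: "x \<in> ?L" using LI[OF q_coeffs_X] by simp
  have pL: "c ^ q \<in> ?L" for c using LI[OF q_coeffs_const[of c]] by simp
  have sub: "a - b \<in> ?L" if ab: "a \<in> ?L" "b \<in> ?L" for a b
  proof -
    obtain G H where "a = poly G x" "q_coeffs G" "b = poly H x" "q_coeffs H" using ab by blast
    then show ?thesis using LI[OF q_coeffs_diff[of G H]] by simp
  qed
  have mul: "a * b \<in> ?L" if ab: "a \<in> ?L" "b \<in> ?L" for a b
  proof -
    obtain G H where "a = poly G x" "q_coeffs G" "b = poly H x" "q_coeffs H" using ab by blast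
    then show ?thesis using LI[OF q_coeffs_mult[of G H]] by simp
  qed
  have pw: "a ^ n \<in> ?L" if "a \<in> ?L" for a n
  proof (induction n)
    case 0
    then show ?case using pL[of 1] by simp
  next
    case (Suc n)
    then show ?case using mul[OF that Suc] by simp
  qed
  have inv: "inverse a \<in> ?L" if a: "a \<in> ?L" for a
  proof -
    have "q - 1 + 1 = q" using q_gt_1 by simp
    then have "a ^ (q - 1) * inverse a ^ q = inverse a"
      using power_minus_mult[of q a] q_gt_1 by (cases "a = 0") (auto simp: power_inverse field_simps)
    then show ?thesis using mul[OF pw[OF a, of "q - 1"] pL[of "inverse a"]] by (simp only:)
  qed
  have "is_subfield ?L" unfolding is_subfield_def
    using pL[of 1] sub mul inv by simp
  moreover have "K \<subseteq> ?L"
  proof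
    fix a assume "a \<in> K"
    then have "a = (a ^ q) ^ q" using K_frob1[of a] by (simp add: power_mult[symmetric] power2_eq_square)
    then show "a \<in> ?L" using pL[of "a ^ q"] by simp
  qed
  moreover have "y \<in> ?L"
  proof -
    have "x ^ (q + 1) - y ^ q = y" using curve by simp
    then show ?thesis using sub[OF pw[OF xL, of "q + 1"] pL[of y]] by (simp only:)
  qed
  ultimately have "?L = UNIV" using generated xL by blast
  then have "z \<in> ?L" by blast
  then show ?thesis using that by blast
qed

lemma q_coeffs_kernel:
  assumes "q_coeffs G" "poly G x = 0"
  shows "poly (pderiv G) x = 0"
proof -
  obtain v where v: "at_point 0 0 v" by (rule at_point_exists[of 0 0]) (use K_closed(1) q_gt_1 in auto)
  interpret rational_place q K x y v 0 0 by (rule rational_placeI[OF v])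
  have vx1: "v x = 1" using v_xa by simp
  obtain c where c: "\<And>i. coeff G i = c i ^ q" using assms(1) unfolding q_coeffs_def by metis
  let ?n = "degree G" and ?I = "\<lambda>r. {i \<in> {..degree G}. i mod q = r}"
  \<comment> \<open>Terms are collected by exponents modulo \<open>q\<close>: the value at
    \<open>x\<close> is the sum of \<open>x ^ r * h r ^ q\<close> over \<open>r < q\<close>, whose
    nonzero terms have distinct orders modulo \<open>q\<close> at the origin.\<close>
  define h where "h r = (\<Sum>i\<in>?I r. c i * x ^ (i div q))" for r
  have h: "(\<Sum>i\<in>?I r. coeff G i * x ^ i) = x ^ r * h r ^ q" for r
  proof -
    have "h r ^ q = (\<Sum>i\<in>?I r. (c i * x ^ (i div q)) ^ q)"
      unfolding h_def using sum_power_q[of _ _ 1] by simp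
    then have "x ^ r * h r ^ q = (\<Sum>i\<in>?I r. x ^ r * (c i * x ^ (i div q)) ^ q)" by (simp add: sum_distrib_left)
    also have "\<dots> = (\<Sum>i\<in>?I r. coeff G i * x ^ i)"
    proof (rule sum.cong[OF refl])
      fix i assume "i \<in> ?I r"
      then have "x ^ i = x ^ (r + q * (i div q))" by auto
      then show "x ^ r * (c i * x ^ (i div q)) ^ q = coeff G i * x ^ i"
        by (simp add: c power_mult_distrib power_add power_mult[symmetric] mult_ac)
    qed
    finally show ?thesis by simp
  qed
  have "poly G x = (\<Sum>r<q. \<Sum>i\<in>?I r. coeff G i * x ^ i)"
    unfolding poly_altdef by (rule sum.group[symmetric]) (use q_gt_1 in auto)
  then have s0: "(\<Sum>r<q. x ^ r * h r ^ q) = 0" using assms(2) h by simp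
  have h0: "h r = 0" if "r < q" for r
  proof (rule ccontr)
    assume hr: "h r \<noteq> 0"
    let ?J = "{r \<in> {..<q}. h r \<noteq> 0}"
    have val: "v (x ^ r * h r ^ q) = int r + int q * v (h r)" if "h r \<noteq> 0" for r
      using that by (simp add: v_mult v_power vx1)
    have "(\<Sum>r\<in>?J. x ^ r * h r ^ q) \<noteq> 0"
    proof (rule conjunct1[OF sum_distinct_valuations])
      show "?J \<noteq> {}" using hr that by blast
      show "inj_on (\<lambda>r. v (x ^ r * h r ^ q)) ?J"
      proof
        fix r s assume rs: "r \<in> ?J" "s \<in> ?J" "v (x ^ r * h r ^ q) = v (x ^ s * h s ^ q)"
        then have "int r + int q * v (h r) = int s + int q * v (h s)" using val by simp
        then have "(int r + int q * v (h r)) mod int q = (int s + int q * v (h s)) mod int q" by simp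
        then have "int r mod int q = int s mod int q" by simp
        then show "r = s" using rs by simp
      qed
    qed auto
    moreover have "(\<Sum>r\<in>?J. x ^ r * h r ^ q) = (\<Sum>r<q. x ^ r * h r ^ q)"
      by (rule sum.mono_neutral_left) (use q_gt_1 in auto)
    ultimately show False using s0 by simp
  qed
  \<comment> \<open>Multiplying the derivative by \<open>x\<close> restores the exponents. As
    \<open>q\<close> is 0 in the field, each block is then multiplied by its residue
    \<open>r\<close>.\<close>
  have co: "coeff (pCons 0 (pderiv G)) i = of_nat i * coeff G i" for i
    by (cases i) (auto simp: coeff_pderiv)
  have "poly (pCons 0 (pderiv G)) x = (\<Sum>i\<le>?n. of_nat i * coeff G i * x ^ i)"
    by (subst poly_as_sum_le[of ?n]) (auto simp: co coeff_eq_0)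
  also have "\<dots> = (\<Sum>r<q. \<Sum>i\<in>?I r. of_nat i * coeff G i * x ^ i)"
    by (rule sum.group[symmetric]) (use q_gt_1 in auto)
  also have "\<dots> = (\<Sum>r<q. of_nat r * (\<Sum>i\<in>?I r. coeff G i * x ^ i))"
  proof (rule sum.cong[OF refl])
    fix r assume "r \<in> {..<q}"
    have "of_nat i = (of_nat r :: 'f)" if "i \<in> ?I r" for i
    proof -
      have "of_nat i = (of_nat (q * (i div q) + i mod q) :: 'f)" by simp
      then show ?thesis using that of_nat_q by (simp only: of_nat_add of_nat_mult) simp
    qed
    then show "(\<Sum>i\<in>?I r. of_nat i * coeff G i * x ^ i) = of_nat r * (\<Sum>i\<in>?I r. coeff G i * x ^ i)"
      by (simp add: sum_distrib_left mult.assoc)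
  qed
  also have "\<dots> = 0" using h h0 q_gt_1 by (intro sum.neutral) auto
  finally show ?thesis by simp
qed

lemma derivation_exists: obtains \<delta> where "\<delta> \<in> derivations K" "\<delta> x = 1"
proof -
  have "\<exists>G. q_coeffs G \<and> poly G x = z" for z by (rule q_coeffs_surj[of z]) blast
  then obtain G where G: "\<And>z. q_coeffs (G z) \<and> poly (G z) x = z" by metis
  define \<delta> where "\<delta> z = poly (pderiv (G z)) x" for z
  have eq: "\<delta> (poly H x) = poly (pderiv H) x" if "q_coeffs H" for H
  proof -
    have "poly (pderiv (G (poly H x) - H)) x = 0"
      by (rule q_coeffs_kernel[OF q_coeffs_diff]) (use G that in auto)
    then show ?thesis unfolding \<delta>_def by (simp add: pderiv_diff)
  qed
  have add: "\<delta> (f + g) = \<delta> f + \<delta> g" for f g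
  proof -
    have *: "q_coeffs (G f - (G 0 - G g))" using G q_coeffs_diff by blast
    have 0: "\<delta> 0 = 0" using eq[OF q_coeffs_const[of 0]] q_gt_1 by (simp add: power_0_left)
    have "\<delta> (f + g) = poly (pderiv (G f - (G 0 - G g))) x" using eq[OF *] G by simp
    also have "\<dots> = \<delta> f - (\<delta> 0 - \<delta> g)" unfolding \<delta>_def by (simp add: pderiv_diff)
    finally show ?thesis using 0 by simp
  qed
  have mult: "\<delta> (f * g) = f * \<delta> g + g * \<delta> f" for f g
  proof -
    have *: "q_coeffs (G f * G g)" using G q_coeffs_mult by blast
    have "\<delta> (f * g) = poly (pderiv (G f * G g)) x" using eq[OF *] G by simp
    also have "\<dots> = f * \<delta> g + g * \<delta> f" unfolding \<delta>_def using G by (simp add: pderiv_mult)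
    finally show ?thesis .
  qed
  have const: "\<delta> a = 0" if "a \<in> K" for a
  proof -
    have "a = (a ^ q) ^ q" using K_frob1[OF that] by (simp add: power_mult[symmetric] power2_eq_square)
    then show ?thesis using eq[OF q_coeffs_const[of "a ^ q"]] by (simp add: pderiv_pCons)
  qed
  have "\<delta> x = 1" using eq[OF q_coeffs_X] by (simp add: pderiv_pCons)
  then show ?thesis using that[of \<delta>] add mult const unfolding derivations_def by blast
qed

end

section \<open>Rules for derivations, and differentials as multiples of dx\<close>

context hermitian
begin

context
  fixes \<delta> assumes \<delta>: "\<delta> \<in> derivations K"
begin

lemma der_const: "a \<in> K \<Longrightarrow> \<delta> a = 0" and der_add: "\<delta> (f + g) = \<delta> f + \<delta> g"
  and der_mult: "\<delta> (f * g) = f * \<delta> g + g * \<delta> f"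
  using \<delta> unfolding derivations_def by auto

lemma der_0: "\<delta> 0 = 0" and der_1: "\<delta> 1 = 0" using der_const K_closed(1,2) by auto

lemma der_minus: "\<delta> (- f) = - \<delta> f" using der_add[of f "- f"] der_0 by (simp add: eq_neg_iff_add_eq_0 add.commute)

lemma der_diff: "\<delta> (f - g) = \<delta> f - \<delta> g" using der_add[of f "- g"] der_minus by simp

lemma der_power: "\<delta> (f ^ n) = of_nat n * f ^ (n - 1) * \<delta> f"
proof (induction n)
  case (Suc n)
  then show ?case by (cases n) (simp_all add: der_mult algebra_simps)
qed (simp add: der_1)

lemma der_qpower: "k > 0 \<Longrightarrow> \<delta> (f ^ (q ^ k)) = 0"
  unfolding der_power by (cases k) (simp_all add: of_nat_q)

lemma der_y: "\<delta> y = x ^ q * \<delta> x"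
proof -
  have "\<delta> (x ^ (q + 1)) = \<delta> (y ^ q) + \<delta> y" unfolding curve by (rule der_add)
  moreover have "\<delta> (x ^ (q + 1)) = of_nat (q + 1) * x ^ (q + 1 - 1) * \<delta> x" by (rule der_power)
  ultimately show ?thesis using der_qpower[of 1 y] of_nat_q by simp
qed

lemma der_inverse: "\<delta> (inverse f) = - \<delta> f / f\<^sup>2"
proof (cases "f = 0")
  case False
  then have "f * \<delta> (inverse f) + inverse f * \<delta> f = 0" using der_mult[of f "inverse f"] der_1 by simp
  then show ?thesis using False by (simp add: field_simps power2_eq_square eq_neg_iff_add_eq_0)
qed (simp add: der_0)

lemma der_unique: assumes "\<delta> x = 0" shows "\<delta> z = 0"
proof -
  have "is_subfield {z. \<delta> z = 0}"
    unfolding is_subfield_def by (auto simp: der_1 der_diff der_mult der_inverse)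
  then have "{z. \<delta> z = 0} = UNIV" by (rule generated) (use der_const der_y assms in auto)
  then show ?thesis by blast
qed

end

lemma derivation_scale:
  assumes "\<delta> \<in> derivations K"
  shows "(\<lambda>z. f * \<delta> z) \<in> derivations K"
  using assms unfolding derivations_def by (auto simp: algebra_simps)

lemma derivation_eq:
  assumes "\<delta> \<in> derivations K" "\<delta>0 \<in> derivations K" "\<delta>0 x = 1"
  shows "\<delta> = (\<lambda>z. \<delta> x * \<delta>0 z)"
proof
  fix z
  have "(\<lambda>z. \<delta> z - \<delta> x * \<delta>0 z) \<in> derivations K"
    using assms unfolding derivations_def by (auto simp: algebra_simps)
  from der_unique[OF this, of z] show "\<delta> z = \<delta> x * \<delta>0 z" using assms by simp
qed

lemma derivation_R: assumes "\<delta> \<in> derivations K" "\<delta> x = 1" "z \<in> R" shows "\<delta> z \<in> R"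
  using assms(3)
proof (induction rule: R_induct)
  case y
  then show ?case using der_y[OF assms(1)] assms(2) by (auto intro: R_closed)
next
  case (const a)
  then show ?case using der_const[OF assms(1)] by simp
qed (use assms in \<open>auto simp: der_add der_mult intro: R_closed\<close>)

lemma differential_rep:
  assumes \<delta>: "\<delta> \<in> derivations K" "\<delta> x = 1"
  shows differential_conv: "differential K f t = differential K (f * \<delta> t) x"
    and differential_inj: "differential K f x = differential K g x \<longleftrightarrow> f = g"
    and differentials_ex: "\<omega> \<in> differentials K \<Longrightarrow> \<exists>h. \<omega> = differential K h x"
proof -
  show "differential K f t = differential K (f * \<delta> t) x"
    unfolding differential_def
  proof (rule restrict_ext)
    fix \<epsilon> assume "\<epsilon> \<in> derivations K"
    then have "\<epsilon> t = \<epsilon> x * \<delta> t" using fun_cong[OF derivation_eq[OF _ \<delta>], of \<epsilon> t] by simp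
    then show "f * \<epsilon> t = f * \<delta> t * \<epsilon> x" by simp
  qed
  show "differential K f x = differential K g x \<longleftrightarrow> f = g"
  proof
    assume "differential K f x = differential K g x"
    then have "differential K f x \<delta> = differential K g x \<delta>" by simp
    then show "f = g" using \<delta> unfolding differential_def by simp
  qed simp
  show "\<exists>h. \<omega> = differential K h x" if w: "\<omega> \<in> differentials K"
  proof (intro exI extensionalityI)
    show "\<omega> \<in> extensional (derivations K)" using w unfolding differentials_def by simp
    show "differential K (\<omega> \<delta>) x \<in> extensional (derivations K)" unfolding differential_def by simp
    fix \<epsilon> assume e: "\<epsilon> \<in> derivations K"
    have "\<omega> \<epsilon> = \<omega> (\<lambda>z. \<epsilon> x * \<delta> z)" using derivation_eq[OF e \<delta>] by simp
    also have "\<dots> = \<epsilon> x * \<omega> \<delta>" using w \<delta> unfolding differentials_def by blast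
    finally show "\<omega> \<epsilon> = differential K (\<omega> \<delta>) x \<epsilon>" using e unfolding differential_def by (simp add: mult.commute)
  qed
qed

lemma differential_in: "differential K f t \<in> differentials K"
proof -
  have *: "(\<lambda>z. \<delta> z + \<epsilon> z) \<in> derivations K" if "\<delta> \<in> derivations K" "\<epsilon> \<in> derivations K" for \<delta> \<epsilon> :: "'f \<Rightarrow> 'f"
    using that unfolding derivations_def by (auto simp: algebra_simps)
  show ?thesis unfolding differentials_def differential_def
    using * derivation_scale by (auto simp: algebra_simps)
qed

lemma zero_differential_eq: "zero_differential K = differential K 0 x"
  unfolding zero_differential_def differential_def by simp

end

context affine_place
begin

text \<open>The derivation preserves \<open>R\<close>, as it sends \<open>y\<close> to
  \<open>x ^ q\<close>; the product rule carries this over to the valuation ring, where denominators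
  are units.\<close>

lemma derivation_integral:
  assumes \<delta>: "\<delta> \<in> derivations K" "\<delta> x = 1" and f: "vge v 0 f"
  shows "vge v 0 (\<delta> f)"
proof -
  obtain z s where *: "z \<in> R" "s \<in> R" "s \<noteq> 0" "v s = 0" "f * s = z" by (rule vge_0_rep[OF f])
  have "\<delta> f * s = \<delta> z - f * \<delta> s" using der_mult[OF \<delta>(1), of f s] *(5) by (simp add: algebra_simps)
  moreover have "vge v 0 (\<delta> z - f * \<delta> s)"
    by (rule vge_diff[OF vge_R[OF derivation_R[OF \<delta> *(1)]] vge_mult0[OF f vge_R[OF derivation_R[OF \<delta> *(2)]]]])
  ultimately have "vge v 0 (\<delta> f * s)" by (simp only:)
  then show ?thesis using *(4,3) by (rule vge_unit_cancel)
qed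

text \<open>The uniformizer \<open>x ^ q ^ (2 * k) - x\<close> has derivative \<open>- 1\<close>,
  and any other one is a unit multiple of it. Hence dx has neither zeros nor poles at affine
  places.\<close>

lemma derivation_uniformizer:
  assumes \<delta>: "\<delta> \<in> derivations K" "\<delta> x = 1" and t: "v t = 1"
  shows derivation_uniformizer_nz: "\<delta> t \<noteq> 0" and derivation_uniformizer_unit: "v (\<delta> t) = 0"
proof -
  obtain k where k0: "k > 0" "\<forall>z\<in>R. vge v 1 (z ^ q ^ (2 * k) - z)" by (rule frobenius_ex)
  note k = k0(1) bspec[OF k0(2)]
  let ?t = "x ^ q ^ (2 * k) - x"
  have vt: "v ?t = 1" by (rule uniformizer_val[OF k])
  have nz: "?t \<noteq> 0" by (rule x_frob_nz[OF k(1)])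
  have tnz: "t \<noteq> 0" using t by auto
  have dt: "\<delta> ?t = - 1" using der_diff[OF \<delta>(1)] der_qpower[OF \<delta>(1), of "2 * k" x] k(1) \<delta>(2) by simp
  define e where "e = t / ?t"
  have e: "t = ?t * e" "e \<noteq> 0" "v e = 0" using nz tnz t vt v_divide[of t ?t] unfolding e_def by auto
  have "\<delta> t = - e + ?t * \<delta> e" unfolding e(1) using der_mult[OF \<delta>(1), of ?t e] dt by (simp add: e_def)
  moreover have "vge v (v (- e) + 1) (?t * \<delta> e)"
    using vge_mult[of 1 ?t 0 "\<delta> e"] derivation_integral[OF \<delta>, of e] e vt by (simp add: vge_def)
  ultimately show "\<delta> t \<noteq> 0" "v (\<delta> t) = 0" using v_add_eq[of "- e" "?t * \<delta> e"] e by simp_all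
qed

lemma order_at_affine:
  assumes "h \<noteq> 0"
  shows "order_at K (differential K h x) v = v h"
proof -
  obtain \<delta> where \<delta>: "\<delta> \<in> derivations K" "\<delta> x = 1" by (rule derivation_exists)
  obtain t where t: "v t = 1" using ex_uniformizer by blast
  note u = derivation_uniformizer[OF \<delta>]
  show ?thesis unfolding order_at_def
  proof (rule the_equality)
    have "differential K h x = differential K (h / \<delta> t) t"
      unfolding differential_conv[OF \<delta>, of "h / \<delta> t" t] using u(1)[OF t] by simp
    moreover have "v h = v (h / \<delta> t)" using v_divide[OF assms u(1)[OF t]] u(2)[OF t] by simp
    ultimately show "\<exists>t f. v t = 1 \<and> differential K h x = differential K f t \<and> v h = v f" using t by blast
    fix n assume "\<exists>t f. v t = 1 \<and> differential K h x = differential K f t \<and> n = v f"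
    then obtain s f where *: "v s = 1" "differential K h x = differential K f s" "n = v f" by blast
    then have "h = f * \<delta> s" unfolding differential_conv[OF \<delta>, of f s] differential_inj[OF \<delta>] by simp
    moreover from this have "f \<noteq> 0" using assms by auto
    ultimately show "n = v h" using v_mult[of f "\<delta> s"] u[OF *(1)] *(3) by simp
  qed
qed

end

context rational_place
begin

text \<open>The definition allows every local parameter and every length of the principal part. So
  it is shown that the coefficients from the second on vanish, that \<open>c 1\<close> is the value
  of \<open>f * t\<close>, and that this value agrees with the one of
  \<open>h * (x - a)\<close>.\<close>

lemma residue_simple_pole:
  assumes h: "vge v (- 1) h" and r: "r \<in> K" "vge v 1 (h * (x - a) - r)"
  shows "residue_at K v (differential K h x) = r"
proof -
  obtain \<delta> where \<delta>: "\<delta> \<in> derivations K" "\<delta> x = 1" by (rule derivation_exists)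
  note u = derivation_uniformizer[OF \<delta>]
  have dxa: "\<delta> (x - a) = 1" using der_diff[OF \<delta>(1)] der_const[OF \<delta>(1) aK] \<delta>(2) by simp
  show ?thesis unfolding residue_at_def
  proof (rule the_equality)
    have "h - r / (x - a) = (h * (x - a) - r) / (x - a)" using xa_nz by (simp add: field_simps)
    moreover have "vge v 0 ((h * (x - a) - r) / (x - a))"
      using vge_cancel[of 1 "(h * (x - a) - r) / (x - a)" "x - a"] xa_nz v_xa r(2) by simp
    ultimately have "h - r / (x - a) \<in> valuation_ring v" unfolding in_valuation_ring_iff by simp
    moreover have "differential K h x = differential K h (x - a)"
      unfolding differential_conv[OF \<delta>, of h "x - a"] dxa by simp
    ultimately show "\<exists>t f a n. v t = 1 \<and> differential K h x = differential K f t \<and> 1 \<le> n \<and>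
      (\<forall>i\<in>{1..n}. a i \<in> K) \<and> f - (\<Sum>i=1..n. a i / t ^ i) \<in> valuation_ring v \<and> r = a 1"
      using v_xa r(1) by (intro exI[of _ "x - a"] exI[of _ h] exI[of _ "\<lambda>_. r"] exI[of _ 1]) simp
    fix s assume "\<exists>t f a n. v t = 1 \<and> differential K h x = differential K f t \<and> 1 \<le> n \<and>
      (\<forall>i\<in>{1..n}. a i \<in> K) \<and> f - (\<Sum>i=1..n. a i / t ^ i) \<in> valuation_ring v \<and> s = a 1"
    then obtain t f c n where *: "v t = 1" "differential K h x = differential K f t" "1 \<le> n"
      "\<forall>i\<in>{1..n}. c i \<in> K" "f - (\<Sum>i=1..n. c i / t ^ i) \<in> valuation_ring v" "s = c 1" by blast
    have tnz: "t \<noteq> 0" using *(1) by auto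
    have hf: "h = f * \<delta> t" using *(2) unfolding differential_conv[OF \<delta>, of f t] differential_inj[OF \<delta>] by simp
    have f1: "vge v (- 1) f" using h vge_unit_cancel[of "- 1" f "\<delta> t"] u[OF *(1)] unfolding hf by blast
    let ?g = "\<Sum>i=1..n. c i / t ^ i"
    have fg: "vge v 0 (f - ?g)" using *(5) by (simp add: in_valuation_ring_iff)
    have "vge v (- 1) (f - (f - ?g))" by (rule vge_diff[OF f1 vge_mono[OF fg]]) simp
    then have g1: "vge v (- 1) ?g" by simp
    have c0: "c i = 0" if i: "i \<in> {2..n}" for i
    proof (rule ccontr)
      assume ci: "c i \<noteq> 0"
      let ?J = "{i \<in> {1..n}. c i \<noteq> 0}"
      have val: "v (c i / t ^ i) = - int i" if "i \<in> ?J" for i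
        using that tnz *(1,4) by (simp add: v_divide v_power v_const)
      have s: "?g = (\<Sum>i\<in>?J. c i / t ^ i)" by (rule sum.mono_neutral_right) auto
      have iJ: "i \<in> ?J" using i ci by simp
      have "(\<Sum>i\<in>?J. c i / t ^ i) \<noteq> 0 \<and> (\<exists>i\<in>?J. v (\<Sum>i\<in>?J. c i / t ^ i) = v (c i / t ^ i) \<and>
          (\<forall>j\<in>?J. v (c i / t ^ i) \<le> v (c j / t ^ j)))"
      proof (rule sum_distinct_valuations)
        show "inj_on (\<lambda>i. v (c i / t ^ i)) ?J" 
        proof (rule inj_onI)
          fix i j assume "i \<in> ?J" "j \<in> ?J" "v (c i / t ^ i) = v (c j / t ^ j)"
          then show "i = j" using val[of i] val[of j] by simp
        qed
      qed (use iJ tnz in auto)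
      then have "?g \<noteq> 0" "v ?g \<le> v (c i / t ^ i)" unfolding s using iJ by fastforce+
      then show False using g1 val[OF iJ] i unfolding vge_def by simp
    qed
    have "?g = c 1 / t ^ 1 + (\<Sum>i=2..n. c i / t ^ i)"
      using *(3) sum.atLeast_Suc_atMost[of 1 n "\<lambda>i. c i / t ^ i"] by (simp add: numeral_2_eq_2)
    then have "?g = c 1 / t" using c0 by simp
    then have "vge v 0 (f - c 1 / t)" using fg by simp
    then have "vge v 1 (t * (f - c 1 / t))" using vge_mult[of 1 t 0 "f - c 1 / t"] *(1) by (simp add: vge_def)
    then have ft: "vge v 1 (f * t - c 1)" using tnz by (simp add: algebra_simps)
    \<comment> \<open>As \<open>t = (x - a) * e\<close> has derivative
      \<open>e + (x - a) * \<delta> e\<close>, the functions \<open>f * t\<close> and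
      \<open>h * (x - a)\<close> differ only by a term of positive order.\<close>
    define e where "e = t / (x - a)"
    have e: "t = (x - a) * e" "v e = 0" using xa_nz tnz v_xa *(1) v_divide[of t "x - a"] unfolding e_def by auto
    have "\<delta> t = (x - a) * \<delta> e + e" unfolding e(1) using der_mult[OF \<delta>(1), of "x - a" e] dxa by (simp add: e_def)
    moreover have "f * (d * D + e) * d = f * (d * e) + f * (d ^ 2 * D)" for d D
      by (simp add: algebra_simps power2_eq_square)
    ultimately have "h * (x - a) = f * ((x - a) * e) + f * ((x - a) ^ 2 * \<delta> e)"
      unfolding hf by (simp only:)
    then have hft: "h * (x - a) = f * t + f * ((x - a) ^ 2 * \<delta> e)" using e(1) by simp
    have "vge v 0 (\<delta> e)" using derivation_integral[OF \<delta>, of e] e(2) by (simp add: vge_def)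
    then have "vge v (- 1 + (2 + 0)) (f * ((x - a) ^ 2 * \<delta> e))"
      using vge_power[OF va, of 2] by (intro vge_mult f1) auto
    then have "vge v 1 ((h * (x - a) - r) - f * ((x - a) ^ 2 * \<delta> e))" by (intro vge_diff[OF r(2)]) simp
    then have "vge v 1 (f * t - r)" unfolding hft by simp
    then have "c 1 = r" using ft *(3,4) r(1) value_unique[of "c 1" r "f * t"] by auto
    then show "s = r" using *(6) by simp
  qed
qed

end

context hermitian_curve
begin

text \<open>Relative to the local parameter \<open>x / y\<close>, the function \<open>x\<close> has
  derivative \<open>- (y ^ 2) / y ^ q\<close>. Its order is 2g - 2 for the genus g = q(q - 1) / 2,
  as it must be when dx has no affine zeros or poles.\<close>

lemma order_at_infinity:
  assumes "h \<noteq> 0"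
  shows "order_at K (differential K h x) Pinf = Pinf h + (int q - 2) * (int q + 1)"
proof -
  obtain \<delta> where \<delta>: "\<delta> \<in> derivations K" "\<delta> (x / y) = 1" by (rule inf.derivation_exists)
  obtain \<epsilon> where \<epsilon>: "\<epsilon> \<in> derivations K" "\<epsilon> x = 1" by (rule derivation_exists)
  have "\<delta> (1 / y) = (x / y) ^ q * \<delta> (x / y)" by (rule inf.der_y[OF \<delta>(1)])
  then have dy: "\<delta> (1 / y) = (x / y) ^ q" using \<delta>(2) by simp
  have "\<delta> (x / y) = \<delta> (x * (1 / y))" by simp
  also have "\<dots> = x * (x / y) ^ q + 1 / y * \<delta> x" unfolding der_mult[OF \<delta>(1)] dy ..
  finally have "1 = x * (x / y) ^ q + \<delta> x / y" using \<delta>(2) by simp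
  then have "y * y ^ q = x ^ (q + 1) * y + \<delta> x * y ^ q" by (simp add: field_simps)
  then have "\<delta> x * y ^ q = - (y ^ 2)" unfolding curve
    by (simp add: algebra_simps power2_eq_square eq_neg_iff_add_eq_0)
  then have dx: "\<delta> x = - (y ^ 2) / y ^ q" by (simp add: field_simps)
  have dxnz: "\<delta> x \<noteq> 0" unfolding dx by simp
  have vdx: "Pinf (\<delta> x) = (int q - 2) * (int q + 1)"
    unfolding dx by (simp add: inf.v_divide inf.v_power v_inf_y algebra_simps)
  have conv: "differential K h x = differential K (h * \<delta> x) (x / y)"
    by (rule inf.differential_conv[OF \<delta>])
  have "order_at K (differential K (h * \<delta> x) (x / y)) Pinf = Pinf (h * \<delta> x)"
    by (rule inf.order_at_affine) (use assms dxnz in simp)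
  then show ?thesis unfolding conv using assms dxnz vdx by (simp add: inf.v_mult)
qed

end

section \<open>Places of degree three\<close>

lemma lspan_map_closed:
  assumes "z \<in> lspan K E" "0 \<in> A" "\<And>c f. c \<in> K \<Longrightarrow> f \<in> A \<Longrightarrow> c * f \<in> A" "\<And>f g. f \<in> A \<Longrightarrow> g \<in> A \<Longrightarrow> f + g \<in> A"
    and "\<And>e. e \<in> E \<Longrightarrow> a * e \<in> A"
  shows "a * z \<in> A"
  using assms(1)
proof induction
  case (step c e z)
  have "a * (c * e + z) = c * (a * e) + a * z" by (simp add: algebra_simps)
  then show ?case using assms(4)[OF assms(3)[OF step(1) assms(5)[OF step(2)]] step.IH] by simp
qed (simp add: assms(2))

context place
begin

lemma residue_system:
  assumes fin: "finite K" and deg: "place_of_degree K n v"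
  obtains T where "finite T" "\<forall>t\<in>T. vge v 0 t" "card T = card K ^ n" "\<forall>z. vge v 0 z \<longrightarrow> (\<exists>!t. t \<in> T \<and> vge v 1 (z - t))"
proof -
  obtain B where B: "B \<subseteq> valuation_ring v" "finite B" "card B = n"
    "\<forall>z\<in>valuation_ring v. \<exists>!c. c \<in> B \<rightarrow>\<^sub>E K \<and> z - (\<Sum>b\<in>B. c b * b) \<in> valuation_ideal v"
    by (rule place_of_degreeD[OF deg])
  define s where "s c = (\<Sum>b\<in>B. c b * b)" for c :: "'f \<Rightarrow> 'f"
  have B4: "\<exists>!c. c \<in> B \<rightarrow>\<^sub>E K \<and> vge v 1 (z - s c)" if "vge v 0 z" for z
    using bspec[OF B(4), of z] that unfolding s_def in_valuation_ring_iff in_valuation_ideal_iff by blast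
  have sO: "vge v 0 (s c)" if "c \<in> B \<rightarrow>\<^sub>E K" for c
    unfolding s_def
  proof (rule vge_sum)
    fix b assume "b \<in> B"
    then have "c b \<in> K" "vge v 0 b" using that B(1) by (auto simp: in_valuation_ring_iff)
    then show "vge v 0 (c b * b)" by (intro vge_mult0) auto
  qed
  have inj: "inj_on s (B \<rightarrow>\<^sub>E K)"
  proof
    fix c d assume cd: "c \<in> B \<rightarrow>\<^sub>E K" "d \<in> B \<rightarrow>\<^sub>E K" "s c = s d"
    have "vge v 1 (s c - s c)" "vge v 1 (s c - s d)" using cd(3) by simp_all
    then show "c = d" using B4[OF sO[OF cd(1)]] cd(1,2) by blast
  qed
  show ?thesis
  proof (rule that[of "s ` (B \<rightarrow>\<^sub>E K)"])
    show "card (s ` (B \<rightarrow>\<^sub>E K)) = card K ^ n" using card_image[OF inj] B(2,3) by (simp add: card_PiE)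
    show "\<forall>t\<in>s ` (B \<rightarrow>\<^sub>E K). vge v 0 t" using sO by blast
    show "\<forall>z. vge v 0 z \<longrightarrow> (\<exists>!t. t \<in> s ` (B \<rightarrow>\<^sub>E K) \<and> vge v 1 (z - t))"
    proof (intro allI impI)
      fix z assume z: "vge v 0 z"
      from ex1_implies_ex[OF B4[OF z]] obtain c where c: "c \<in> B \<rightarrow>\<^sub>E K" "vge v 1 (z - s c)" by blast
      show "\<exists>!t. t \<in> s ` (B \<rightarrow>\<^sub>E K) \<and> vge v 1 (z - t)"
      proof (rule ex1I[of _ "s c"])
        fix t assume t: "t \<in> s ` (B \<rightarrow>\<^sub>E K) \<and> vge v 1 (z - t)"
        then obtain d where d: "d \<in> B \<rightarrow>\<^sub>E K" "t = s d" by blast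
        then show "t = s c" using B4[OF z] c t by blast
      qed (use c in blast)
    qed
  qed (use B(2) fin in \<open>simp add: finite_PiE\<close>)
qed

text \<open>As \<open>K\<close> has more than one element, this forces \<open>n \<le> 1\<close>. It
  separates a place of degree three from the rational places and from infinity.\<close>

lemma residue_constants_degree:
  assumes fin: "finite K" and deg: "place_of_degree K n v"
    and const: "\<And>z. vge v 0 z \<Longrightarrow> \<exists>c\<in>K. vge v 1 (z - c)"
  shows "card K ^ n \<le> card K"
proof -
  obtain T where T: "finite T" "\<forall>t\<in>T. vge v 0 t" "card T = card K ^ n"
    "\<forall>z. vge v 0 z \<longrightarrow> (\<exists>!t. t \<in> T \<and> vge v 1 (z - t))" by (rule residue_system[OF fin deg])
  obtain c where c: "\<And>t. t \<in> T \<Longrightarrow> c t \<in> K \<and> vge v 1 (t - c t)" using const T(2) by metis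
  have "inj_on c T"
  proof
    fix s t assume st: "s \<in> T" "t \<in> T" "c s = c t"
    have "vge v 1 ((s - c s) - (t - c t))"
      by (rule vge_diff[OF conjunct2[OF c[OF st(1)]] conjunct2[OF c[OF st(2)]]])
    then have "vge v 1 (s - t)" "vge v 1 (s - s)" using st(3) by simp_all
    then show "s = t" using T(2,4) st(1,2) by blast
  qed
  then show ?thesis using card_inj_on_le[of c T K] c fin T(3) by force
qed

lemma vge_prod_prime:
  "finite I \<Longrightarrow> (\<And>i. i \<in> I \<Longrightarrow> vge v 0 (f i)) \<Longrightarrow> vge v 1 (prod f I) \<Longrightarrow> \<exists>i\<in>I. vge v 1 (f i)"
proof (induction I rule: finite_induct)
  case (insert i I)
  have "vge v 0 (prod f I)"
    using insert(1) insert.prems(1) by (induction I rule: finite_induct) (auto intro: vge_mult0)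
  then show ?case using insert vge_prime[of "f i" "prod f I"] by auto
qed (simp add: not_vge_1)

end

context hermitian
begin

lemma q2_gt_1: "q\<^sup>2 > 1" using one_less_power[OF q_gt_1, of 2] by simp

text \<open>Both sides come from monic polynomials of degree \<open>q ^ 2\<close> that vanish on
  \<open>K\<close>; their difference has too many roots for its degree.\<close>

lemma prod_constants: "(\<Prod>c\<in>K. z - c) = z ^ q\<^sup>2 - z"
proof -
  define P where "P = (\<Prod>c\<in>K. [:- c, 1:]) - (monom 1 (q\<^sup>2) - [:0, 1:])"
  note q2 = q2_gt_1
  have d: "degree (\<Prod>c\<in>K. [:- c, 1:]) = q\<^sup>2"
    using card_K by (simp add: degree_prod_eq_sum_degree)
  have "lead_coeff (\<Prod>c\<in>K. [:- c, 1:]) = 1" unfolding lead_coeff_prod by simp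
  note lc = d this
  have "P = 0"
  proof (rule ccontr)
    assume nz: "P \<noteq> 0"
    have dX: "degree [:0, 1::'f:] < q\<^sup>2" using q2 by simp
    have c: "coeff P i = 0" if "i \<ge> q\<^sup>2" for i
    proof (cases "i = q\<^sup>2")
      case True
      then show ?thesis using lc dX unfolding P_def by (simp add: coeff_eq_0)
    next
      case False
      then show ?thesis using that lc dX unfolding P_def by (simp add: coeff_eq_0)
    qed
    have deg: "degree P < q\<^sup>2"
    proof (rule ccontr)
      assume "\<not> ?thesis"
      then have "lead_coeff P = 0" using c[of "degree P"] by simp
      then show False using nz by simp
    qed
    have "K \<subseteq> {z. poly P z = 0}"
    proof
      fix a assume a: "a \<in> K"
      then have "(\<Prod>c\<in>K. a - c) = 0" using finite_K by (auto intro: prod_zero)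
      then show "a \<in> {z. poly P z = 0}" using K_frob1[OF a] unfolding P_def by (simp add: poly_prod poly_monom)
    qed
    then have "card K \<le> card {z. poly P z = 0}" by (intro card_mono poly_roots_finite nz)
    also have "\<dots> \<le> degree P" by (rule card_poly_roots_bound[OF nz])
    finally show False using deg card_K by simp
  qed
  then have "poly P z = 0" by simp
  then show ?thesis unfolding P_def by (simp add: poly_prod poly_monom)
qed

end

context affine_place
begin

lemma constant_residue:
  assumes "vge v 0 z" "vge v 1 (z ^ q\<^sup>2 - z)"
  obtains c where "c \<in> K" "vge v 1 (z - c)"
proof -
  have "\<exists>c\<in>K. vge v 1 (z - c)"
    using vge_prod_prime[OF finite_K, of "\<lambda>c. z - c"] assms prod_constants[of z] vge_diff[OF assms(1) vge_const] by simp
  then show ?thesis using that by blast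
qed

text \<open>The curve equation gives \<open>y ^ q ^ 2 - y = x ^ q * (x ^ q ^ 2 - x)\<close>, so the
  condition on \<open>x\<close> controls \<open>y\<close> as well.\<close>

lemma rational_of_frobenius:
  assumes xx: "vge v 1 (x ^ q\<^sup>2 - x)"
  obtains a b where "at_point a b v"
proof -
  have "y ^ q\<^sup>2 - y = (y ^ q + y) ^ q - (y ^ q + y)"
    by (simp add: frob1 power_mult[symmetric] power2_eq_square)
  also have "\<dots> = x ^ q * (x ^ q\<^sup>2 - x)"
    unfolding curve[symmetric] by (simp add: algebra_simps power_mult[symmetric] power2_eq_square power_mult_distrib)
  finally have yy: "vge v 1 (y ^ q\<^sup>2 - y)" using vge_mult0[OF vge_power0[OF vx] xx] by simp
  obtain a where a: "a \<in> K" "vge v 1 (x - a)" by (rule constant_residue[OF vx xx])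
  obtain b where b: "b \<in> K" "vge v 1 (y - b)" by (rule constant_residue[OF vy yy])
  have "at_point a b v" using v a b unfolding at_point_def by simp
  then show ?thesis by (rule that)
qed

lemma vge_frob: "vge v n z \<Longrightarrow> n > 0 \<Longrightarrow> vge v n (z ^ q ^ k)"
proof -
  assume a: "vge v n z" "n > 0"
  have "1 * n \<le> int (q ^ k) * n" using a(2) q_power_pos[of k] by (intro mult_right_mono) linarith+
  then show ?thesis using vge_power[OF a(1), of "q ^ k"] vge_mono by auto
qed

lemma vge_frob_iff: "vge v 0 z \<Longrightarrow> vge v 1 (z ^ q ^ k) \<longleftrightarrow> vge v 1 z"
  using vge_frob[of 1 z k] vge_power_1[of z "q ^ k"] by auto

text \<open>Triples of elements whose residues form an orbit of the Frobenius map \<open>z \<mapsto> z ^ q\<^sup>2\<close>.\<close>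

definition cyc :: "'f \<Rightarrow> 'f \<Rightarrow> 'f \<Rightarrow> bool" where
  "cyc z0 z1 z2 \<longleftrightarrow> vge v 0 z0 \<and> vge v 0 z1 \<and> vge v 0 z2 \<and>
     vge v 1 (z0 ^ q\<^sup>2 - z1) \<and> vge v 1 (z1 ^ q\<^sup>2 - z2) \<and> vge v 1 (z2 ^ q\<^sup>2 - z0)"

lemma cyc_rotate: "cyc z0 z1 z2 \<Longrightarrow> cyc z1 z2 z0"
  unfolding cyc_def by blast

lemma vge_1_mult_cong:
  assumes "vge v 0 a" "vge v 0 d" "vge v 1 (a - b)" "vge v 1 (c - d)"
  shows "vge v 1 (a * c - b * d)"
proof -
  have "a * c - b * d = a * (c - d) + d * (a - b)" by (simp add: algebra_simps)
  then show ?thesis using vge_add[OF vge_mult0[OF assms(1,4)] vge_mult0[OF assms(2,3)]] by (simp only:)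
qed

lemma cyc_mult:
  assumes "cyc z0 z1 z2" "cyc w0 w1 w2"
  shows "cyc (z0 * w0) (z1 * w1) (z2 * w2)"
proof -
  have *: "vge v 1 ((z * w) ^ q\<^sup>2 - z' * w')"
    if "vge v 0 z" "vge v 0 w'" "vge v 1 (z ^ q\<^sup>2 - z')" "vge v 1 (w ^ q\<^sup>2 - w')" for z w z' w'
    unfolding power_mult_distrib by (rule vge_1_mult_cong[OF vge_power0[OF that(1)] that(2-4)])
  show ?thesis using assms * vge_mult0 unfolding cyc_def by simp
qed

text \<open>Raising to the power \<open>q ^ 2\<close> permutes the three residues, so their sum has
  a residue in \<open>K\<close>.\<close>

lemma cyc_trace:
  assumes "cyc z0 z1 z2"
  obtains c where "c \<in> K" "vge v 1 (z0 + z1 + z2 - c)"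
proof -
  have z: "vge v 0 z0" "vge v 0 z1" "vge v 0 z2" "vge v 1 (z0 ^ q\<^sup>2 - z1)" "vge v 1 (z1 ^ q\<^sup>2 - z2)" "vge v 1 (z2 ^ q\<^sup>2 - z0)"
    using assms unfolding cyc_def by auto
  have eq: "(z0 + z1 + z2) ^ q\<^sup>2 - (z0 + z1 + z2) = (z0 ^ q\<^sup>2 - z1) + (z1 ^ q\<^sup>2 - z2) + (z2 ^ q\<^sup>2 - z0)"
    by (simp add: add_power_q)
  have "vge v 1 ((z0 + z1 + z2) ^ q\<^sup>2 - (z0 + z1 + z2))"
    unfolding eq by (rule vge_add[OF vge_add[OF z(4,5)] z(6)])
  from constant_residue[OF vge_add[OF vge_add[OF z(1,2)] z(3)] this] show ?thesis using that by blast
qed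

lemma cyc_norm:
  assumes "cyc z0 z1 z2"
  obtains c where "c \<in> K" "vge v 1 (z0 * z1 * z2 - c)"
proof -
  have z: "vge v 0 z0" "vge v 0 z1" "vge v 0 z2" "vge v 1 (z0 ^ q\<^sup>2 - z1)" "vge v 1 (z1 ^ q\<^sup>2 - z2)" "vge v 1 (z2 ^ q\<^sup>2 - z0)"
    using assms unfolding cyc_def by auto
  have "vge v 1 (z0 ^ q\<^sup>2 * z1 ^ q\<^sup>2 * z2 ^ q\<^sup>2 - z1 * z2 * z0)"
    using z by (intro vge_1_mult_cong vge_mult0 vge_power0) auto
  moreover have "z0 ^ q\<^sup>2 * z1 ^ q\<^sup>2 * z2 ^ q\<^sup>2 - z1 * z2 * z0 = (z0 * z1 * z2) ^ q\<^sup>2 - z0 * z1 * z2"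
    by (simp add: power_mult_distrib mult_ac)
  ultimately have "vge v 1 ((z0 * z1 * z2) ^ q\<^sup>2 - z0 * z1 * z2)" by (simp only:)
  from constant_residue[OF vge_mult0[OF vge_mult0[OF z(1,2)] z(3)] this] show ?thesis using that by blast
qed

end

section \<open>Tangent lines at a place of degree three\<close>

locale cubic_place = affine_place q K x y v for q and K :: "'f::field set" and x y :: 'f and v +
  assumes deg3: "place_of_degree K 3 v"
begin

lemma frob6: assumes "vge v 0 z" shows "vge v 1 (z ^ q ^ 6 - z)"
proof -
  obtain T where T: "finite T" "\<forall>t\<in>T. vge v 0 t" "card T = card K ^ 3"
    "\<forall>z. vge v 0 z \<longrightarrow> (\<exists>!t. t \<in> T \<and> vge v 1 (z - t))" by (rule residue_system[OF finite_K deg3])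
  have "z ^ card T - z \<in> {z. vge v 1 z}"
  proof (rule fermat_mod_ideal[where O' = "{z. vge v 0 z}"])
    show "\<exists>!t. t \<in> T \<and> z - t \<in> {z. vge v 1 z}" if "z \<in> {z. vge v 0 z}" for z
      using T(4) that by simp
  qed (use T assms not_vge_1 in \<open>auto intro: vge_diff vge_add vge_mult0 dest: vge_prime\<close>)
  then show ?thesis using T(3) card_K by (simp add: power_mult[symmetric])
qed

lemma frob6_R: "z \<in> R \<Longrightarrow> vge v 1 (z ^ q ^ (2 * 3) - z)"
  using frob6[OF vge_R] by simp

lemma uniformizer6: "v (x ^ q ^ 6 - x) = 1" "x ^ q ^ 6 - x \<noteq> 0"
  using uniformizer_val[of 3, OF _ frob6_R] x_frob_nz[of 3] by simp_all

lemma not_rational: "\<not> vge v 1 (x ^ q\<^sup>2 - x)"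
proof
  assume "vge v 1 (x ^ q\<^sup>2 - x)"
  then obtain a b where "at_point a b v" by (rule rational_of_frobenius)
  then interpret r: rational_place q K x y v a b by (rule rational_placeI)
  have "card K ^ 3 \<le> card K"
    by (rule residue_constants_degree[OF finite_K deg3]) (use r.value_ex in blast)
  moreover have "card K ^ 1 < card K ^ 3" using card_K q2_gt_1 by (intro power_strict_increasing) auto
  ultimately show False by simp
qed

text \<open>The tangent line at the point \<open>(x ^ Q, y ^ Q)\<close> for \<open>Q = q ^ 6\<close>, which approximates the
  point of the curve over the residue field up to order \<open>Q\<close>.\<close>

lemma tangent_order:
  "vge v (int q) (y - (x ^ q ^ 6) ^ q * x + (y ^ q ^ 6) ^ q)"
proof -
  let ?A = "x ^ q ^ 6" and ?B = "y ^ q ^ 6"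
  let ?l = "y - ?A ^ q * x + ?B ^ q"
  have AB: "?A ^ (q + 1) = ?B ^ q + ?B"
  proof -
    have "?A ^ (q + 1) = (x ^ (q + 1)) ^ q ^ 6" by (simp only: power_mult[symmetric] mult.commute)
    also have "\<dots> = (y ^ q) ^ q ^ 6 + ?B" unfolding curve by (rule add_power_q)
    also have "(y ^ q) ^ q ^ 6 = ?B ^ q" by (simp only: power_mult[symmetric] mult.commute)
    finally show ?thesis .
  qed
  have A: "vge v 1 (?A - x)" and B: "vge v 1 (?B - y)" using frob6 vx vy by auto
  \<comment> \<open>By the curve equation the line lies in the maximal ideal. So
    \<open>1 + ?l ^ (q - 1)\<close> is a unit, and \<open>?l\<close> inherits the order of
    \<open>?l ^ q + ?l\<close>, which is at least \<open>q\<close> by the factorisation in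
    \<open>tangent_line\<close>.\<close>
  have "?l = (?B - y) ^ q - (?A - x) ^ q * x" using curve by (simp add: frob1 algebra_simps)
  moreover have "vge v 1 ((?B - y) ^ q - (?A - x) ^ q * x)"
    using vge_frob[OF A, of 1] vge_frob[OF B, of 1] vx by (intro vge_diff vge_mult0') auto
  ultimately have l1: "vge v 1 ?l" by (simp only:)
  have "vge v (int q * 1 + 0) ((x - ?A) ^ q * (x - ?A ^ q\<^sup>2))"
    using A vx by (intro vge_mult vge_power vge_diff[OF vx vge_power0[OF vge_power0[OF vx]]]) (simp add: vge_minus_commute)
  moreover have "L * (1 + L ^ (q - 1)) = L ^ q + L" for L :: 'f
    using power_minus_mult[of q L] q_gt_1 by (simp add: algebra_simps)
  ultimately have lq: "vge v (int q) (?l * (1 + ?l ^ (q - 1)))"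
    using tangent_line[OF AB] by (simp only: mult_1_right add_0_right)
  have l0: "vge v 0 (?l ^ (q - 1))" using vge_mono[OF l1] by (intro vge_power0) simp
  have "vge v 1 (?l ^ (q - 1))"
    using vge_mono[OF vge_power[OF l1, of "q - 1"], of 1] q_gt_1 by simp
  then have "\<not> vge v 1 (1 + ?l ^ (q - 1))" using vge_diff[of 1 "1 + ?l ^ (q - 1)" "?l ^ (q - 1)"] not_vge_1 by auto
  then have "1 + ?l ^ (q - 1) \<noteq> 0 \<and> v (1 + ?l ^ (q - 1)) = 0" using v_eq_0_iff[of "1 + ?l ^ (q - 1)"] vge_add[OF vge_1 l0] by simp
  then show ?thesis using vge_unit_cancel[OF lq] by blast
qed

text \<open>The product of the tangent lines at the three conjugate points is a cubic over \<open>K\<close>.\<close>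

lemma tangent_cubic:
  obtains N where "N - y ^ 3 \<in> lspan K {x ^ i * y ^ j | i j. j \<le> 2 \<and> i + j \<le> 3}" "vge v (int q + 1) N"
proof -
  let ?Q = "q ^ 6"
  \<comment> \<open>The tangent at \<open>(A, B)\<close> has the coefficients \<open>A ^ q\<close>
    and \<open>B ^ q\<close>; at the three conjugates of \<open>(x, y)\<close> these are, modulo the
    maximal ideal, powers with exponents \<open>q\<close>, \<open>q ^ 3\<close> and
    \<open>q ^ 5\<close>.\<close>
  define a0 a1 a2 where a: "a0 = x ^ q" "a1 = x ^ q ^ 3" "a2 = x ^ q ^ 5"
  define b0 b1 b2 where b: "b0 = y ^ q" "b1 = y ^ q ^ 3" "b2 = y ^ q ^ 5"
  have fp: "(z ^ q ^ i) ^ q\<^sup>2 = z ^ q ^ (i + 2)" for z :: 'f and i by (rule frob_power)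
  have cyc: "cyc (z ^ q) (z ^ q ^ 3) (z ^ q ^ 5)" if "vge v 0 z" for z
  proof -
    have "vge v 1 ((z ^ q ^ 6 - z) ^ q ^ 1)" by (rule vge_frob[OF frob6[OF that]]) simp
    moreover have "(z ^ q ^ 5) ^ q\<^sup>2 - z ^ q = (z ^ q ^ 6 - z) ^ q ^ 1"
      unfolding diff_power_q frob_power by simp
    ultimately have "vge v 1 ((z ^ q ^ 5) ^ q\<^sup>2 - z ^ q)" by (simp only:)
    moreover have "(z ^ q) ^ q\<^sup>2 = z ^ q ^ 3"
      by (simp add: power_mult[symmetric] power2_eq_square power3_eq_cube mult.assoc)
    moreover have "(z ^ q ^ 3) ^ q\<^sup>2 = z ^ q ^ 5" unfolding fp by simp
    ultimately show ?thesis using vge_power0[OF that] unfolding cyc_def by simp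
  qed
  have ca: "cyc a0 a1 a2" "cyc a1 a2 a0" "cyc a2 a0 a1" and cb: "cyc b0 b1 b2" "cyc b1 b2 b0" "cyc b2 b0 b1"
    using cyc[OF vx] cyc[OF vy] cyc_rotate unfolding a b by blast+
  \<comment> \<open>The coefficients of the product of the three lines are traces and norms, hence
    congruent to constants; \<open>N\<close> is the cubic with these constants as
    coefficients.\<close>
  obtain A1 where A1: "A1 \<in> K" "vge v 1 (a0 + a1 + a2 - A1)" by (rule cyc_trace[OF ca(1)])
  obtain B1 where B1: "B1 \<in> K" "vge v 1 (b0 + b1 + b2 - B1)" by (rule cyc_trace[OF cb(1)])
  obtain A2 where A2: "A2 \<in> K" "vge v 1 (a0 * a1 + a1 * a2 + a2 * a0 - A2)" by (rule cyc_trace[OF cyc_mult[OF ca(1,2)]])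
  obtain B2 where B2: "B2 \<in> K" "vge v 1 (b0 * b1 + b1 * b2 + b2 * b0 - B2)" by (rule cyc_trace[OF cyc_mult[OF cb(1,2)]])
  obtain C where C: "C \<in> K" "vge v 1 (a0 * b1 + a1 * b2 + a2 * b0 - C)" by (rule cyc_trace[OF cyc_mult[OF ca(1) cb(2)]])
  obtain C' where C': "C' \<in> K" "vge v 1 (a0 * b2 + a1 * b0 + a2 * b1 - C')" by (rule cyc_trace[OF cyc_mult[OF ca(1) cb(3)]])
  obtain A3 where A3: "A3 \<in> K" "vge v 1 (a0 * a1 * a2 - A3)" by (rule cyc_norm[OF ca(1)])
  obtain B3 where B3: "B3 \<in> K" "vge v 1 (b0 * b1 * b2 - B3)" by (rule cyc_norm[OF cb(1)])
  obtain D1 where D1: "D1 \<in> K" "vge v 1 (a0 * a1 * b2 + a1 * a2 * b0 + a2 * a0 * b1 - D1)"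
    by (rule cyc_trace[OF cyc_mult[OF cyc_mult[OF ca(1,2)] cb(3)]])
  obtain D2 where D2: "D2 \<in> K" "vge v 1 (b0 * b1 * a2 + b1 * b2 * a0 + b2 * b0 * a1 - D2)"
    by (rule cyc_trace[OF cyc_mult[OF cyc_mult[OF cb(1,2)] ca(3)]])
  define N where "N = y ^ 3 + (- A1) * (x ^ 1 * y ^ 2) + B1 * (x ^ 0 * y ^ 2) + A2 * (x ^ 2 * y ^ 1) + (- (C + C')) * (x ^ 1 * y ^ 1)
    + B2 * (x ^ 0 * y ^ 1) + (- A3) * (x ^ 3 * y ^ 0) + D1 * (x ^ 2 * y ^ 0) + (- D2) * (x ^ 1 * y ^ 0) + B3 * (x ^ 0 * y ^ 0)"
  let ?E = "{x ^ i * y ^ j | i j. j \<le> 2 \<and> i + j \<le> 3}"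
  have E: "c * (x ^ i * y ^ j) \<in> lspan K ?E" if "c \<in> K" "j \<le> 2" "i + j \<le> 3" for c i j
    by (rule lspan_base_scale[OF K that(1)]) (use that in blast)
  have "N - y ^ 3 = (- A1) * (x ^ 1 * y ^ 2) + B1 * (x ^ 0 * y ^ 2) + A2 * (x ^ 2 * y ^ 1) + (- (C + C')) * (x ^ 1 * y ^ 1)
    + B2 * (x ^ 0 * y ^ 1) + (- A3) * (x ^ 3 * y ^ 0) + D1 * (x ^ 2 * y ^ 0) + (- D2) * (x ^ 1 * y ^ 0) + B3 * (x ^ 0 * y ^ 0)"
    unfolding N_def by simp
  moreover have "\<dots> \<in> lspan K ?E"
    by (intro lspan_add[OF K] E) (use A1 A2 A3 B1 B2 B3 C C' D1 D2 in \<open>auto intro: K_closed\<close>)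
  ultimately have NE: "N - y ^ 3 \<in> lspan K ?E" by (simp only:)
  \<comment> \<open>The power \<open>?Q\<close> fixes constants and turns a congruence modulo the
    maximal ideal into one of order \<open>?Q\<close>. Hence the product of the tangents at
    \<open>(x ^ ?Q, y ^ ?Q)\<close> and its Frobenius images agrees with \<open>N\<close> to that
    order.\<close>
  have lift: "vge v (int ?Q) (z ^ ?Q - c)" if "c \<in> K" "vge v 1 (z - c)" for z c
  proof -
    have "vge v (int ?Q * 1) ((z - c) ^ ?Q)" by (rule vge_power[OF that(2)])
    moreover have "(z - c) ^ ?Q = z ^ ?Q - c" using K_frob[OF that(1), of 3] by (simp add: diff_power_q)
    ultimately show ?thesis by simp
  qed
  define A where "A i = x ^ q ^ (6 + 2 * i)" for i
  define B where "B i = y ^ q ^ (6 + 2 * i)" for i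
  define l where "l i = y - A i ^ q * x + B i ^ q" for i
  have pq: "(z ^ q ^ i) ^ q = z ^ q ^ (i + 1)" for z :: 'f and i using frob_power[of z i 1] by simp
  have aQ: "a0 ^ ?Q = A 0 ^ q" "a1 ^ ?Q = A 1 ^ q" "a2 ^ ?Q = A 2 ^ q" "b0 ^ ?Q = B 0 ^ q" "b1 ^ ?Q = B 1 ^ q" "b2 ^ ?Q = B 2 ^ q"
    unfolding a b A_def B_def pq using frob_power[of x 1 6] frob_power[of y 1 6] by (simp_all add: frob_power)
  let ?p = "\<lambda>z. z ^ ?Q"
  define M where "M i j = x ^ i * y ^ j" for i j
  have x0: "vge v 0 (M i j)" for i j
    unfolding M_def by (rule vge_mult0[OF vge_power0[OF vx] vge_power0[OF vy]])
  have "l 0 * l 1 * l 2 - N =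
      (- (((?p a0 + ?p a1 + ?p a2) - A1) * M 1 2)) + ((?p b0 + ?p b1 + ?p b2) - B1) * M 0 2
      + ((?p a0 * ?p a1 + ?p a1 * ?p a2 + ?p a2 * ?p a0) - A2) * M 2 1
      + (- (((?p a0 * ?p b1 + ?p a1 * ?p b2 + ?p a2 * ?p b0) - C) * M 1 1))
      + (- (((?p a0 * ?p b2 + ?p a1 * ?p b0 + ?p a2 * ?p b1) - C') * M 1 1))
      + ((?p b0 * ?p b1 + ?p b1 * ?p b2 + ?p b2 * ?p b0) - B2) * M 0 1
      + (- ((?p a0 * ?p a1 * ?p a2 - A3) * M 3 0))
      + ((?p a0 * ?p a1 * ?p b2 + ?p a1 * ?p a2 * ?p b0 + ?p a2 * ?p a0 * ?p b1) - D1) * M 2 0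
      + (- (((?p b0 * ?p b1 * ?p a2 + ?p b1 * ?p b2 * ?p a0 + ?p b2 * ?p b0 * ?p a1) - D2) * M 1 0))
      + (?p b0 * ?p b1 * ?p b2 - B3) * M 0 0"
    unfolding N_def l_def aQ M_def by (simp add: power2_eq_square power3_eq_cube) algebra
  moreover have "vge v (int ?Q) \<dots>"
    unfolding power_mult_distrib[symmetric] add_power_q[symmetric]
    by (intro vge_add vge_uminus[THEN iffD2] vge_mult0'[OF _ x0] lift A1 A2 A3 B1 B2 B3 C C' D1 D2)
  ultimately have "vge v (int ?Q) (l 0 * l 1 * l 2 - N)" by (simp only:)
  moreover have "int ?Q \<ge> int q + 1"
  proof -
    have "q ^ 2 \<le> ?Q" using q_gt_1 by (intro power_increasing) auto
    moreover have "2 * q \<le> q ^ 2" using q_gt_1 by (simp add: power2_eq_square)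
    ultimately have "q + 1 \<le> ?Q" using q_gt_1 by linarith
    then show ?thesis by linarith
  qed
  ultimately have lN: "vge v (int q + 1) (l 0 * l 1 * l 2 - N)" by (rule vge_mono)
  have l0: "vge v (int q) (l 0)" using tangent_order unfolding l_def A_def B_def by simp
  have O': "vge v 0 (l i)" for i
    unfolding l_def A_def B_def by (intro vge_add vge_diff vge_mult0' vge_power0 vx vy)
  \<comment> \<open>The third tangent passes through the Frobenius image of its point of contact,
    which modulo the maximal ideal is \<open>(x, y)\<close>. This adds 1 to the order
    \<open>q\<close> of the first tangent.\<close>
  have l2: "vge v 1 (l 2)"
  proof -
    have "vge v 1 (z ^ q ^ 12 - z)" if "vge v 0 z" for z
    proof -
      have "vge v 1 ((z ^ q ^ 6 - z) ^ q ^ 6 + (z ^ q ^ 6 - z))"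
        by (rule vge_add[OF vge_frob[OF frob6[OF that]] frob6[OF that]]) simp
      then show ?thesis by (simp add: diff_power_q frob_power)
    qed
    then have A: "vge v 1 (x ^ q ^ 12 - x)" and B: "vge v 1 (y ^ q ^ 12 - y)" using vx vy by auto
    have "l 2 ^ q = y ^ q - (A 2 ^ q) ^ q * x ^ q + (B 2 ^ q) ^ q"
      unfolding l_def by (simp only: frob1 power_mult_distrib)
    also have "(A 2 ^ q) ^ q = x ^ q ^ 12" unfolding A_def pq by simp
    also have "(B 2 ^ q) ^ q = y ^ q ^ 12" unfolding B_def pq by simp
    finally have "l 2 ^ q = (y ^ q ^ 12 - y) - (x ^ q ^ 12 - x) * x ^ q" using curve by (simp add: algebra_simps)
    moreover have "vge v 1 ((y ^ q ^ 12 - y) - (x ^ q ^ 12 - x) * x ^ q)"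
      by (rule vge_diff[OF B vge_mult0'[OF A vge_power0[OF vx]]])
    ultimately have "vge v 1 (l 2 ^ q)" by (simp only:)
    then show ?thesis by (rule vge_power_1[OF O'])
  qed
  have "vge v (int q + 0 + 1) (l 0 * l 1 * l 2)" by (rule vge_mult[OF vge_mult[OF l0 O'] l2])
  then have "vge v (int q + 1) (l 0 * l 1 * l 2 - (l 0 * l 1 * l 2 - N))" by (intro vge_diff[OF _ lN]) simp
  then show ?thesis using that[OF NE] by simp
qed

end

section \<open>Division by the tangent cubic\<close>

context place
begin

text \<open>A substitute for the uniqueness of expansions in powers of \<open>t\<close>: by
  \<open>jump\<close> a digit in the maximal ideal is negligible, so no carries occur and the lowest
  unit digit would determine the order.\<close>

lemma digits_vge:
  assumes t: "t \<noteq> 0" "v t = 1" and d: "\<And>i. i \<le> m \<Longrightarrow> vge v 0 (d i)"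
    and jump: "\<And>i. i \<le> m \<Longrightarrow> vge v 1 (d i) \<Longrightarrow> vge v (int n) (d i)"
    and s: "vge v (int n) (\<Sum>i\<le>m. d i * t ^ i)" and i: "i \<le> m" "i < n"
  shows "vge v 1 (d i)"
  using i
proof (induction i rule: less_induct)
  case (less i)
  have tO: "vge v (int k) (t ^ k)" for k using t by (simp add: vge_def v_power)
  have split: "{..m} = insert i ({..<i} \<union> {i<..m})" using less.prems by auto
  have "(\<Sum>k\<le>m. d k * t ^ k) = d i * t ^ i + ((\<Sum>k<i. d k * t ^ k) + (\<Sum>k\<in>{i<..m}. d k * t ^ k))"
    unfolding split by (subst sum.insert) (auto intro!: sum.union_disjoint)
  then have eq: "d i * t ^ i = (\<Sum>k\<le>m. d k * t ^ k) - ((\<Sum>k<i. d k * t ^ k) + (\<Sum>k\<in>{i<..m}. d k * t ^ k))"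
    by simp
  have lo: "vge v (int i + 1) (\<Sum>k<i. d k * t ^ k)"
  proof (rule vge_sum)
    fix k assume "k \<in> {..<i}"
    then have "vge v (int n) (d k)" using jump less by simp
    then have "vge v (int n) (d k * t ^ k)" using vge_mono[OF tO, of 0 k] by (intro vge_mult0') auto
    then show "vge v (int i + 1) (d k * t ^ k)" using less.prems by (elim vge_mono) simp
  qed
  have hi: "vge v (int i + 1) (\<Sum>k\<in>{i<..m}. d k * t ^ k)"
  proof (rule vge_sum)
    fix k assume k: "k \<in> {i<..m}"
    then have "vge v (int k) (d k * t ^ k)" using d tO by (intro vge_mult0) auto
    then show "vge v (int i + 1) (d k * t ^ k)" using k by (elim vge_mono) auto
  qed
  have "vge v (int i + 1) (d i * t ^ i)"
    unfolding eq using less.prems by (intro vge_diff vge_add lo hi vge_mono[OF s]) simp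
  then have "vge v (int i + 1 - v (t ^ i)) (d i)" using t by (intro vge_cancel) auto
  then show ?case using t by (simp add: v_power)
qed

end

context hermitian
begin

definition V :: "nat \<Rightarrow> 'f set" where "V d = lspan K {x ^ i * y ^ j | i j. i + j \<le> d}"

lemma V_subset_R: "V d \<subseteq> R" unfolding V_def R_def by (rule lspan_mono[OF K]) auto

end

locale tangent_cubic_place = cubic_place q K x y v for q and K :: "'f::field set" and x y :: 'f and v +
  fixes N assumes N_monic: "N - y ^ 3 \<in> lspan K {x ^ i * y ^ j | i j. j \<le> 2 \<and> i + j \<le> 3}"
    and N_order: "vge v (int q + 1) N"
begin

lemma N_in_R: "N \<in> R"
proof -
  have "lspan K {x ^ i * y ^ j | i j. j \<le> 2 \<and> i + j \<le> 3} \<subseteq> R" unfolding R_def by (rule lspan_mono[OF K]) auto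
  then have "(N - y ^ 3) + y ^ 3 \<in> R" using N_monic by (intro R_add R_power) auto
  then show ?thesis by simp
qed

text \<open>\<open>N\<close> is monic of degree 3 in \<open>y\<close> and has total degree 3, so
  division with respect to \<open>y\<close> does not raise the total degree. Writing
  \<open>i + j + 3 \<le> e\<close> avoids a truncated difference: for \<open>e < 3\<close> the
  quotient is 0.\<close>

lemma divide_N:
  assumes "f \<in> V e"
  obtains r f' where "r \<in> lspan K {x ^ i * y ^ j | i j. j \<le> 2 \<and> i + j \<le> e}"
    "f' \<in> lspan K {x ^ i * y ^ j | i j. i + j + 3 \<le> e}" "f = r + N * f'"
proof -
  let ?W = "lspan K {x ^ i * y ^ j | i j. j \<le> 2 \<and> i + j \<le> e}" and ?W' = "lspan K {x ^ i * y ^ j | i j. i + j + 3 \<le> e}"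
  define A where "A = {r + N * f' | r f'. r \<in> ?W \<and> f' \<in> ?W'}"
  have AI: "r + N * f' \<in> A" if "r \<in> ?W" "f' \<in> ?W'" for r f' unfolding A_def using that by blast
  have A0: "0 \<in> A" using AI[OF lspan.zero lspan.zero] by simp
  have Aadd: "a + b \<in> A" if ab: "a \<in> A" "b \<in> A" for a b
  proof -
    obtain r f' s g' where *: "r \<in> ?W" "f' \<in> ?W'" "a = r + N * f'" "s \<in> ?W" "g' \<in> ?W'" "b = s + N * g'"
      using ab unfolding A_def by blast
    have "a + b = (r + s) + N * (f' + g')" using * by (simp add: algebra_simps)
    then show ?thesis using AI[OF lspan_add[OF K *(1,4)] lspan_add[OF K *(2,5)]] by simp
  qed
  have Ascale: "c * a \<in> A" if ca: "c \<in> K" "a \<in> A" for c a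
  proof -
    obtain r f' where *: "r \<in> ?W" "f' \<in> ?W'" "a = r + N * f'" using ca unfolding A_def by blast
    have "c * a = c * r + N * (c * f')" using * by (simp add: algebra_simps)
    then show ?thesis using AI[OF lspan_scale[OF K ca(1) *(1)] lspan_scale[OF K ca(1) *(2)]] by simp
  qed
  have mon: "x ^ i * y ^ j \<in> A" if "i + j \<le> e" for i j
    using that
  proof (induction j arbitrary: i rule: less_induct)
    case (less j)
    show ?case
    proof (cases "j \<le> 2")
      case True
      then have "x ^ i * y ^ j \<in> ?W" using less.prems by (intro lspan_base[OF K]) blast
      then show ?thesis using AI[OF _ lspan.zero] by simp
    next
      case False
      then obtain k where k: "j = k + 3" by (metis add.commute le_Suc_ex not_less_eq_eq numeral_2_eq_2 numeral_3_eq_3)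
      have "x ^ i * y ^ k * (N - y ^ 3) \<in> A"
      proof (rule lspan_map_closed[OF N_monic A0 Ascale Aadd])
        fix f assume "f \<in> {x ^ i * y ^ j | i j. j \<le> 2 \<and> i + j \<le> 3}"
        then obtain i' j' where f: "f = x ^ i' * y ^ j'" "j' \<le> 2" "i' + j' \<le> 3" by blast
        have "x ^ i * y ^ k * f = x ^ (i + i') * y ^ (k + j')" unfolding f(1) by (simp add: power_add mult_ac)
        then show "x ^ i * y ^ k * f \<in> A" using less.IH[of "k + j'" "i + i'"] f less.prems k by simp
      qed
      then have 1: "(- 1) * (x ^ i * y ^ k * (N - y ^ 3)) \<in> A" by (rule Ascale[OF K_closed(4)[OF K_closed(2)]])
      have "i + k + 3 \<le> e" using less.prems k by simp
      then have "x ^ i * y ^ k \<in> {x ^ i * y ^ j | i j. i + j + 3 \<le> e}" by blast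
      then have "x ^ i * y ^ k \<in> ?W'" by (rule lspan_base[OF K])
      from Aadd[OF AI[OF lspan.zero this] 1] show ?thesis unfolding k by (simp add: algebra_simps power_add)
    qed
  qed
  have "1 * f \<in> A" using assms unfolding V_def
    by (rule lspan_map_closed[OF _ A0 Ascale Aadd]) (use mon in auto)
  then show ?thesis using that unfolding A_def by auto
qed

text \<open>Division by \<open>N\<close> bounds the exponent of \<open>y\<close> by 2. Replacing
  \<open>x ^ (q + 1)\<close> by \<open>y ^ q + y\<close> then lowers the total degree, so the
  process ends, with \<open>3 * (q + 1)\<close> monomials.\<close>

lemma R_modulo_N:
  assumes "z \<in> R"
  obtains \<mu> w where "\<mu> \<in> lspan K ((\<lambda>(i, j). x ^ i * y ^ j) ` ({..q} \<times> {..2}))" "w \<in> R" "z = \<mu> + N * w"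
proof -
  let ?M = "lspan K ((\<lambda>(i, j). x ^ i * y ^ j) ` ({..q} \<times> {..2}))"
  define A where "A = {r + N * w | r w. r \<in> ?M \<and> w \<in> R}"
  have AI: "r + N * f' \<in> A" if "r \<in> ?M" "f' \<in> R" for r f' unfolding A_def using that by blast
  have A0: "0 \<in> A" using AI[OF lspan.zero R_0] by simp
  have Aadd: "a + b \<in> A" if ab: "a \<in> A" "b \<in> A" for a b
  proof -
    obtain r f' s g' where *: "r \<in> ?M" "f' \<in> R" "a = r + N * f'" "s \<in> ?M" "g' \<in> R" "b = s + N * g'"
      using ab unfolding A_def by blast
    have "a + b = (r + s) + N * (f' + g')" using * by (simp add: algebra_simps)
    then show ?thesis using AI[OF lspan_add[OF K *(1,4)] R_add[OF *(2,5)]] by simp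
  qed
  have Ascale: "c * a \<in> A" if ca: "c \<in> K" "a \<in> A" for c a
  proof -
    obtain r f' where *: "r \<in> ?M" "f' \<in> R" "a = r + N * f'" using ca unfolding A_def by blast
    have "c * a = c * r + N * (c * f')" using * by (simp add: algebra_simps)
    then show ?thesis using AI[OF lspan_scale[OF K ca(1) *(1)] R_mult[OF R_K[OF ca(1)] *(2)]] by simp
  qed
  have mon: "x ^ i * y ^ j \<in> A" if "i + j = d" for i j d
    using that
  proof (induction d arbitrary: i j rule: less_induct)
    case (less d)
    have "x ^ i * y ^ j \<in> V d" unfolding V_def using less.prems by (intro lspan_base[OF K]) blast
    then obtain r f' where rf: "r \<in> lspan K {x ^ i * y ^ j | i j. j \<le> 2 \<and> i + j \<le> d}"
      "f' \<in> lspan K {x ^ i * y ^ j | i j. i + j + 3 \<le> d}" "x ^ i * y ^ j = r + N * f'" by (rule divide_N)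
    have "lspan K {x ^ i * y ^ j | i j. i + j + 3 \<le> d} \<subseteq> R" unfolding R_def by (rule lspan_mono[OF K]) auto
    then have f'A: "N * f' \<in> A" using AI[OF lspan.zero, of f'] rf(2) by auto
    have "1 * r \<in> A"
    proof (rule lspan_map_closed[OF rf(1) A0 Ascale Aadd])
      fix f assume "f \<in> {x ^ i * y ^ j | i j. j \<le> 2 \<and> i + j \<le> d}"
      then obtain i' j' where f: "f = x ^ i' * y ^ j'" "j' \<le> 2" "i' + j' \<le> d" by blast
      show "1 * f \<in> A"
      proof (cases "i' \<le> q")
        case True
        then have "f \<in> ?M" unfolding f(1) using f(2) by (intro lspan_base[OF K]) auto
        then show ?thesis using AI[OF _ R_0] by simp
      next
        case False
        then obtain k where k: "i' = k + (q + 1)" by (metis add.commute le_Suc_ex not_less_eq_eq Suc_eq_plus1)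
        have "f = x ^ k * x ^ (q + 1) * y ^ j'" unfolding f(1) k by (simp add: power_add)
        also have "\<dots> = x ^ k * y ^ (j' + q) + x ^ k * y ^ (j' + 1)" unfolding curve by (simp add: algebra_simps power_add)
        finally have f': "f = x ^ k * y ^ (j' + q) + x ^ k * y ^ (j' + 1)" .
        have "k + (j' + q) < d" "k + (j' + 1) < d" using f(3) k q_gt_1 by auto
        then show ?thesis unfolding f' mult_1_left by (intro Aadd less.IH[OF _ refl])
      qed
    qed
    then show ?case using Aadd[OF _ f'A] rf(3) by simp
  qed
  have "1 * z \<in> A" using assms unfolding R_def
    by (rule lspan_map_closed[OF _ A0 Ascale Aadd]) (use mon in auto)
  then show ?thesis using that unfolding A_def by auto
qed

text \<open>Both \<open>R\<close> modulo \<open>N\<close> and \<open>R\<close> modulo the \<open>(q + 1)\<close>-st power of the maximal ideal have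
  \<open>q ^ (6 * (q + 1))\<close> elements.\<close>

lemma N_divides:
  assumes "z \<in> R" "vge v (int q + 1) z"
  obtains w where "w \<in> R" "z = N * w"
proof -
  let ?M = "lspan K ((\<lambda>(i, j). x ^ i * y ^ j) ` ({..q} \<times> {..2::nat}))"
  have finM: "finite ?M" by (rule finite_lspan_image[OF K finite_K]) simp
  have cardM: "card ?M \<le> (q ^ 6) ^ (q + 1)"
  proof -
    have "card ?M \<le> card K ^ card ({..q} \<times> {..2::nat})" by (rule card_lspan_image_le[OF K finite_K]) simp
    also have "\<dots> = (q ^ 6) ^ (q + 1)" using card_K by (simp add: power_mult[symmetric] card_cartesian_product power_add)
    finally show ?thesis .
  qed
  obtain T where T: "finite T" "\<forall>t\<in>T. vge v 0 t" "card T = card K ^ 3"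
    "\<forall>z. vge v 0 z \<longrightarrow> (\<exists>!t. t \<in> T \<and> vge v 1 (z - t))" by (rule residue_system[OF finite_K deg3])
  have "\<forall>t\<in>T. \<exists>z\<in>R. vge v 1 (t - z)" using T(2) by (meson residue_rep)
  then obtain f where f: "\<And>t. t \<in> T \<Longrightarrow> f t \<in> R \<and> vge v 1 (t - f t)" by metis
  let ?t = "x ^ q ^ 6 - x"
  have tR: "?t \<in> R" by (intro R_diff R_power R_x)
  let ?F = "{..q} \<rightarrow>\<^sub>E T"
  have cardF: "card ?F = (q ^ 6) ^ (q + 1)" using T(1,3) card_K by (simp add: card_PiE power_mult[symmetric])
  \<comment> \<open>Distinct digit vectors give elements that are distinct modulo order
    \<open>q + 1\<close>. There are \<open>(q ^ 6) ^ (q + 1)\<close> of them, which is also the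
    upper bound for the size of \<open>?M\<close>.\<close>
  define s where "s \<rho> = (\<Sum>i\<le>q. f (\<rho> i) * ?t ^ i)" for \<rho>
  have sR: "s \<rho> \<in> R" if "\<rho> \<in> ?F" for \<rho>
    unfolding s_def using that f tR by (intro R_sum R_mult R_power) auto
  have sep: "\<rho> = \<rho>'" if r: "\<rho> \<in> ?F" "\<rho>' \<in> ?F" "vge v (int (q + 1)) (s \<rho> - s \<rho>')" for \<rho> \<rho>'
  proof -
    let ?d = "\<lambda>i. f (\<rho> i) - f (\<rho>' i)"
    have eq: "\<rho> i = \<rho>' i" if i: "i \<le> q" "vge v 1 (?d i)" for i
    proof -
      have m: "\<rho> i \<in> T" "\<rho>' i \<in> T" using r i by auto
      have "vge v 1 ((\<rho> i - f (\<rho> i)) + ?d i - (\<rho>' i - f (\<rho>' i)))"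
        by (rule vge_diff[OF vge_add[OF conjunct2[OF f[OF m(1)]] i(2)] conjunct2[OF f[OF m(2)]]])
      then have "vge v 1 (\<rho> i - \<rho>' i)" "vge v 1 (\<rho> i - \<rho> i)" by simp_all
      then show ?thesis using T(2,4) m by blast
    qed
    have "s \<rho> - s \<rho>' = (\<Sum>i\<le>q. ?d i * ?t ^ i)" unfolding s_def by (simp add: sum_subtractf left_diff_distrib)
    then have sm: "vge v (int (q + 1)) (\<Sum>i\<le>q. ?d i * ?t ^ i)" using r(3) by simp
    have "\<rho> i = \<rho>' i" if i: "i \<le> q" for i
    proof (rule eq[OF i])
      show "vge v 1 (?d i)"
      proof (rule digits_vge[OF uniformizer6(2,1) _ _ sm])
        fix k assume k: "k \<le> q"
        then show "vge v 0 (?d k)" using r f by (intro vge_R R_diff) auto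
        assume "vge v 1 (?d k)"
        then show "vge v (int (q + 1)) (?d k)" using eq[OF k] by simp
      qed (use i in auto)
    qed
    then show ?thesis using r by (intro PiE_ext[of \<rho> "{..q}" "\<lambda>_. T"]) auto
  qed
  have "\<exists>\<mu>\<in>?M. vge v (int (q + 1)) (s \<rho> - \<mu>)" if r: "\<rho> \<in> ?F" for \<rho>
  proof -
    obtain \<mu> w where m: "\<mu> \<in> ?M" "w \<in> R" "s \<rho> = \<mu> + N * w" by (rule R_modulo_N[OF sR[OF r]])
    have "vge v (int q + 1) (N * w)" by (rule vge_mult0'[OF N_order vge_R[OF m(2)]])
    then have "vge v (int (q + 1)) (s \<rho> - \<mu>)" unfolding m(3) by (simp add: add.commute)
    then show ?thesis using m(1) by blast
  qed
  \<comment> \<open>Reduction modulo \<open>N\<close> stays in the same class modulo order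
    \<open>q + 1\<close>. So \<open>g\<close> is injective and, by the two counts, onto
    \<open>?M\<close>; elements of \<open>?M\<close> in the same class, such as \<open>\<mu>\<close>
    and 0 below, are therefore equal.\<close>
  then obtain g where g: "\<And>\<rho>. \<rho> \<in> ?F \<Longrightarrow> g \<rho> \<in> ?M \<and> vge v (int (q + 1)) (s \<rho> - g \<rho>)" by metis
  have inj: "inj_on g ?F"
  proof
    fix \<rho> \<rho>' assume r: "\<rho> \<in> ?F" "\<rho>' \<in> ?F" "g \<rho> = g \<rho>'"
    have "vge v (int (q + 1)) ((s \<rho> - g \<rho>) - (s \<rho>' - g \<rho>'))"
      by (rule vge_diff[OF conjunct2[OF g[OF r(1)]] conjunct2[OF g[OF r(2)]]])
    then have "vge v (int (q + 1)) (s \<rho> - s \<rho>')" using r(3) by simp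
    then show "\<rho> = \<rho>'" by (rule sep[OF r(1,2)])
  qed
  have "g ` ?F \<subseteq> ?M" using g by blast
  moreover have "card ?M \<le> card (g ` ?F)" unfolding card_image[OF inj] cardF by (rule cardM)
  ultimately have surj: "g ` ?F = ?M" using finM by (simp add: card_seteq)
  obtain \<mu> w where m: "\<mu> \<in> ?M" "w \<in> R" "z = \<mu> + N * w" by (rule R_modulo_N[OF assms(1)])
  have "vge v (int q + 1) (z - N * w)"
    by (rule vge_diff[OF assms(2) vge_mult0'[OF N_order vge_R[OF m(2)]]])
  then have mu: "vge v (int (q + 1)) \<mu>" using m(3) by (simp add: add.commute)
  obtain \<rho> where r: "\<rho> \<in> ?F" "\<mu> = g \<rho>" using m(1) surj by blast
  obtain \<rho>' where r': "\<rho>' \<in> ?F" "0 = g \<rho>'" using lspan.zero surj by blast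
  have "vge v (int (q + 1)) (((s \<rho> - g \<rho>) + g \<rho>) - (s \<rho>' - g \<rho>'))"
    by (rule vge_diff[OF vge_add[OF conjunct2[OF g[OF r(1)]] mu[unfolded r(2)]] conjunct2[OF g[OF r'(1)]]])
  then have "\<rho> = \<rho>'" using r'(2) by (intro sep[OF r(1) r'(1)]) simp
  then have "\<mu> = 0" using r r' by simp
  then show ?thesis using that m by simp
qed

text \<open>The power \<open>q + 1\<close> of the uniformizer is a multiple of \<open>N\<close>,
  which bounds the order of \<open>N\<close> from above.\<close>

lemma N_nz: "N \<noteq> 0" and v_N: "v N = int q + 1"
proof -
  let ?t = "x ^ q ^ 6 - x"
  have tR: "?t ^ (q + 1) \<in> R" by (intro R_diff R_power R_x)
  have vt: "v (?t ^ (q + 1)) = int q + 1" "?t ^ (q + 1) \<noteq> 0"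
    using uniformizer6 v_power[of ?t "q + 1"] by simp_all
  then obtain w where w: "w \<in> R" "?t ^ (q + 1) = N * w" using N_divides[OF tR] by (auto simp: vge_def)
  show nz: "N \<noteq> 0" using w(2) vt(2) by auto
  have "w \<noteq> 0" using w(2) vt(2) by auto
  then have "v N + v w = int q + 1" "0 \<le> v w"
    using w v_mult[OF nz] vt(1) vge_R[OF w(1)] by (auto simp: vge_def)
  then show "v N = int q + 1" using N_order nz by (simp add: vge_def)
qed

text \<open>Some \<open>s\<close> vanishes at \<open>v\<close> but not at \<open>w\<close>; its
  power \<open>q + 1\<close> is a multiple of \<open>N\<close>, so \<open>N\<close> does not vanish
  at \<open>w\<close> either.\<close>

lemma N_unit_elsewhere:
  assumes w: "is_place K w" "vge w 0 x" "w \<noteq> v"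
  shows "w N = 0"
proof -
  interpret w: affine_place q K x y w by (rule affine_placeI[OF w(1,2)])
  have "\<not> center v \<subseteq> center w" using affine_place_eqI[OF v vx w(1,2)] w(3) by blast
  then obtain s where s: "s \<in> center v" "s \<notin> center w" by blast
  then have sR: "s \<in> R" by (simp add: center_def)
  then have ws: "s \<noteq> 0" "w s = 0" using w.unit_iff s(2) by auto
  have "vge v (int (q + 1) * 1) (s ^ (q + 1))" using s by (intro vge_power) (simp add: center_def)
  then have "vge v (int q + 1) (s ^ (q + 1))" by (simp only: mult_1_right of_nat_add of_nat_1)
  then obtain r where r: "r \<in> R" "s ^ (q + 1) = N * r" by (rule N_divides[OF R_power[OF sR]])
  then have "r \<noteq> 0" using ws(1) by auto
  then have "w N + w r = 0" using r(2) w.v_mult[OF N_nz] w.v_power[OF ws(1), of "q + 1"] ws(2) by simp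
  then show ?thesis using w.vge_R[OF N_in_R] w.vge_R[OF r(1)] N_nz \<open>r \<noteq> 0\<close> by (simp add: vge_def)
qed

end

section \<open>Polynomials of low degree vanishing at a place of degree three\<close>

context hermitian
begin

lemma poly_K_frob:
  assumes "\<And>i. coeff p i \<in> K"
  shows "poly p (z ^ q ^ (2 * k)) = poly p z ^ q ^ (2 * k)"
proof -
  have "coeff p i * (z ^ q ^ (2 * k)) ^ i = (coeff p i * z ^ i) ^ q ^ (2 * k)" for i
    using K_frob[OF assms] by (simp add: power_mult_distrib power_mult[symmetric] mult.commute)
  then show ?thesis unfolding poly_altdef by (simp add: sum_power_q)
qed

lemma frob_inj: "inj (\<lambda>s::'f. s ^ q ^ k)"
proof
  fix s t :: 'f assume "s ^ q ^ k = t ^ q ^ k"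
  then have "(s - t) ^ q ^ k = 0" by (simp add: diff_power_q)
  then show "s = t" by simp
qed

end

context place
begin

lemma poly_coeffs_integral_mult:
  "(\<And>i. vge v 0 (coeff p i)) \<Longrightarrow> (\<And>i. vge v 0 (coeff r i)) \<Longrightarrow> vge v 0 (coeff (p * r) i)"
  unfolding coeff_mult by (intro vge_sum vge_mult0)

lemma poly_coeffs_integral_power:
  "(\<And>i. vge v 0 (coeff p i)) \<Longrightarrow> vge v 0 (coeff (p ^ n) i)"
  by (induction n arbitrary: i) (auto simp: coeff_1 intro: poly_coeffs_integral_mult)

lemma poly_coeffs_integral_pcompose:
  assumes "\<And>i. vge v 0 (coeff p i)" "\<And>i. vge v 0 (coeff r i)"
  shows "vge v 0 (coeff (pcompose p r) i)"
  using assms(1)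
proof (induction p arbitrary: i)
  case (pCons a p)
  have "vge v 0 (coeff p j)" for j using pCons.prems[of "Suc j"] by simp
  then have "vge v 0 (coeff (r * pcompose p r) i)"
    using pCons.IH assms(2) by (intro poly_coeffs_integral_mult) auto
  moreover have "vge v 0 (coeff [:a:] i)" using pCons.prems[of 0] by (cases i) auto
  ultimately show ?case unfolding pcompose_pCons coeff_add by (intro vge_add)
qed simp

lemma vge_power_diff: "vge v 0 f \<Longrightarrow> vge v 0 g \<Longrightarrow> vge v n (f - g) \<Longrightarrow> vge v n (f ^ j - g ^ j)"
proof (induction j)
  case (Suc j)
  have "f ^ Suc j - g ^ Suc j = f * (f ^ j - g ^ j) + g ^ j * (f - g)" by (simp add: algebra_simps)
  then show ?case using vge_add[OF vge_mult0[OF Suc.prems(1) Suc.IH[OF Suc.prems]] vge_mult0[OF vge_power0[OF Suc.prems(2)] Suc.prems(3)]]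
    by (simp only:)
qed simp

end

context cubic_place
begin

text \<open>A polynomial of degree at most 2 over \<open>K\<close> that vanishes at the residue of
  \<open>z\<close> also vanishes at its three distinct conjugates; divided differences then remove
  the coefficients one by one.\<close>

lemma residue_independent:
  assumes z: "vge v 0 z" "\<not> vge v 1 (z ^ q\<^sup>2 - z)" and k: "k0 \<in> K" "k1 \<in> K" "k2 \<in> K"
    and rel: "vge v 1 (k0 + k1 * z + k2 * z ^ 2)"
  shows "k0 = 0 \<and> k1 = 0 \<and> k2 = 0"
proof -
  define z1 z2 where zz: "z1 = z ^ q\<^sup>2" "z2 = z1 ^ q\<^sup>2"
  have O1: "vge v 0 z1" "vge v 0 z2" unfolding zz using z(1) vge_power0 by auto
  have n1: "\<not> vge v 1 (z1 - z)" using z(2) zz by simp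
  have "z2 - z1 = (z1 - z) ^ q\<^sup>2" unfolding zz by (simp add: diff_power_q)
  then have n2: "\<not> vge v 1 (z2 - z1)" using vge_frob_iff[of "z1 - z" 2] n1 vge_diff[OF O1(1) z(1)] by simp
  have n3: "\<not> vge v 1 (z2 - z)"
  proof
    assume "vge v 1 (z2 - z)"
    then have "vge v 1 ((z2 - z) ^ q ^ 2)" by (rule vge_frob) simp
    then have "vge v 1 (z ^ q ^ 6 - z1)" unfolding zz by (simp add: diff_power_q frob_power)
    then have "vge v 1 ((z ^ q ^ 6 - z) - (z ^ q ^ 6 - z1))" by (rule vge_diff[OF frob6[OF z(1)]])
    then show False using n1 by simp
  qed
  have conj: "vge v 1 (k0 + k1 * w ^ q\<^sup>2 + k2 * (w ^ q\<^sup>2) ^ 2)" if "vge v 1 (k0 + k1 * w + k2 * w ^ 2)" for w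
  proof -
    have "(k0 + k1 * w + k2 * w ^ 2) ^ q\<^sup>2 = k0 + k1 * w ^ q\<^sup>2 + k2 * (w ^ q\<^sup>2) ^ 2"
      using k K_frob1 by (simp add: add_power_q power_mult_distrib power_mult[symmetric] mult.commute)
    then show ?thesis using vge_frob[OF that, of 2] by simp
  qed
  have r1: "vge v 1 (k0 + k1 * z1 + k2 * z1 ^ 2)" using conj[OF rel] zz by simp
  have r2: "vge v 1 (k0 + k1 * z2 + k2 * z2 ^ 2)" using conj[OF r1] zz by simp
  have quot: "vge v 1 (k1 + k2 * (a + b))" if ab: "vge v 0 a" "vge v 0 b" "\<not> vge v 1 (a - b)"
    "vge v 1 (k0 + k1 * a + k2 * a ^ 2)" "vge v 1 (k0 + k1 * b + k2 * b ^ 2)" for a b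
  proof -
    have "vge v 1 ((k0 + k1 * a + k2 * a ^ 2) - (k0 + k1 * b + k2 * b ^ 2))" by (rule vge_diff[OF ab(4,5)])
    also have "\<dots> = (a - b) * (k1 + k2 * (a + b))" by (simp add: algebra_simps power2_eq_square)
    finally have "vge v 1 \<dots>" .
    moreover have "vge v 0 (k1 + k2 * (a + b))"
      by (rule vge_add[OF vge_const[OF k(2)] vge_mult0[OF vge_const[OF k(3)] vge_add[OF ab(1,2)]]])
    ultimately show ?thesis using vge_prime[OF vge_diff[OF ab(1,2)]] ab(3) by blast
  qed
  have s1: "vge v 1 (k1 + k2 * (z1 + z))" by (rule quot[OF O1(1) z(1) n1 r1 rel])
  have s2: "vge v 1 (k1 + k2 * (z2 + z))" by (rule quot[OF O1(2) z(1) n3 r2 rel])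
  have "vge v 1 ((k1 + k2 * (z2 + z)) - (k1 + k2 * (z1 + z)))" by (rule vge_diff[OF s2 s1])
  also have "(k1 + k2 * (z2 + z)) - (k1 + k2 * (z1 + z)) = k2 * (z2 - z1)" by (simp add: algebra_simps)
  finally have "vge v 1 k2" using vge_prime[OF vge_const[OF k(3)] vge_diff[OF O1(2,1)]] n2 by blast
  then have k2: "k2 = 0" by (rule vge_const_1[OF k(3)])
  then have "k1 = 0" using s1 vge_const_1[OF k(2)] by simp
  then show ?thesis using k2 rel vge_const_1[OF k(1)] by simp
qed

text \<open>If \<open>r\<close> of degree at most \<open>e\<close> has order at least \<open>e\<close> at the place, its restriction to the
  tangent line \<open>s \<mapsto> (x + s, y + x ^ q * s)\<close> vanishes modulo the maximal ideal: the coefficients of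
  \<open>s ^ i\<close> for \<open>i < e\<close> by comparison with the expansion at \<open>(x ^ q ^ 6, y ^ q ^ 6)\<close>, and the leading
  coefficient since the line passes through the conjugate point \<open>(x ^ q\<^sup>2, y ^ q\<^sup>2)\<close>.\<close>

lemma low_order_vanish:
  assumes q3: "q \<ge> 3" and e: "1 \<le> e" "e \<le> q"
    and r: "r \<in> lspan K {x ^ i * y ^ j | i j. j \<le> 2 \<and> i + j \<le> e}" "vge v (int e) r"
  shows "r = 0"
proof -
  have "\<exists>p. (\<forall>j i. coeff (p j) i \<in> K \<and> (coeff (p j) i \<noteq> 0 \<longrightarrow> i + j \<le> e)) \<and> r = (\<Sum>j\<le>2. poly (p j) x * y ^ j)"
    using r(1)
  proof induction
    case zero
    then show ?case using K_closed(1) by (intro exI[of _ "\<lambda>_. 0"]) simp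
  next
    case (step c f z)
    then obtain p i j where p: "\<forall>j i. coeff (p j) i \<in> K \<and> (coeff (p j) i \<noteq> 0 \<longrightarrow> i + j \<le> e)"
        "z = (\<Sum>j\<le>2. poly (p j) x * y ^ j)" and f: "f = x ^ i * y ^ j" "j \<le> 2" "i + j \<le> e" by blast
    let ?p = "p(j := p j + monom c i)"
    have "(\<Sum>k\<le>2. poly (?p k) x * y ^ k) = (\<Sum>k\<le>2. poly (p k) x * y ^ k + (if k = j then c * x ^ i * y ^ j else 0))"
      by (intro sum.cong) (auto simp: poly_monom algebra_simps)
    also have "\<dots> = z + c * f" using f p(2) by (simp add: sum.distrib mult.assoc)
    finally have "c * f + z = (\<Sum>k\<le>2. poly (?p k) x * y ^ k)" by (simp add: add.commute)
    moreover have "\<forall>k i'. coeff (?p k) i' \<in> K \<and> (coeff (?p k) i' \<noteq> 0 \<longrightarrow> i' + k \<le> e)"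
    proof (intro allI)
      fix k i'
      show "coeff (?p k) i' \<in> K \<and> (coeff (?p k) i' \<noteq> 0 \<longrightarrow> i' + k \<le> e)"
        using p(1)[rule_format, of k i'] f(3) step(1) K_closed(5)[of "coeff (p j) i'" c] by (cases "k = j"; cases "i' = i") auto
    qed
    ultimately show ?case by (intro exI[of _ ?p]) blast
  qed
  then obtain p where p: "\<And>j i. coeff (p j) i \<in> K" "\<And>j i. coeff (p j) i \<noteq> 0 \<Longrightarrow> i + j \<le> e"
    and rp: "r = (\<Sum>j\<le>2. poly (p j) x * y ^ j)" by blast
  let ?Q = "q ^ 6"
  define a b where ab: "a = x ^ ?Q" "b = y ^ ?Q"
  \<comment> \<open>\<open>g\<close> restricts \<open>r\<close> to the line through
    \<open>(x, y)\<close> with slope \<open>x ^ q\<close>, and \<open>g'\<close> does the same at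
    \<open>(a, b)\<close>.\<close>
  define g where "g = (\<Sum>j\<le>2. pcompose (p j) [:x, 1:] * [:y, x ^ q:] ^ j)"
  define g' where "g' = (\<Sum>j\<le>2. pcompose (p j) [:a, 1:] * [:b, a ^ q:] ^ j)"
  define gQ where "gQ = map_poly (\<lambda>c. c ^ ?Q) g"
  have g: "poly g s = (\<Sum>j\<le>2. poly (p j) (x + s) * (y + x ^ q * s) ^ j)" for s
    unfolding g_def by (simp add: poly_sum poly_pcompose poly_power mult.commute)
  have g': "poly g' s = (\<Sum>j\<le>2. poly (p j) (a + s) * (b + a ^ q * s) ^ j)" for s
    unfolding g'_def by (simp add: poly_sum poly_pcompose poly_power mult.commute)
  have gO: "vge v 0 (coeff g i)" for i
    unfolding g_def coeff_sum
  proof (intro vge_sum poly_coeffs_integral_mult poly_coeffs_integral_pcompose poly_coeffs_integral_power)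
    fix j k show "vge v 0 (coeff (p j) k)" using p(1) by simp
    show "vge v 0 (coeff [:x, 1:] k)" using vx by (cases k; cases "k - 1") auto
    show "vge v 0 (coeff [:y, x ^ q:] k)" using vy vge_power0[OF vx] by (cases k; cases "k - 1") auto
  qed
  have deg: "degree g \<le> e"
    unfolding g_def
  proof (rule degree_sum_le)
    fix j :: nat assume "j \<in> {..2}"
    show "degree (pcompose (p j) [:x, 1:] * [:y, x ^ q:] ^ j) \<le> e"
    proof (cases "p j = 0")
      case False
      then have "degree (p j) + j \<le> e" using p(2)[of j "degree (p j)"] by simp
      moreover have "degree ([:y, x ^ q:] ^ j) \<le> j" using degree_power_le[of "[:y, x ^ q:]" j] by simp
      moreover have "degree (pcompose (p j) [:x, 1:]) \<le> degree (p j)" using degree_pcompose_le[of "p j" "[:x, 1:]"] by simp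
      ultimately show ?thesis using degree_mult_le[of "pcompose (p j) [:x, 1:]" "[:y, x ^ q:] ^ j"] by linarith
    qed simp
  qed simp
  have cQ: "coeff gQ i = coeff g i ^ ?Q" for i unfolding gQ_def by (simp add: coeff_map_poly)
  have zero: "coeff g i = 0" if "i > e" for i using deg that by (intro coeff_eq_0) simp
  have gs: "poly g s = (\<Sum>i\<le>e. coeff g i * s ^ i)" for s by (rule poly_as_sum_le) (rule zero)
  have gQs: "poly gQ s = (\<Sum>i\<le>e. coeff g i ^ ?Q * s ^ i)" for s
    by (subst poly_as_sum_le[of e]) (simp_all add: cQ zero)
  \<comment> \<open>The power \<open>?Q\<close> fixes the coefficients of \<open>r\<close>, so it
    carries \<open>g\<close> to \<open>g'\<close>. The polynomials are compared at all
    \<open>?Q\<close>-th powers, of which there are infinitely many.\<close>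
  have "gQ = g'"
  proof (rule ccontr)
    assume "gQ \<noteq> g'"
    then have "finite {s. poly (gQ - g') s = 0}" by (intro poly_roots_finite) simp
    moreover have "range (\<lambda>s::'f. s ^ ?Q) \<subseteq> {s. poly (gQ - g') s = 0}"
    proof
      fix w :: 'f assume "w \<in> range (\<lambda>s. s ^ ?Q)"
      then obtain s where w: "w = s ^ ?Q" by blast
      have "poly gQ w = poly g s ^ ?Q" unfolding gQs gs w
        by (simp add: sum_power_q power_mult_distrib power_mult[symmetric] mult.commute)
      moreover have "poly g' w = poly g s ^ ?Q" unfolding g' g w ab
      proof (subst sum_power_q, rule sum.cong[OF refl])
        fix j :: nat
        have "poly (p j) (x ^ ?Q + s ^ ?Q) = poly (p j) (x + s) ^ ?Q"
          using poly_K_frob[of "p j" "x + s" 3] p(1) by (simp add: add_power_q)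
        moreover have "y ^ ?Q + (x ^ ?Q) ^ q * s ^ ?Q = (y + x ^ q * s) ^ ?Q"
          by (simp add: add_power_q power_mult_distrib power_mult[symmetric] mult.commute)
        ultimately show "poly (p j) (x ^ ?Q + s ^ ?Q) * (y ^ ?Q + (x ^ ?Q) ^ q * s ^ ?Q) ^ j =
            (poly (p j) (x + s) * (y + x ^ q * s) ^ j) ^ ?Q"
          by (simp add: power_mult_distrib power_mult[symmetric] mult.commute)
      qed
      ultimately show "w \<in> {s. poly (gQ - g') s = 0}" by simp
    qed
    ultimately have "finite (range (\<lambda>s::'f. s ^ ?Q))" by (rule finite_subset[rotated])
    then have "finite (UNIV :: 'f set)" using frob_inj finite_imageD by blast
    then show False using infinite_R finite_subset[OF subset_UNIV] by blast
  qed
  have xa: "x - a \<noteq> 0" "v (x - a) = 1"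
    using uniformizer6 v_minus[of "x - a"] unfolding ab by auto
  have aO: "vge v 0 a" "vge v 0 b" unfolding ab using vx vy vge_power0 by auto
  \<comment> \<open>The tangent at \<open>(a, b)\<close> has order at least \<open>q\<close> at the
    place, so up to order \<open>e\<close> the function \<open>r\<close> is the value of
    \<open>g'\<close> at the parameter \<open>x - a\<close>.\<close>
  have bl: "vge v (int e) (y - (b + a ^ q * (x - a)))"
  proof -
    have "a ^ (q + 1) = (x ^ (q + 1)) ^ ?Q" unfolding ab by (simp only: power_mult[symmetric] mult.commute)
    also have "\<dots> = (y ^ q) ^ ?Q + b" unfolding curve ab by (rule add_power_q)
    also have "(y ^ q) ^ ?Q = b ^ q" unfolding ab by (simp only: power_mult[symmetric] mult.commute)
    finally have "y - (b + a ^ q * (x - a)) = y - a ^ q * x + b ^ q" by (simp add: algebra_simps)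
    moreover have "vge v (int e) (y - a ^ q * x + b ^ q)"
      using vge_mono[OF tangent_order, of "int e"] e(2) unfolding ab by simp
    ultimately show ?thesis by (simp only:)
  qed
  have "vge v (int e) (r - poly g' (x - a))"
  proof -
    have "r - poly g' (x - a) = (\<Sum>j\<le>2. poly (p j) x * (y ^ j - (b + a ^ q * (x - a)) ^ j))"
      unfolding rp g' by (simp add: sum_subtractf right_diff_distrib)
    moreover have "vge v (int e) (\<Sum>j\<le>2. poly (p j) x * (y ^ j - (b + a ^ q * (x - a)) ^ j))"
    proof (intro vge_sum vge_mult0 vge_power_diff bl vy)
      show "vge v 0 (b + a ^ q * (x - a))" by (rule vge_add[OF aO(2) vge_mult0[OF vge_power0[OF aO(1)] vge_diff[OF vx aO(1)]]])
      fix j show "vge v 0 (poly (p j) x)"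
        unfolding poly_altdef by (intro vge_sum vge_mult0[OF vge_const[OF p(1)]] vge_power0 vx)
    qed
    ultimately show ?thesis by (simp only:)
  qed
  from vge_diff[OF r(2) this] have "vge v (int e) (\<Sum>i\<le>e. coeff g i ^ ?Q * (x - a) ^ i)"
    using \<open>gQ = g'\<close> gQs[of "x - a"] by simp
  \<comment> \<open>The digits are \<open>?Q\<close>-th powers, so each is a unit or of order at
    least \<open>?Q\<close>, as \<open>digits_vge\<close> requires; this is what the expansion at
    \<open>(a, b)\<close> provides.\<close>
  note dig = digits_vge[OF xa _ _ this]
  have Qe: "int e \<le> int ?Q"
  proof -
    have "q ^ 1 \<le> q ^ 6" using q_gt_1 by (intro power_increasing) auto
    then show ?thesis using e(2) by simp
  qed
  have low: "vge v 1 (coeff g i)" if "i < e" for i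
  proof -
    have "vge v 1 (coeff g i ^ ?Q)"
    proof (rule dig)
      fix k show "vge v 0 (coeff g k ^ ?Q)" by (rule vge_power0[OF gO])
      assume "vge v 1 (coeff g k ^ ?Q)"
      then have "vge v 1 (coeff g k)" by (rule vge_power_1[OF gO])
      then have "vge v (int ?Q * 1) (coeff g k ^ ?Q)" by (rule vge_power)
      then show "vge v (int e) (coeff g k ^ ?Q)" using Qe by (elim vge_mono) simp
    qed (use that in auto)
    then show ?thesis by (rule vge_power_1[OF gO])
  qed
  \<comment> \<open>At this parameter the line through \<open>(x, y)\<close> reaches the conjugate
    point, where \<open>r\<close> vanishes too. The terms below \<open>e\<close> are already in the
    maximal ideal and \<open>?s\<close> is a unit, so the leading coefficient is in it as
    well.\<close>
  let ?s = "x ^ q\<^sup>2 - x"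
  have sO: "vge v 0 ?s" by (rule vge_diff[OF vge_power0[OF vx] vx])
  have "poly g ?s = r ^ q\<^sup>2"
  proof -
    have 1: "y + x ^ q * ?s = y ^ q\<^sup>2"
    proof -
      have "x ^ q * x ^ q\<^sup>2 = (x ^ (q + 1)) ^ q"
        by (simp add: power_mult_distrib power_mult[symmetric] power2_eq_square mult.commute)
      also have "\<dots> = y ^ q\<^sup>2 + y ^ q"
        unfolding curve by (simp add: frob1 power_mult[symmetric] power2_eq_square)
      finally have "x ^ q * x ^ q\<^sup>2 = y ^ q\<^sup>2 + y ^ q" .
      moreover have "x ^ q * x = y ^ q + y" using curve by (simp add: mult.commute)
      ultimately show ?thesis by (simp add: right_diff_distrib)
    qed
    have "poly g ?s = (\<Sum>j\<le>2. poly (p j) (x ^ q\<^sup>2) * (y ^ q\<^sup>2) ^ j)" unfolding g 1 by simp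
    also have "\<dots> = (\<Sum>j\<le>2. (poly (p j) x * y ^ j) ^ q\<^sup>2)"
      using poly_K_frob[of "p _" x 1] p(1)
      by (intro sum.cong) (simp_all add: power_mult_distrib power_mult[symmetric] mult.commute)
    also have "\<dots> = r ^ q\<^sup>2" unfolding rp by (rule sum_power_q[symmetric])
    finally show ?thesis .
  qed
  moreover have "vge v 1 (r ^ q\<^sup>2)" using vge_frob[OF vge_mono[OF r(2)], of 1 2] e(1) by simp
  ultimately have 1: "vge v 1 (\<Sum>i\<le>e. coeff g i * ?s ^ i)" using gs by simp
  have 2: "vge v 1 (\<Sum>i<e. coeff g i * ?s ^ i)"
    by (intro vge_sum vge_mult0'[OF low] vge_power0 sO) simp
  have "vge v 1 (coeff g e * ?s ^ e)"
    using vge_diff[OF 1 2] by (simp add: lessThan_Suc_atMost[symmetric])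
  then have top: "vge v 1 (coeff g e)"
    using vge_prime[OF gO vge_power0[OF sO]] vge_power_1[OF sO] not_rational by blast
  have all: "vge v 1 (poly g s)" if "vge v 0 s" for s
    unfolding gs
  proof (intro vge_sum vge_mult0' vge_power0 that)
    fix i assume "i \<in> {..e}"
    then show "vge v 1 (coeff g i)" using low top by (cases "i = e") auto
  qed
  \<comment> \<open>\<open>\<theta> t\<close> is the second coordinate of the point of the line with
    first coordinate \<open>t\<close>. For \<open>t\<close> in \<open>K\<close>, the vanishing of
    \<open>r\<close> there is a relation over \<open>K\<close> between 1, \<open>\<theta> t\<close>
    and its square. It is trivial unless the residue of \<open>\<theta> t\<close> is rational, which
    happens for at most one \<open>t\<close>.\<close>
  define \<theta> where "\<theta> t = x ^ q * t - y ^ q" for t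
  let ?bad = "{t \<in> K. vge v 1 (\<theta> t ^ q\<^sup>2 - \<theta> t)}"
  have good: "poly (p j) t = 0" if t: "t \<in> K - ?bad" and j: "j \<le> 2" for j t
  proof -
    have tK: "t \<in> K" and nb: "\<not> vge v 1 (\<theta> t ^ q\<^sup>2 - \<theta> t)" using t by auto
    have tO: "vge v 0 t" using tK by simp
    have th0: "vge v 0 (\<theta> t)" unfolding \<theta>_def by (rule vge_diff[OF vge_mult0[OF vge_power0[OF vx] tO] vge_power0[OF vy]])
    have "y + x ^ q * (t - x) = \<theta> t" unfolding \<theta>_def using curve by (simp add: algebra_simps)
    then have "poly g (t - x) = (\<Sum>j\<le>2. poly (p j) t * \<theta> t ^ j)" unfolding g by simp
    also have "\<dots> = poly (p 0) t + poly (p 1) t * \<theta> t + poly (p 2) t * \<theta> t ^ 2"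
      by (simp add: numeral_2_eq_2)
    finally have rel: "vge v 1 (poly (p 0) t + poly (p 1) t * \<theta> t + poly (p 2) t * \<theta> t ^ 2)"
      using all[OF vge_diff[OF tO vx]] by simp
    have pK: "poly (p j) t \<in> K" for j unfolding poly_altdef using p(1) tK by (intro K_closed) auto
    have "poly (p 0) t = 0 \<and> poly (p 1) t = 0 \<and> poly (p 2) t = 0"
      by (rule residue_independent[OF th0 nb pK pK pK rel])
    moreover have "j = 0 \<or> j = 1 \<or> j = 2" using j by auto
    ultimately show ?thesis by blast
  qed
  have bad: "card ?bad \<le> 1"
  proof (rule card_le_Suc0_iff_eq[THEN iffD2, folded One_nat_def])
    show "finite ?bad" using finite_K by simp
    show "\<forall>t\<in>?bad. \<forall>u\<in>?bad. t = u"
    proof (intro ballI, rule ccontr)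
      fix t u assume t: "t \<in> ?bad" and u: "u \<in> ?bad" and ne: "t \<noteq> u"
      have ex: "\<theta> t ^ q\<^sup>2 - \<theta> t = (x ^ q ^ 3 - x ^ q) * t - (y ^ q ^ 3 - y ^ q)" if "t \<in> K" for t
      proof -
        have "(z ^ q) ^ q\<^sup>2 = z ^ q ^ 3" for z :: 'f
          by (simp add: power_mult[symmetric] power2_eq_square power3_eq_cube mult.assoc)
        then show ?thesis unfolding \<theta>_def using K_frob1[OF that]
          by (simp add: diff_power_q power_mult_distrib algebra_simps)
      qed
      have "vge v 1 ((\<theta> t ^ q\<^sup>2 - \<theta> t) - (\<theta> u ^ q\<^sup>2 - \<theta> u))" using t u vge_diff by blast
      also have "(\<theta> t ^ q\<^sup>2 - \<theta> t) - (\<theta> u ^ q\<^sup>2 - \<theta> u) = (x ^ q ^ 3 - x ^ q) * (t - u)"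
      proof -
        have "t \<in> K" "u \<in> K" using t u by auto
        then show ?thesis unfolding ex[OF \<open>t \<in> K\<close>] ex[OF \<open>u \<in> K\<close>] by (simp add: algebra_simps)
      qed
      also have "x ^ q ^ 3 - x ^ q = ?s ^ q"
        by (simp add: frob1 power_mult[symmetric] power2_eq_square power3_eq_cube mult.assoc)
      finally have "vge v 1 (?s ^ q * (t - u))" .
      moreover have tu: "t - u \<in> K" "t - u \<noteq> 0" using t u ne by (auto intro: K_closed)
      ultimately have "vge v 1 (?s ^ q)" using vge_unit_cancel v_const by blast
      then show False using vge_power_1[OF sO] not_rational by blast
    qed
  qed
  have "p j = 0" if j: "j \<le> 2" for j
  proof (rule ccontr)
    assume nz: "p j \<noteq> 0"
    have "card (K - ?bad) \<le> card {t. poly (p j) t = 0}"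
      using good[OF _ j] by (intro card_mono poly_roots_finite nz) blast
    also have "\<dots> \<le> degree (p j)" by (rule card_poly_roots_bound[OF nz])
    also have "\<dots> \<le> e" using p(2)[of j "degree (p j)"] nz by simp
    finally have "card K - card ?bad \<le> e" using finite_K by (subst (asm) card_Diff_subset) auto
    then have "q\<^sup>2 \<le> q + 1" using bad card_K e(2) by linarith
    moreover have "3 * q \<le> q\<^sup>2" using q3 by (simp add: power2_eq_square)
    ultimately show False using q3 by linarith
  qed
  then show ?thesis unfolding rp by simp
qed

end

lemma (in tangent_cubic_place) vanishing_divisible:
  assumes "q \<ge> 3" "1 \<le> e" "e \<le> q" "f \<in> V e" "vge v (int e) f"
  obtains f' where "f' \<in> lspan K {x ^ i * y ^ j | i j. i + j + 3 \<le> e}" "f = N * f'"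
proof -
  obtain r f' where *: "r \<in> lspan K {x ^ i * y ^ j | i j. j \<le> 2 \<and> i + j \<le> e}"
    "f' \<in> lspan K {x ^ i * y ^ j | i j. i + j + 3 \<le> e}" "f = r + N * f'" by (rule divide_N[OF assms(4)])
  have "lspan K {x ^ i * y ^ j | i j. i + j + 3 \<le> e} \<subseteq> R" unfolding R_def by (rule lspan_mono[OF K]) auto
  then have "vge v 0 f'" using *(2) vge_R by blast
  then have "vge v (int q + 1) (N * f')" by (rule vge_mult0'[OF N_order])
  then have "vge v (int e) (N * f')" by (rule vge_mono) (use assms(3) in simp)
  then have "vge v (int e) (f - N * f')" by (rule vge_diff[OF assms(5)])
  then have "vge v (int e) r" using *(3) by simp
  then have "r = 0" by (rule low_order_vanish[OF assms(1-3) *(1)])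
  then show ?thesis using that * by simp
qed

section \<open>The residue theorem as a vanishing sum over the rational points\<close>

context hermitian
begin

lemma sum_powers_K: assumes "k < q\<^sup>2 - 1" shows "(\<Sum>a\<in>K. a ^ k) = 0"
proof (cases "k = 0")
  case True
  then show ?thesis using card_K of_nat_q by simp
next
  case False
  have "\<exists>\<zeta>\<in>K. \<zeta> \<noteq> 0 \<and> \<zeta> ^ k \<noteq> 1"
  proof (rule ccontr)
    assume *: "\<not> ?thesis"
    let ?p = "monom (1::'f) k - 1"
    have "coeff ?p k = 1" using False by simp
    then have nz: "?p \<noteq> 0" by (metis coeff_0 zero_neq_one)
    have "card (K - {0}) \<le> card {z. poly ?p z = 0}"
      using * by (intro card_mono poly_roots_finite nz) (auto simp: poly_monom)
    also have "\<dots> \<le> degree ?p" by (rule card_poly_roots_bound[OF nz])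
    also have "\<dots> \<le> k" by (intro degree_diff_le) (auto simp: degree_monom_le)
    finally show False using assms card_K K_closed(1) finite_K by simp
  qed
  then obtain \<zeta> where z: "\<zeta> \<in> K" "\<zeta> \<noteq> 0" "\<zeta> ^ k \<noteq> 1" by blast
  have "(\<Sum>a\<in>K. a ^ k) = (\<Sum>a\<in>K. (\<zeta> * a) ^ k)"
    by (rule sum.reindex_bij_witness[of _ "\<lambda>a. \<zeta> * a" "\<lambda>a. inverse \<zeta> * a"])
      (use z in \<open>auto intro: K_closed simp: mult.assoc[symmetric]\<close>)
  also have "\<dots> = \<zeta> ^ k * (\<Sum>a\<in>K. a ^ k)" by (simp add: power_mult_distrib sum_distrib_left)
  finally have "(\<zeta> ^ k - 1) * (\<Sum>a\<in>K. a ^ k) = 0" by (simp add: algebra_simps)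
  then show ?thesis using z(3) by simp
qed

lemma sum_powers_K_top: "(\<Sum>a\<in>K. a ^ (q\<^sup>2 - 1)) = - 1"
proof -
  have q2: "q\<^sup>2 - 1 > 0" using q2_gt_1 by simp
  have "a ^ (q\<^sup>2 - 1) = (if a = 0 then 0 else 1)" if "a \<in> K" for a
    using K_frob1[OF that] power_minus_mult[of "q\<^sup>2" a] q2 q_gt_1 by (cases "a = 0") auto
  then have "(\<Sum>a\<in>K. a ^ (q\<^sup>2 - 1)) = (\<Sum>a\<in>K. if a = 0 then 0 else 1)" by (intro sum.cong) auto
  also have "\<dots> = (\<Sum>a\<in>K - {0}. 1)" by (rule sum.mono_neutral_cong_right) (use finite_K in auto)
  also have "\<dots> = of_nat (q\<^sup>2 - 1)" using card_K K_closed(1) finite_K by simp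
  also have "\<dots> = - 1" using q2 of_nat_q by (simp add: of_nat_diff)
  finally show ?thesis .
qed

lemma sum_poly_K:
  assumes "degree g \<le> q\<^sup>2 - 1"
  shows "(\<Sum>b\<in>K. poly g b) = - coeff g (q\<^sup>2 - 1)"
proof -
  have "(\<Sum>b\<in>K. poly g b) = (\<Sum>b\<in>K. \<Sum>k\<le>q\<^sup>2 - 1. coeff g k * b ^ k)"
    using assms by (intro sum.cong poly_as_sum_le refl coeff_eq_0) simp
  also have "\<dots> = (\<Sum>k\<le>q\<^sup>2 - 1. coeff g k * (\<Sum>b\<in>K. b ^ k))"
    by (subst sum.swap) (simp add: sum_distrib_left)
  also have "\<dots> = (\<Sum>k\<in>{q\<^sup>2 - 1}. coeff g k * (\<Sum>b\<in>K. b ^ k))"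
    by (rule sum.mono_neutral_right) (auto simp: sum_powers_K)
  finally show ?thesis by (simp add: sum_powers_K_top del: One_nat_def)
qed

definition points :: "('f \<times> 'f) set" where
  "points = {(a, b). a \<in> K \<and> b \<in> K \<and> a ^ (q + 1) = b ^ q + b}"

lemma finite_points: "finite points"
  by (rule finite_subset[of _ "K \<times> K"]) (use finite_K in \<open>auto simp: points_def\<close>)

text \<open>The elements \<open>b ^ q + b - a ^ (q + 1)\<close> lie in the subfield with \<open>q\<close> elements, so that
  their \<open>(q - 1)\<close>-st powers yield the indicator function of the set of points.\<close>

lemma sum_points_monomial:
  assumes j: "j < q" and w: "wt i j \<le> q ^ 3 + q\<^sup>2 - q - 2"
  shows "(\<Sum>(a, b)\<in>points. a ^ i * b ^ j) = 0"
proof -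
  have q0: "q - 1 > 0" using q_gt_1 by simp
  define t where "t a b = b ^ q + b - a ^ (q + 1)" for a b :: 'f
  have ind: "1 - t a b ^ (q - 1) = (if (a, b) \<in> points then 1 else 0)" if ab: "a \<in> K" "b \<in> K" for a b
  proof (cases "t a b = 0")
    case True
    then have "(a, b) \<in> points" using ab unfolding points_def t_def by simp
    then show ?thesis using True q0 by (simp add: power_0_left)
  next
    case False
    have "t a b ^ q = t a b"
      unfolding t_def using K_frob1[OF ab(1)] K_frob1[OF ab(2)]
      by (simp add: frob1 power_mult_distrib power_mult[symmetric] power2_eq_square mult.commute)
    then have "t a b ^ (q - 1) * t a b = 1 * t a b" using power_minus_mult[of q "t a b"] q_gt_1 by simp
    then have "t a b ^ (q - 1) = 1" using False by simp
    moreover have "(a, b) \<notin> points" using False unfolding points_def t_def by auto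
    ultimately show ?thesis by simp
  qed
  \<comment> \<open>In \<open>b\<close>, the product \<open>b ^ j * t a b ^ (q - 1)\<close> is monic
    of degree \<open>j + q * (q - 1)\<close>, and only the coefficient at \<open>q ^ 2 - 1\<close>
    contributes to the sum over \<open>K\<close>. So the sum is independent of \<open>a\<close> and
    nonzero only for \<open>j = q - 1\<close>.\<close>
  have inner: "(\<Sum>b\<in>K. b ^ j * (1 - t a b ^ (q - 1))) = (if j = q - 1 then 1 else 0)" for a
  proof -
    define M where "M = monom 1 q + [:- (a ^ (q + 1)), 1:]"
    let ?g = "monom 1 j * M ^ (q - 1)"
    have dl: "degree [:- (a ^ (q + 1)), 1:] < degree (monom (1::'f) q)" using q_gt_1 by (simp add: degree_monom_eq)
    have dM: "degree M = q" unfolding M_def using degree_add_eq_left[OF dl] by (simp add: degree_monom_eq)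
    have "coeff [:- (a ^ (q + 1)), 1:] q = 0" by (rule coeff_eq_0) (use q_gt_1 in simp)
    then have lM: "lead_coeff M = 1" unfolding dM unfolding M_def by (simp only: coeff_add coeff_monom) simp
    then have nM: "M \<noteq> 0" by (metis leading_coeff_0_iff zero_neq_one)
    have dg: "degree ?g = j + q * (q - 1)"
      using nM by (subst degree_mult_eq) (simp_all add: degree_monom_eq degree_power_eq dM mult.commute)
    have lg: "lead_coeff ?g = 1" using lM by (simp add: lead_coeff_mult lead_coeff_power degree_monom_eq)
    have qq: "q - 1 + q * (q - 1) = q\<^sup>2 - 1" using q_gt_1 by (cases q) (simp_all add: power2_eq_square)
    have le: "degree ?g \<le> q\<^sup>2 - 1" unfolding dg qq[symmetric] using j by simp
    have "coeff ?g (q\<^sup>2 - 1) = (if j = q - 1 then 1 else 0)"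
    proof (cases "j = q - 1")
      case True
      then have "degree ?g = q\<^sup>2 - 1" using dg qq by simp
      then show ?thesis using lg True by simp
    next
      case False
      then have "degree ?g < q\<^sup>2 - 1" unfolding dg qq[symmetric] using j by simp
      then show ?thesis using False by (simp add: coeff_eq_0)
    qed
    moreover have "poly ?g b = b ^ j * t a b ^ (q - 1)" for b
      unfolding t_def M_def by (simp add: poly_monom algebra_simps)
    ultimately have 1: "(\<Sum>b\<in>K. b ^ j * t a b ^ (q - 1)) = - (if j = q - 1 then 1 else 0)"
      using sum_poly_K[OF le] by simp
    have "j < q\<^sup>2 - 1"
    proof -
      have "q * 2 \<le> q * q" using q_gt_1 by simp
      then show ?thesis using j q_gt_1 unfolding power2_eq_square by linarith
    qed
    from sum_powers_K[OF this] 1 show ?thesis by (simp add: right_diff_distrib sum_subtractf)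
  qed
  have "(\<Sum>(a, b)\<in>points. a ^ i * b ^ j) = (\<Sum>(a, b)\<in>K \<times> K. a ^ i * b ^ j * (1 - t a b ^ (q - 1)))"
  proof (rule sum.mono_neutral_cong_left)
    show "points \<subseteq> K \<times> K" unfolding points_def by auto
    show "\<forall>p\<in>K \<times> K - points. (case p of (a, b) \<Rightarrow> a ^ i * b ^ j * (1 - t a b ^ (q - 1))) = 0"
    proof
      fix p assume "p \<in> K \<times> K - points"
      then obtain a b where "p = (a, b)" "a \<in> K" "b \<in> K" "(a, b) \<notin> points" by auto
      then show "(case p of (a, b) \<Rightarrow> a ^ i * b ^ j * (1 - t a b ^ (q - 1))) = 0" using ind[of a b] by simp
    qed
    fix p assume "p \<in> points"
    moreover obtain a b where "p = (a, b)" by (cases p)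
    moreover have "a \<in> K" "b \<in> K" using calculation unfolding points_def by auto
    ultimately show "(case p of (a, b) \<Rightarrow> a ^ i * b ^ j) = (case p of (a, b) \<Rightarrow> a ^ i * b ^ j * (1 - t a b ^ (q - 1)))"
      using ind[of a b] by simp
  qed (use finite_K in simp)
  also have "\<dots> = (\<Sum>a\<in>K. a ^ i * (\<Sum>b\<in>K. b ^ j * (1 - t a b ^ (q - 1))))"
    by (simp add: sum.cartesian_product[symmetric] sum_distrib_left mult.assoc)
  also have "\<dots> = (\<Sum>a\<in>K. a ^ i) * (if j = q - 1 then 1 else 0)" unfolding inner by (simp add: sum_distrib_right)
  also have "\<dots> = 0"
  proof (cases "j = q - 1")
    case True
    \<comment> \<open>The weight for \<open>i = q ^ 2 - 1\<close> and \<open>j = q - 1\<close> is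
      \<open>q ^ 3 + q ^ 2 - q - 1\<close>, just above the bound.\<close>
    have "i < q\<^sup>2 - 1"
    proof (rule ccontr)
      assume "\<not> ?thesis"
      then have "q * (q\<^sup>2 - 1) \<le> q * i" by (intro mult_left_mono) auto
      then have "q * (q\<^sup>2 - 1) + (q + 1) * (q - 1) \<le> q ^ 3 + q\<^sup>2 - q - 2"
        using w unfolding True by linarith
      moreover have "q * (q\<^sup>2 - 1) + (q + 1) * (q - 1) = q ^ 3 + q\<^sup>2 - q - 1"
        using q_gt_1 by (cases q) (simp_all add: power2_eq_square power3_eq_cube algebra_simps)
      moreover have "q ^ 3 + q\<^sup>2 > q + 2"
      proof -
        have "q\<^sup>2 \<ge> 2 * q" using q_gt_1 by (simp add: power2_eq_square)
        moreover have "q ^ 3 \<ge> q ^ 1" using q_gt_1 by (intro power_increasing) auto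
        ultimately show ?thesis using q_gt_1 by simp
      qed
      ultimately show False by linarith
    qed
    then show ?thesis using sum_powers_K by simp
  qed simp
  finally show ?thesis .
qed

definition value_at :: "'f place \<Rightarrow> 'f \<Rightarrow> 'f" where
  "value_at v f = (THE c. c \<in> K \<and> vge v 1 (f - c))"

definition affine_points :: "'f place set" where
  "affine_points = {v. \<exists>a b. at_point a b v}"

end

context rational_place
begin

lemma value_at_eqI: "c \<in> K \<Longrightarrow> vge v 1 (f - c) \<Longrightarrow> value_at v f = c"
  unfolding value_at_def by (rule the_equality) (use value_unique in auto)

lemma value_at: assumes "vge v 0 f" shows "value_at v f \<in> K" "vge v 1 (f - value_at v f)"
proof -
  obtain c where "c \<in> K" "vge v 1 (f - c)" by (rule value_ex[OF assms])
  then show "value_at v f \<in> K" "vge v 1 (f - value_at v f)" using value_at_eqI by auto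
qed

lemma value_at_x: "value_at v x = a" and value_at_y: "value_at v y = b"
  using value_at_eqI aK bK va vb by auto

lemma value_at_const: "c \<in> K \<Longrightarrow> value_at v c = c" by (rule value_at_eqI) auto

lemma value_at_add: assumes "vge v 0 f" "vge v 0 g" shows "value_at v (f + g) = value_at v f + value_at v g"
proof (rule value_at_eqI)
  have "vge v 1 ((f - value_at v f) + (g - value_at v g))" using value_at assms by (intro vge_add)
  then show "vge v 1 (f + g - (value_at v f + value_at v g))" by (simp add: algebra_simps)
qed (use value_at assms in \<open>auto intro: K_closed\<close>)

lemma value_at_mult: assumes "vge v 0 f" "vge v 0 g" shows "value_at v (f * g) = value_at v f * value_at v g"
proof (rule value_at_eqI)
  have "vge v 1 (f * (g - value_at v g) + value_at v g * (f - value_at v f))"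
    using value_at assms by (intro vge_add vge_mult0[OF assms(1)] vge_mult0[OF vge_const]) auto
  then show "vge v 1 (f * g - value_at v f * value_at v g)" by (simp add: algebra_simps)
qed (use value_at assms in \<open>auto intro: K_closed\<close>)

lemma value_at_diff: assumes "vge v 0 f" "vge v 0 g" shows "value_at v (f - g) = value_at v f - value_at v g"
  using value_at_add[of "f - g" g] vge_diff[OF assms] assms by simp

lemma value_at_power: "vge v 0 f \<Longrightarrow> value_at v (f ^ n) = value_at v f ^ n"
  by (induction n) (auto simp: value_at_mult vge_power0 value_at_const[OF K_closed(2)])

lemma value_at_0_iff: assumes "vge v 0 f" shows "value_at v f = 0 \<longleftrightarrow> vge v 1 f"
  using value_at[OF assms] value_at_eqI[OF K_closed(1), of f] by auto

end

context hermitian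
begin

lemma affine_points_bij: "bij_betw (\<lambda>v. (value_at v x, value_at v y)) affine_points points"
proof -
  have at: "at_point (value_at v x) (value_at v y) v" if v: "v \<in> affine_points" for v
  proof -
    obtain a b where ab: "at_point a b v" using v unfolding affine_points_def by blast
    then interpret rational_place q K x y v a b by (rule rational_placeI)
    show ?thesis using ab value_at_x value_at_y by simp
  qed
  show ?thesis
  proof (rule bij_betw_imageI)
    show "inj_on (\<lambda>v. (value_at v x, value_at v y)) affine_points"
    proof
      fix v w assume "v \<in> affine_points" "w \<in> affine_points"
        "(value_at v x, value_at v y) = (value_at w x, value_at w y)"
      then show "v = w" using at[of v] at[of w] at_point_unique by auto
    qed
    show "(\<lambda>v. (value_at v x, value_at v y)) ` affine_points = points"
    proof (intro equalityI subsetI)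
      fix p assume "p \<in> (\<lambda>v. (value_at v x, value_at v y)) ` affine_points"
      then obtain v where "v \<in> affine_points" "p = (value_at v x, value_at v y)" by blast
      then show "p \<in> points" using at[of v] at_point_curve unfolding points_def at_point_def by auto
    next
      fix p assume "p \<in> points"
      then obtain a b where p: "p = (a, b)" "a \<in> K" "b \<in> K" "a ^ (q + 1) = b ^ q + b" unfolding points_def by auto
      obtain v where ab: "at_point a b v" by (rule at_point_exists[OF p(2-4)])
      then interpret rational_place q K x y v a b by (rule rational_placeI)
      have "v \<in> affine_points" using ab unfolding affine_points_def by blast
      then show "p \<in> (\<lambda>v. (value_at v x, value_at v y)) ` affine_points"
        using value_at_x value_at_y p(1) by force
    qed
  qed
qed

lemma finite_affine_points: "finite affine_points"
  using bij_betw_finite[OF affine_points_bij] finite_points by simp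

lemma affine_points_nonempty: "affine_points \<noteq> {}"
proof -
  have "(0, 0) \<in> points" unfolding points_def using K_closed(1) q_gt_1 by simp
  then show ?thesis using affine_points_bij unfolding bij_betw_def by blast
qed

text \<open>This is the residue theorem for F dx / (x^(q^2) - x): the residue at an affine rational
  point is minus the value of \<open>F\<close>, and the bound on the pole order, q^3 + 2g - 2, makes
  the differential regular at infinity.\<close>

lemma sum_affine_points:
  assumes "F \<in> S (q ^ 3 + q\<^sup>2 - q - 1)"
  shows "(\<Sum>v\<in>affine_points. value_at v F) = 0"
proof -
  let ?E = "{x ^ i * y ^ j | i j. j < q \<and> wt i j < q ^ 3 + q\<^sup>2 - q - 1}"
  have mon: "(\<Sum>v\<in>affine_points. value_at v (x ^ i * y ^ j)) = 0"
    if ij: "j < q" "wt i j < q ^ 3 + q\<^sup>2 - q - 1" for i j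
  proof -
    have "(\<Sum>v\<in>affine_points. value_at v (x ^ i * y ^ j)) =
        (\<Sum>v\<in>affine_points. (\<lambda>(a, b). a ^ i * b ^ j) (value_at v x, value_at v y))"
    proof (rule sum.cong[OF refl])
      fix v assume v: "v \<in> affine_points"
      then obtain a b where ab: "at_point a b v" unfolding affine_points_def by blast
      then interpret rational_place q K x y v a b by (rule rational_placeI)
      show "value_at v (x ^ i * y ^ j) = (\<lambda>(a, b). a ^ i * b ^ j) (value_at v x, value_at v y)"
        by (simp add: value_at_mult value_at_power vge_power0 vx vy)
    qed
    also have "\<dots> = (\<Sum>(a, b)\<in>points. a ^ i * b ^ j)" by (rule sum.reindex_bij_betw[OF affine_points_bij])
    also have "\<dots> = 0" using ij by (intro sum_points_monomial) auto
    finally show ?thesis .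
  qed
  have ER: "lspan K ?E \<subseteq> R" unfolding R_def by (rule lspan_mono[OF K]) auto
  have "F \<in> lspan K ?E" using assms unfolding S_def .
  then show ?thesis
  proof induction
    case zero
    have "value_at v 0 = 0" if v: "v \<in> affine_points" for v
    proof -
      obtain a b where ab: "at_point a b v" using v unfolding affine_points_def by blast
      then interpret rational_place q K x y v a b by (rule rational_placeI)
      show ?thesis by (rule value_at_const[OF K_closed(1)])
    qed
    then show ?case by simp
  next
    case (step c e z)
    then obtain i j where e: "e = x ^ i * y ^ j" "j < q" "wt i j < q ^ 3 + q\<^sup>2 - q - 1" by blast
    have "value_at v (c * e + z) = c * value_at v e + value_at v z" if v: "v \<in> affine_points" for v
    proof -
      obtain a b where ab: "at_point a b v" using v unfolding affine_points_def by blast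
      then interpret rational_place q K x y v a b by (rule rational_placeI)
      have eO: "vge v 0 e" unfolding e(1) using R_mon by (intro vge_R)
      have zO: "vge v 0 z" using step(3) ER by (intro vge_R) blast
      have cO: "vge v 0 c" using step(1) by simp
      show ?thesis
        by (simp add: value_at_add value_at_mult vge_mult0[OF cO eO] eO zO cO value_at_const[OF step(1)])
    qed
    then have "(\<Sum>v\<in>affine_points. value_at v (c * e + z)) = c * (\<Sum>v\<in>affine_points. value_at v e) + (\<Sum>v\<in>affine_points. value_at v z)"
      by (simp add: sum.distrib sum_distrib_left)
    also have "\<dots> = 0" using mon[OF e(2,3)] step.IH e(1) by simp
    finally show ?case .
  qed
qed

end

section \<open>Counting\<close>

text \<open>\<open>X\<close> is an information set for \<open>U\<close>; closure under differences
  takes the part of linearity.\<close>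

lemma card_le_by_restriction:
  fixes K :: "'f::ab_group_add set"
  assumes "finite K" "finite S" and U: "U \<subseteq> S \<rightarrow>\<^sub>E K" "\<And>u w. u \<in> U \<Longrightarrow> w \<in> U \<Longrightarrow> (\<lambda>s\<in>S. u s - w s) \<in> U"
    and X: "X \<subseteq> S" "\<And>u. u \<in> U \<Longrightarrow> (\<And>s. s \<in> X \<Longrightarrow> u s = 0) \<Longrightarrow> (\<And>s. s \<in> S \<Longrightarrow> u s = 0)"
  shows "card U \<le> card K ^ card X"
proof -
  have finX: "finite X" using X(1) assms(2) finite_subset by blast
  have "inj_on (\<lambda>u. restrict u X) U"
  proof
    fix u w assume uw: "u \<in> U" "w \<in> U" "restrict u X = restrict w X"
    let ?d = "\<lambda>s\<in>S. u s - w s"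
    have "?d s = 0" if "s \<in> X" for s using fun_cong[OF uw(3), of s] that X(1) by auto
    then have "?d s = 0" if "s \<in> S" for s using X(2)[OF U(2)[OF uw(1,2)]] that by blast
    then have "u s = w s" if "s \<in> S" for s using that by fastforce
    then show "u = w" using uw U(1) by (intro PiE_ext[of u S "\<lambda>_. K" w]) auto
  qed
  moreover have "(\<lambda>u. restrict u X) ` U \<subseteq> X \<rightarrow>\<^sub>E K" using U(1) X(1) by fastforce
  ultimately have "card U \<le> card (X \<rightarrow>\<^sub>E K)" using finX assms(1) by (intro card_inj_on_le) (auto simp: finite_PiE)
  then show ?thesis using finX by (simp add: card_PiE)
qed

text \<open>A minimal information set of \<open>U\<close> has a complement that is again an information set, as
  \<open>U\<close> is isotropic.\<close>

lemma isotropic_card: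
  fixes K :: "'f::field set"
  assumes fin: "finite K" "finite S"
    and U: "U \<subseteq> S \<rightarrow>\<^sub>E K" "\<And>u w. u \<in> U \<Longrightarrow> w \<in> U \<Longrightarrow> (\<lambda>s\<in>S. u s - w s) \<in> U"
    and c: "\<And>s. s \<in> S \<Longrightarrow> c s \<noteq> 0" and iso: "\<And>u w. u \<in> U \<Longrightarrow> w \<in> U \<Longrightarrow> (\<Sum>s\<in>S. c s * u s * w s) = 0"
  shows "card U ^ 2 \<le> card K ^ card S"
proof -
  define info where "info X \<longleftrightarrow> X \<subseteq> S \<and> (\<forall>u\<in>U. (\<forall>s\<in>X. u s = 0) \<longrightarrow> (\<forall>s\<in>S. u s = 0))" for X
  have "info S" unfolding info_def by simp
  then obtain I where I: "info I" "\<And>X. info X \<Longrightarrow> card I \<le> card X"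
    using ex_has_least_nat[of info S card] by blast
  have IS: "I \<subseteq> S" and finI: "finite I" using I(1) fin(2) finite_subset unfolding info_def by auto
  have "u s = 0" if u: "u \<in> U" "\<And>s. s \<in> S - I \<Longrightarrow> u s = 0" and s: "s \<in> I" for u s
  proof -
    \<comment> \<open>By minimality some \<open>w\<close> in \<open>U\<close> vanishes on
      \<open>I\<close> except at \<open>s\<close>. As \<open>u\<close> vanishes off
      \<open>I\<close>, only the term at \<open>s\<close> survives in the form, and so
      \<open>u s = 0\<close>.\<close>
    have "card (I - {s}) < card I" using s finI by (meson card_Diff1_less)
    then have "\<not> info (I - {s})" using I(2) by (meson not_less)
    then obtain w where w: "w \<in> U" "\<forall>s'\<in>I - {s}. w s' = 0" "\<not> (\<forall>s\<in>S. w s = 0)"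
      using IS unfolding info_def by blast
    have ws: "w s \<noteq> 0"
    proof
      assume "w s = 0"
      then have "\<forall>s'\<in>I. w s' = 0" using w(2) by blast
      then show False using I(1) w(1,3) unfolding info_def by blast
    qed
    have "0 = (\<Sum>s'\<in>S. c s' * u s' * w s')" using iso[OF u(1) w(1)] by simp
    also have "\<dots> = (\<Sum>s'\<in>{s}. c s' * u s' * w s')"
      by (rule sum.mono_neutral_right) (use fin(2) s IS w(2) u(2) in auto)
    finally show ?thesis using ws c s IS by auto
  qed
  then have co: "card U \<le> card K ^ card (S - I)"
    by (intro card_le_by_restriction[OF fin U]) (use IS in auto)
  have "card U \<le> card K ^ card I"
    by (intro card_le_by_restriction[OF fin U]) (use I(1) in \<open>auto simp: info_def\<close>)
  then have "card U * card U \<le> card K ^ card I * card K ^ card (S - I)" using co by (rule mult_mono) auto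
  also have "\<dots> = card K ^ card S" using IS fin(2) finI card_mono[OF fin(2) IS]
    by (simp add: power_add[symmetric] card_Diff_subset)
  finally show ?thesis by (simp add: power2_eq_square)
qed

text \<open>Rank and nullity in terms of cardinalities: translation embeds every fiber into
  \<open>L\<close>.\<close>

lemma card_le_fiber:
  fixes f :: "'f::ab_group_add \<Rightarrow> 'b"
  assumes "finite A" and diff: "\<And>a b. a \<in> A \<Longrightarrow> b \<in> A \<Longrightarrow> f a = f b \<Longrightarrow> a - b \<in> L" and L: "finite L"
  shows "card A \<le> card (f ` A) * card L"
proof -
  have fib: "card {a \<in> A. f a = b} \<le> card L" if b: "b \<in> f ` A" for b
  proof -
    obtain a0 where a0: "a0 \<in> A" "b = f a0" using b by blast
    show ?thesis
      by (rule card_inj_on_le[of "\<lambda>a. a - a0"]) (use a0 diff L in \<open>auto simp: inj_on_def\<close>)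
  qed
  have "card A = card (\<Union>b\<in>f ` A. {a \<in> A. f a = b})" by (rule arg_cong[of _ _ card]) auto
  also have "\<dots> \<le> (\<Sum>b\<in>f ` A. card {a \<in> A. f a = b})" by (rule card_UN_le) (use assms(1) in simp)
  also have "\<dots> \<le> (\<Sum>b\<in>f ` A. card L)" by (rule sum_mono) (rule fib)
  finally show ?thesis by simp
qed

lemma card_triangle: "2 * card {(i::nat, j::nat). i + j \<le> d} = (d + 1) * (d + 2)"
proof -
  have "{(i::nat, j::nat). i + j \<le> d} = (SIGMA i:{..d}. {..d - i})" by auto
  then have "card {(i::nat, j::nat). i + j \<le> d} = (\<Sum>i\<le>d. d - i + 1)" by (simp add: card_SigmaI)
  also have "\<dots> = (\<Sum>i\<le>d. i + 1)"
    by (rule sum.reindex_bij_witness[of _ "\<lambda>i. d - i" "\<lambda>i. d - i"]) auto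
  finally have "card {(i::nat, j::nat). i + j \<le> d} = (\<Sum>i\<le>d. i + 1)" .
  moreover have "2 * (\<Sum>i\<le>d. i + 1) = (d + 1) * (d + 2)" by (induction d) simp_all
  ultimately show ?thesis by simp
qed

lemma finite_triangle: "finite {(i::nat, j::nat). i + j + c \<le> d}"
  by (rule finite_subset[of _ "{..d} \<times> {..d}"]) auto

text \<open>The integer product also covers \<open>e = 1\<close> and \<open>e = 2\<close>, where the
  triangle is empty. At \<open>e = 0\<close> it would be 2 although the triangle is empty, so that
  case is treated separately.\<close>

lemma card_small_triangle:
  assumes "e \<ge> 1"
  shows "2 * int (card {(i::nat, j::nat). i + j + 3 \<le> e}) = (int e - 1) * (int e - 2)"
proof (cases "e \<ge> 3")
  case True
  then obtain d where d: "e = d + 3" by (metis add.commute le_Suc_ex)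
  have "{(i::nat, j::nat). i + j + 3 \<le> e} = {(i, j). i + j \<le> d}" using d by auto
  then have "2 * int (card {(i::nat, j::nat). i + j + 3 \<le> e}) = int ((d + 1) * (d + 2))"
    using card_triangle[of d] by (simp only: of_nat_mult[symmetric, of 2, simplified])
  then show ?thesis using d by (simp add: algebra_simps)
next
  case False
  then have "{(i::nat, j::nat). i + j + 3 \<le> e} = {}" by auto
  moreover have "e = 1 \<or> e = 2" using False assms by auto
  ultimately show ?thesis by auto
qed

context hermitian
begin

lemma V_image: "V d = lspan K ((\<lambda>(i, j). x ^ i * y ^ j) ` {(i, j). i + j \<le> d})"
  unfolding V_def by (rule arg_cong[of _ _ "lspan K"]) auto

lemma finite_V: "finite (V d)"
  unfolding V_image by (rule finite_lspan_image[OF K finite_K]) (use finite_triangle[of 0 d] in simp)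

lemma card_V_ge: assumes "d < q" shows "card K ^ card {(i::nat, j::nat). i + j \<le> d} \<le> card (V d)"
proof -
  let ?I = "{(i::nat, j::nat). i + j \<le> d}"
  have fin: "finite ?I" using finite_triangle[of 0 d] by simp
  let ?f = "\<lambda>c. \<Sum>(i, j)\<in>?I. c (i, j) * (x ^ i * y ^ j)"
  have inj: "inj_on ?f (?I \<rightarrow>\<^sub>E K)"
  proof
    fix c d' assume cd: "c \<in> ?I \<rightarrow>\<^sub>E K" "d' \<in> ?I \<rightarrow>\<^sub>E K" "?f c = ?f d'"
    let ?e = "\<lambda>i j. c (i, j) - d' (i, j)"
    have z: "(\<Sum>(i, j)\<in>?I. ?e i j * (x ^ i * y ^ j)) = 0"
      using cd(3) by (simp add: left_diff_distrib sum_subtractf case_prod_unfold)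
    have I: "\<forall>(i, j)\<in>?I. j < q \<and> ?e i j \<in> K"
      using cd(1,2) assms by (auto intro!: K_closed(3) dest: PiE_mem)
    have "c p = d' p" if p: "p \<in> ?I" for p
      using reduced_independent[OF fin I z, of "fst p" "snd p"] p by (simp add: case_prod_unfold)
    then show "c = d'" using cd by (intro PiE_ext[of c ?I "\<lambda>_. K" d']) auto
  qed
  have "?f ` (?I \<rightarrow>\<^sub>E K) \<subseteq> V d"
  proof (intro image_subsetI)
    fix c assume c: "c \<in> ?I \<rightarrow>\<^sub>E K"
    show "?f c \<in> V d" unfolding V_def
    proof (intro lspan_sum[OF K])
      fix p assume p: "p \<in> ?I"
      obtain i j where ij: "p = (i, j)" by (cases p)
      have "c (i, j) \<in> K" using c p ij by (auto dest: PiE_mem)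
      moreover have "x ^ i * y ^ j \<in> {x ^ i * y ^ j | i j. i + j \<le> d}" using p ij by blast
      ultimately show "(case p of (i, j) \<Rightarrow> c (i, j) * (x ^ i * y ^ j)) \<in> lspan K {x ^ i * y ^ j | i j. i + j \<le> d}"
        unfolding ij prod.case by (rule lspan_base_scale[OF K])
    qed
  qed
  then have "card (?I \<rightarrow>\<^sub>E K) \<le> card (V d)" using inj finite_V by (intro card_inj_on_le)
  then show ?thesis using fin by (simp add: card_PiE)
qed

text \<open>A reduced monomial of total degree above \<open>e\<close> but weight at most
  \<open>e * (q + 1)\<close> would have \<open>i \<ge> q + 1\<close>; then \<open>q * i\<close>
  alone exceeds that weight, as \<open>e < q\<close>.\<close>

lemma S_subset_V: assumes "e < q" shows "S (e * (q + 1) + 1) \<subseteq> V e"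
  unfolding S_def V_def
proof (rule lspan_mono[OF K], clarify)
  fix i j assume ij: "j < q" "wt i j < e * (q + 1) + 1"
  have "i + j \<le> e"
  proof (rule ccontr)
    assume "\<not> i + j \<le> e"
    then have "(q + 1) * (e + 1) \<le> (q + 1) * (i + j)" by (intro mult_left_mono) auto
    then have iq: "q + 1 \<le> i" using ij(2) by (simp add: algebra_simps)
    have "q * (q + 1) \<le> q * i" using iq by (rule mult_left_mono) simp
    then have "q * (q + 1) \<le> e * (q + 1)" using ij(2) by linarith
    then have "q \<le> e" by (metis mult_le_cancel2 add_gr_0 zero_less_one)
    then show False using assms by simp
  qed
  then show "\<exists>i' j'. x ^ i * y ^ j = x ^ i' * y ^ j' \<and> i' + j' \<le> e" by blast
qed

end

lemma (in hermitian_curve) vge_inf_V: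
  assumes "F \<in> V d"
  shows "vge Pinf (- (int d * (int q + 1))) F"
proof (rule inf.vge_lspan)
  show "F \<in> lspan K {x ^ i * y ^ j | i j. i + j \<le> d}" using assms unfolding V_def .
  fix e assume "e \<in> {x ^ i * y ^ j | i j. i + j \<le> d}"
  then obtain i j where e: "e = x ^ i * y ^ j" "i + j \<le> d" by blast
  have "Pinf e = - int (wt i j)"
    unfolding e(1) by (simp add: inf.v_mult inf.v_power v_inf_x v_inf_y algebra_simps)
  moreover have "wt i j \<le> (q + 1) * (i + j)" by (simp add: algebra_simps)
  moreover have "(q + 1) * (i + j) \<le> (q + 1) * d" using e(2) by (rule mult_left_mono) simp
  ultimately have "- int ((q + 1) * d) \<le> Pinf e" by linarith
  then show "vge Pinf (- (int d * (int q + 1))) e" unfolding vge_def by (simp add: algebra_simps)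
qed

section \<open>The minimum distance\<close>

lemma (in place) vge_divide: "vge v n f \<Longrightarrow> g \<noteq> 0 \<Longrightarrow> vge v (n - v g) (f / g)"
  using vge_cancel[of n "f / g" g] by simp

locale hermitian_cubic = hermitian_curve q K x y + P: tangent_cubic_place q K x y P N
  for q and K :: "'f::field set" and x y :: 'f and P N
begin

lemma P_not_affine_point: "P \<notin> affine_points"
proof
  assume "P \<in> affine_points"
  then obtain a b where "at_point a b P" unfolding affine_points_def by blast
  then interpret r: rational_place q K x y P a b by (rule rational_placeI)
  show False using r.frob_rational[OF R_x] P.not_rational by simp
qed

lemma v_inf_N: "Pinf N = - (3 * (int q + 1))"
proof -
  have y3: "Pinf (y ^ 3) = - (3 * (int q + 1))" by (simp add: inf.v_power v_inf_y)
  have "vge Pinf (Pinf (y ^ 3) + 1) (N - y ^ 3)"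
  proof (rule inf.vge_lspan[OF _ P.N_monic])
    fix f assume "f \<in> {x ^ i * y ^ j | i j. j \<le> 2 \<and> i + j \<le> 3}"
    then obtain i j where f: "f = x ^ i * y ^ j" "j \<le> 2" "i + j \<le> 3" by blast
    have "q * (i + j) \<le> q * 3" using f(3) by (rule mult_left_mono) simp
    then have "wt i j \<le> 3 * q + 2" using f(2) by (simp add: algebra_simps)
    then have "int (wt i j) \<le> int (3 * q + 2)" by (simp only: of_nat_le_iff)
    moreover have "Pinf f = - int (wt i j)"
      unfolding f(1) by (simp add: inf.v_mult inf.v_power v_inf_x v_inf_y algebra_simps)
    ultimately show "vge Pinf (Pinf (y ^ 3) + 1) f" unfolding y3 vge_def by (intro disjI2) simp
  qed
  from inf.v_add_eq(1)[OF _ this] show ?thesis using y3 by simp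
qed

lemma v_inf_frob: "Pinf (x ^ q\<^sup>2 - x) = - (int q ^ 3)"
proof -
  have 1: "Pinf (x ^ q\<^sup>2) = - (int q ^ 3)" by (simp add: inf.v_power v_inf_x power2_eq_square power3_eq_cube)
  have "int q ^ 1 < int q ^ 3" using q_gt_1 by (intro power_strict_increasing) auto
  then have "vge Pinf (Pinf (x ^ q\<^sup>2) + 1) (- x)"
    unfolding 1 vge_def inf.v_minus v_inf_x power_one_right by (intro disjI2) linarith
  from inf.v_add_eq(1)[OF _ this] show ?thesis using 1 by simp
qed

text \<open>\<open>hP\<close>, \<open>hD\<close>, \<open>hO\<close> and \<open>hI\<close> spell out
  that the divisor of h dx is at least m P - D, with the order of dx at infinity moved to the other
  side.\<close>

lemma weight_bound:
  assumes q3: "q \<ge> 3" and qe: "q = 3 * k + e + 2" and h: "h \<noteq> 0"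
    and hP: "vge P (int (2 * k * (q + 1) + e)) h"
    and hD: "\<And>v. v \<in> affine_points \<Longrightarrow> vge v (- 1) h"
    and hO: "\<And>v. is_place K v \<Longrightarrow> vge v 0 x \<Longrightarrow> v \<noteq> P \<Longrightarrow> v \<notin> affine_points \<Longrightarrow> vge v 0 h"
    and hI: "vge Pinf (- ((int q - 2) * (int q + 1))) h"
  shows "(3 * int k + 1) * (3 * int k + 2) - (int e - 1) * (int e - 2)
    \<le> int (card {v \<in> affine_points. \<not> vge v 0 h})"
proof -
  let ?S = "{v \<in> affine_points. \<not> vge v 0 h}" and ?t = "x ^ q\<^sup>2 - x"
  \<comment> \<open>Division by \<open>N ^ (2 * k)\<close> leaves a zero of order at least
    \<open>e\<close> at \<open>P\<close> and does not change the other affine orders.\<close>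
  define h1 where "h1 = h / N ^ (2 * k)"
  \<comment> \<open>The factor \<open>?t\<close> clears the simple poles; up to sign the values of
    \<open>z\<close> are the residues of h1 dx, and they become the coefficients of the diagonal
    form.\<close>
  define z where "z = h1 * ?t"
  have tnz: "?t \<noteq> 0" using x_frob_nz[of 1] by simp
  have h1nz: "h1 \<noteq> 0" unfolding h1_def using h P.N_nz by simp
  have h1P: "vge P (int e) h1"
  proof -
    have "vge P (int (2 * k * (q + 1) + e) - P (N ^ (2 * k))) h1"
      unfolding h1_def by (rule P.vge_divide[OF hP]) (use P.N_nz in simp)
    then show ?thesis using P.v_power[OF P.N_nz, of "2 * k"] P.v_N by (simp add: algebra_simps)
  qed
  have h1v: "vge v n h1" if "is_place K v" "vge v 0 x" "v \<noteq> P" "vge v n h" for v n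
  proof -
    interpret affine_place q K x y v by (rule affine_placeI[OF that(1,2)])
    have "vge v (n - v (N ^ (2 * k))) h1"
      unfolding h1_def by (rule vge_divide[OF that(4)]) (use P.N_nz in simp)
    then show ?thesis using v_power[OF P.N_nz, of "2 * k"] P.N_unit_elsewhere[OF that(1-3)] by simp
  qed
  have h1I: "vge Pinf (- ((int q - 2) * (int q + 1)) + int (2 * k) * (3 * (int q + 1))) h1"
  proof -
    have "Pinf (N ^ (2 * k)) = - (int (2 * k) * (3 * (int q + 1)))"
      unfolding inf.v_power[OF P.N_nz] v_inf_N by (rule mult_minus_right)
    then show ?thesis using inf.vge_divide[OF hI, of "N ^ (2 * k)"] P.N_nz
      unfolding h1_def by simp
  qed
  have PD: "v \<noteq> P" if "v \<in> affine_points" for v using that P_not_affine_point by blast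
  have zR: "z \<in> R"
  proof (rule regular_in_R)
    fix v assume pv: "is_place K v" "vge v 0 x"
    interpret affine_place q K x y v by (rule affine_placeI[OF pv])
    have tO: "vge v 0 ?t" by (rule vge_diff[OF vge_power0[OF vx] vx])
    show "vge v 0 z"
    proof (cases "v \<in> affine_points")
      case True
      then obtain a b where "at_point a b v" unfolding affine_points_def by blast
      then interpret r: rational_place q K x y v a b by (rule rational_placeI)
      have "vge v 1 ?t" using r.rational_uniformizer by (simp add: vge_def)
      then have "vge v (- 1 + 1) z" unfolding z_def by (rule vge_mult[OF h1v[OF pv PD[OF True] hD[OF True]]])
      then show ?thesis by simp
    next
      case False
      have "vge v 0 h1"
      proof (cases "v = P")
        case True
        then show ?thesis using vge_mono[OF h1P, of 0] by simp
      next
        case F: False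
        then show ?thesis by (intro h1v[OF pv] hO[OF pv] False)
      qed
      then show ?thesis unfolding z_def by (rule vge_mult0[OF _ tO])
    qed
  qed
  have zI: "vge Pinf (- ((int q - 2) * (int q + 1)) + int (2 * k) * (3 * (int q + 1)) + (- (int q ^ 3))) z"
    unfolding z_def by (rule inf.vge_mult[OF h1I]) (simp add: vge_def v_inf_frob)
  let ?V = "V (3 * k)"
  have orth: "(\<Sum>v\<in>?S. value_at v z * value_at v F * value_at v G) = 0" if FG: "F \<in> ?V" "G \<in> ?V" for F G
  proof -
    let ?n = "q ^ 3 + q\<^sup>2 - q - 2"
    have FGR: "F \<in> R" "G \<in> R" using FG V_subset_R by auto
    have n: "int ?n = int q ^ 3 + (int q - 2) * (int q + 1)"
    proof -
      have "q\<^sup>2 \<ge> 3 * q" using q3 by (simp add: power2_eq_square)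
      then have "q + 2 \<le> q ^ 3 + q\<^sup>2" using q3 by linarith
      then have "int ?n = int q ^ 3 + int q ^ 2 - int q - 2" by (simp add: of_nat_diff)
      then show ?thesis by (simp add: algebra_simps power2_eq_square)
    qed
    \<comment> \<open>The contributions of \<open>N ^ (2 * k)\<close> and of \<open>F * G\<close>
      cancel, which leaves exactly the pole order permitted in
      \<open>sum_affine_points\<close>.\<close>
    have "vge Pinf (- ((int q - 2) * (int q + 1)) + int (2 * k) * (3 * (int q + 1)) + (- (int q ^ 3))
        + (- (int (3 * k) * (int q + 1))) + (- (int (3 * k) * (int q + 1)))) (z * F * G)"
      by (rule inf.vge_mult[OF inf.vge_mult[OF zI vge_inf_V[OF FG(1)]] vge_inf_V[OF FG(2)]])
    then have "vge Pinf (- int ?n) (z * F * G)" unfolding n by (simp add: algebra_simps)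
    from S_of_vge_inf[OF R_mult[OF R_mult[OF zR FGR(1)] FGR(2)] this]
    have "z * F * G \<in> S (?n + 1)" .
    moreover have "?n + 1 = q ^ 3 + q\<^sup>2 - q - 1"
    proof -
      have "q\<^sup>2 \<ge> 3 * q" using q3 by (simp add: power2_eq_square)
      then show ?thesis using q3 by linarith
    qed
    ultimately have 0: "(\<Sum>v\<in>affine_points. value_at v (z * F * G)) = 0" using sum_affine_points by simp
    have "value_at v (z * F * G) = (if v \<in> ?S then value_at v z * value_at v F * value_at v G else 0)"
      if vA: "v \<in> affine_points" for v
    proof -
      obtain a b where ab: "at_point a b v" using vA unfolding affine_points_def by blast
      then interpret r: rational_place q K x y v a b by (rule rational_placeI)
      note O = r.vge_R[OF zR] r.vge_R[OF FGR(1)] r.vge_R[OF FGR(2)]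
      have 1: "value_at v (z * F * G) = value_at v z * value_at v F * value_at v G"
        using O by (simp add: r.value_at_mult r.vge_mult0)
      have "value_at v z = 0" if "v \<notin> ?S"
      proof -
        have "vge v 0 h1" using that vA h1v[OF r.v r.vx PD[OF vA]] by blast
        moreover have "vge v 1 ?t" using r.rational_uniformizer by (simp add: vge_def)
        ultimately have "vge v 1 z" unfolding z_def by (rule r.vge_mult0)
        then show ?thesis using r.value_at_0_iff[OF O(1)] by simp
      qed
      then show ?thesis using 1 by simp
    qed
    then have "(\<Sum>v\<in>affine_points. if v \<in> ?S then value_at v z * value_at v F * value_at v G else 0) = 0"
      using 0 by (simp cong: sum.cong)
    then show ?thesis using finite_affine_points by (subst (asm) sum.inter_filter[symmetric]) auto
  qed
  have znz: "value_at v z \<noteq> 0" if vS: "v \<in> ?S" for v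
  proof -
    have vA: "v \<in> affine_points" using vS by simp
    obtain a b where ab: "at_point a b v" using vA unfolding affine_points_def by blast
    then interpret r: rational_place q K x y v a b by (rule rational_placeI)
    have "v N = 0" by (rule P.N_unit_elsewhere[OF r.v r.vx PD[OF vA]])
    then have vh1: "v h1 = v h" unfolding h1_def using h P.N_nz by (simp add: r.v_divide r.v_power)
    have "v h < 0" using vS h by (simp add: vge_def)
    then have "v z \<le> 0" unfolding z_def using vh1 r.v_mult[OF h1nz tnz] r.rational_uniformizer by simp
    then have "\<not> vge v 1 z" unfolding vge_def z_def using h1nz tnz by simp
    then show ?thesis using r.value_at_0_iff[OF r.vge_R[OF zR]] by simp
  qed
  let ?f = "\<lambda>F. \<lambda>v\<in>?S. value_at v F"
  let ?L = "{F \<in> ?V. \<forall>v\<in>?S. value_at v F = 0}"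
  have val_diff: "value_at v (F - G) = value_at v F - value_at v G" and val_K: "value_at v F \<in> K"
    if vFG: "v \<in> ?S" "F \<in> ?V" "G \<in> ?V" for v F G
  proof -
    obtain a b where ab: "at_point a b v" using vFG(1) unfolding affine_points_def by blast
    then interpret r: rational_place q K x y v a b by (rule rational_placeI)
    have "vge v 0 F" "vge v 0 G" using vFG V_subset_R r.vge_R by auto
    then show "value_at v (F - G) = value_at v F - value_at v G" "value_at v F \<in> K"
      using r.value_at_diff r.value_at by auto
  qed
  have Vdiff: "F - G \<in> ?V" if "F \<in> ?V" "G \<in> ?V" for F G
    using that unfolding V_def by (rule lspan_diff[OF K])
  have finS: "finite ?S" using finite_affine_points by simp
  have iso: "card (?f ` ?V) ^ 2 \<le> card K ^ card ?S"
  proof (rule isotropic_card[OF finite_K finS, where c = "\<lambda>v. value_at v z"])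
    show "?f ` ?V \<subseteq> ?S \<rightarrow>\<^sub>E K"
    proof (rule image_subsetI)
      fix F assume F: "F \<in> ?V"
      show "?f F \<in> ?S \<rightarrow>\<^sub>E K" by (rule restrict_PiE_iff[THEN iffD2]) (use val_K[OF _ F F] in blast)
    qed
    fix u w assume "u \<in> ?f ` ?V" "w \<in> ?f ` ?V"
    then obtain F G where FG: "F \<in> ?V" "G \<in> ?V" "u = ?f F" "w = ?f G" by blast
    have "(\<lambda>s\<in>?S. u s - w s) = ?f (F - G)" unfolding FG(3,4) by (intro restrict_ext) (simp add: val_diff[OF _ FG(1,2)])
    then show "(\<lambda>s\<in>?S. u s - w s) \<in> ?f ` ?V" using Vdiff[OF FG(1,2)] by (intro image_eqI[of _ _ "F - G"])
    have "(\<Sum>s\<in>?S. value_at s z * u s * w s) = (\<Sum>v\<in>?S. value_at v z * value_at v F * value_at v G)"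
      unfolding FG(3,4) by (intro sum.cong) auto
    then show "(\<Sum>s\<in>?S. value_at s z * u s * w s) = 0" using orth[OF FG(1,2)] by simp
  qed (rule znz)
  have fib: "card ?V \<le> card (?f ` ?V) * card ?L"
  proof (rule card_le_fiber[OF finite_V])
    show "finite ?L" using finite_V by simp
    fix F G assume FG: "F \<in> ?V" "G \<in> ?V" "?f F = ?f G"
    have "value_at v (F - G) = 0" if "v \<in> ?S" for v
      using fun_cong[OF FG(3), of v] val_diff[OF that FG(1,2)] that by simp
    then show "F - G \<in> ?L" using Vdiff[OF FG(1,2)] by blast
  qed
  \<comment> \<open>For \<open>e = 0\<close> the functions \<open>F * h1\<close> are constants, of
    dimension 1. This is also the value of (e - 1)(e - 2) / 2 at 0, so the final formula is
    uniform.\<close>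
  let ?c = "if e = 0 then 1 else card {(i::nat, j::nat). i + j + 3 \<le> e}"
  have cL: "card ?L \<le> card K ^ ?c"
  proof -
    have LV: "F * h1 \<in> V e \<and> vge P (int e) (F * h1)" if FL: "F \<in> ?L" for F
    proof -
      have FR: "F \<in> R" using FL V_subset_R by blast
      have "F * h1 \<in> R"
      proof (rule regular_in_R)
        fix v assume pv: "is_place K v" "vge v 0 x"
        interpret affine_place q K x y v by (rule affine_placeI[OF pv])
        show "vge v 0 (F * h1)"
        proof (cases "v \<in> ?S")
          case True
          then obtain a b where "at_point a b v" unfolding affine_points_def by blast
          then interpret r: rational_place q K x y v a b by (rule rational_placeI)
          have "vge v 1 F" using FL True r.value_at_0_iff[OF vge_R[OF FR]] by blast
          moreover have "vge v (- 1) h1" using True by (intro h1v[OF pv PD hD]) auto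
          ultimately have "vge v (1 + (- 1)) (F * h1)" by (rule vge_mult)
          then show ?thesis by simp
        next
          case False
          have "vge v 0 h1"
          proof (cases "v = P")
            case True
            then show ?thesis using vge_mono[OF h1P, of 0] by simp
          next
            case F: False
            then show ?thesis using False hO[OF pv] by (intro h1v[OF pv]) auto
          qed
          then show ?thesis by (rule vge_mult0[OF vge_R[OF FR]])
        qed
      qed
      moreover have "vge Pinf (- int (e * (q + 1))) (F * h1)"
      proof -
        have "F \<in> ?V" using FL by simp
        from inf.vge_mult[OF vge_inf_V[OF this] h1I]
        have "vge Pinf (- (int (3 * k) * (int q + 1)) + (- ((int q - 2) * (int q + 1)) + int (2 * k) * (3 * (int q + 1)))) (F * h1)" .
        moreover have "- (int (3 * k) * (int q + 1)) + (- ((int q - 2) * (int q + 1)) + int (2 * k) * (3 * (int q + 1)))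
            = - int (e * (q + 1))"
        proof -
          have e: "int e = int q - 2 - 3 * int k" using qe by simp
          show ?thesis unfolding of_nat_mult e by (simp add: algebra_simps)
        qed
        ultimately show ?thesis by (simp only:)
      qed
      ultimately have "F * h1 \<in> S (e * (q + 1) + 1)" by (rule S_of_vge_inf)
      moreover have "e < q" using qe by simp
      ultimately have "F * h1 \<in> V e" using S_subset_V by blast
      moreover have "vge P (0 + int e) (F * h1)" by (rule P.vge_mult[OF P.vge_R[OF FR] h1P])
      ultimately show ?thesis by simp
    qed
    have inj: "inj_on (\<lambda>F. F * h1) ?L" using h1nz by (auto simp: inj_on_def)
    show ?thesis
    proof (cases "e = 0")
      case True
      have "card ?L \<le> card (V 0)"
        by (rule card_inj_on_le[OF inj]) (use LV True finite_V in auto)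
      also have "V 0 = lspan K ((\<lambda>_. 1) ` {0::nat})" unfolding V_def by (rule arg_cong[of _ _ "lspan K"]) auto
      also have "card \<dots> \<le> card K ^ card {0::nat}" by (rule card_lspan_image_le[OF K finite_K]) simp
      finally show ?thesis using True by simp
    next
      case False
      let ?I = "{(i::nat, j::nat). i + j + 3 \<le> e}"
      let ?W = "lspan K ((\<lambda>(i, j). x ^ i * y ^ j) ` ?I)"
      have finW: "finite ?W" by (rule finite_lspan_image[OF K finite_K finite_triangle])
      have W: "?W = lspan K {x ^ i * y ^ j | i j. i + j + 3 \<le> e}" by (rule arg_cong[of _ _ "lspan K"]) auto
      have "(\<lambda>F. F * h1) ` ?L \<subseteq> (\<lambda>w. N * w) ` ?W"
      proof (intro image_subsetI)
        fix F assume "F \<in> ?L"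
        then have *: "F * h1 \<in> V e" "vge P (int e) (F * h1)" using LV by auto
        have e1: "1 \<le> e" "e \<le> q" using False qe by auto
        obtain w where "w \<in> lspan K {x ^ i * y ^ j | i j. i + j + 3 \<le> e}" "F * h1 = N * w"
          by (rule P.vanishing_divisible[OF q3 e1 *])
        then show "F * h1 \<in> (\<lambda>w. N * w) ` ?W" unfolding W by blast
      qed
      then have "card ?L \<le> card ((\<lambda>w. N * w) ` ?W)" using inj finW by (intro card_inj_on_le) auto
      also have "\<dots> \<le> card ?W" by (rule card_image_le[OF finW])
      also have "\<dots> \<le> card K ^ card ?I" by (rule card_lspan_image_le[OF K finite_K finite_triangle])
      finally show ?thesis using False by simp
    qed
  qed
  let ?d = "card {(i::nat, j::nat). i + j \<le> 3 * k}"
  have "card K ^ ?d \<le> card ?V" by (rule card_V_ge) (use qe in simp)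
  also note fib
  also have "card (?f ` ?V) * card ?L \<le> card (?f ` ?V) * card K ^ ?c" using cL by (rule mult_left_mono) simp
  finally have "(card K ^ ?d) ^ 2 \<le> (card (?f ` ?V) * card K ^ ?c) ^ 2" by (rule power_mono) simp
  also have "\<dots> \<le> card K ^ card ?S * (card K ^ ?c) ^ 2" unfolding power_mult_distrib using iso by (rule mult_right_mono) simp
  finally have "card K ^ (2 * ?d) \<le> card K ^ (card ?S + 2 * ?c)"
    by (simp only: power_mult[symmetric] power_add mult.commute)
  moreover have "card K > 1" using card_K q2_gt_1 by simp
  ultimately have "2 * ?d \<le> card ?S + 2 * ?c" by (simp only: power_increasing_iff)
  moreover have "2 * ?d = (3 * k + 1) * (3 * k + 2)" by (rule card_triangle)
  moreover have "2 * int ?c = (int e - 1) * (int e - 2)"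
    using card_small_triangle[of e] by (cases "e = 0") auto
  ultimately have "int ((3 * k + 1) * (3 * k + 2)) - (int e - 1) * (int e - 2) \<le> int (card ?S)" by linarith
  then show ?thesis by (simp only: of_nat_mult of_nat_add of_nat_numeral of_nat_1)
qed

section \<open>From functions to differentials and codewords\<close>

definition admissible :: "int \<Rightarrow> 'f \<Rightarrow> bool" where
  "admissible m h \<longleftrightarrow> vge P m h \<and> (\<forall>v\<in>affine_points. vge v (- 1) h) \<and>
     (\<forall>v. is_place K v \<and> vge v 0 x \<and> v \<noteq> P \<and> v \<notin> affine_points \<longrightarrow> vge v 0 h) \<and>
     vge Pinf (- ((int q - 2) * (int q + 1))) h"

lemma affine_pointD: "v \<in> affine_points \<Longrightarrow> is_place K v" "v \<in> affine_points \<Longrightarrow> vge v 0 x"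
proof -
  assume "v \<in> affine_points"
  then obtain a b where ab: "at_point a b v" unfolding affine_points_def by blast
  then interpret r: rational_place q K x y v a b by (rule rational_placeI)
  show "is_place K v" "vge v 0 x" by (rule r.v r.vx)+
qed

lemma admissible_diff: "admissible m g \<Longrightarrow> admissible m h \<Longrightarrow> admissible m (g - h)"
  using place.vge_diff[OF place.intro[OF K]] P.vge_diff inf.vge_diff affine_pointD(1)
  unfolding admissible_def by meson

lemma Omega_eq:
  "Omega K (\<lambda>v. place_multiple m P v - places_sum affine_points v) = {differential K h x | h. admissible m h}"
proof -
  obtain \<delta> where \<delta>: "\<delta> \<in> derivations K" "\<delta> x = 1" by (rule derivation_exists)
  let ?A = "\<lambda>v. place_multiple m P v - places_sum affine_points v"
  have PI: "Pinf \<noteq> P" "Pinf \<notin> affine_points" using not_affine_inf P.vx affine_pointD(2) by auto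
  have A: "?A P = m" "v \<in> affine_points \<Longrightarrow> ?A v = - 1" "v \<noteq> P \<Longrightarrow> v \<notin> affine_points \<Longrightarrow> ?A v = 0" for v
    using P_not_affine_point unfolding place_multiple_def places_sum_def by auto
  have iff: "(\<forall>v. is_place K v \<longrightarrow> ?A v \<le> order_at K (differential K h x) v) \<longleftrightarrow> admissible m h" if h: "h \<noteq> 0" for h
  proof -
    have ord: "order_at K (differential K h x) v = v h" if "is_place K v" "vge v 0 x" for v
      by (rule affine_place.order_at_affine[OF affine_placeI[OF that] h])
    note oi = order_at_infinity[OF h]
    show ?thesis
    proof
      assume L: "\<forall>v. is_place K v \<longrightarrow> ?A v \<le> order_at K (differential K h x) v"
      have *: "vge v (?A v) h" if "is_place K v" "vge v 0 x" for v
        using L that ord unfolding vge_def by auto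
      have "?A Pinf \<le> order_at K (differential K h x) Pinf" using L inf.v by blast
      then have "vge Pinf (- ((int q - 2) * (int q + 1))) h" unfolding oi A(3)[OF PI] vge_def by linarith
      moreover have "vge P m h" using *[OF P.v P.vx] A(1) by simp
      moreover have "vge v (- 1) h" if "v \<in> affine_points" for v
        using *[OF affine_pointD[OF that]] A(2)[OF that] by simp
      moreover have "vge v 0 h" if "is_place K v \<and> vge v 0 x \<and> v \<noteq> P \<and> v \<notin> affine_points" for v
        using *[of v] A(3)[of v] that by simp
      ultimately show "admissible m h" unfolding admissible_def by blast
    next
      assume a: "admissible m h"
      show "\<forall>v. is_place K v \<longrightarrow> ?A v \<le> order_at K (differential K h x) v"
      proof (intro allI impI)
        fix v assume pv: "is_place K v"
        show "?A v \<le> order_at K (differential K h x) v"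
        proof (cases "v = Pinf")
          case True
          have "vge Pinf (- ((int q - 2) * (int q + 1))) h" using a unfolding admissible_def by blast
          then show ?thesis unfolding True oi A(3)[OF PI] using h unfolding vge_def by linarith
        next
          case False
          then have vx: "vge v 0 x" using place_affine_or_inf[OF pv] by blast
          have "vge v (?A v) h"
          proof (cases "v = P \<or> v \<in> affine_points")
            case True
            then show ?thesis using a A(1,2) unfolding admissible_def by metis
          next
            case False
            then show ?thesis using a A(3)[of v] pv vx unfolding admissible_def by metis
          qed
          then show ?thesis unfolding ord[OF pv vx] using h unfolding vge_def by simp
        qed
      qed
    qed
  qed
  have 0: "admissible m 0" unfolding admissible_def vge_def by simp
  show ?thesis
  proof (rule set_eqI)
    fix \<omega>
    show "\<omega> \<in> Omega K ?A \<longleftrightarrow> \<omega> \<in> {differential K h x | h. admissible m h}"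
    proof
      assume w: "\<omega> \<in> Omega K ?A"
      then obtain h where h: "\<omega> = differential K h x" using differentials_ex[OF \<delta>] unfolding Omega_def by blast
      have "admissible m h"
      proof (cases "h = 0")
        case False
        then have "\<omega> \<noteq> zero_differential K" unfolding h zero_differential_eq differential_inj[OF \<delta>] .
        then show ?thesis using w iff[OF False] unfolding Omega_def h by blast
      qed (use 0 in simp)
      then show "\<omega> \<in> {differential K h x | h. admissible m h}" using h by blast
    next
      assume "\<omega> \<in> {differential K h x | h. admissible m h}"
      then obtain h where h: "\<omega> = differential K h x" "admissible m h" by blast
      show "\<omega> \<in> Omega K ?A"
      proof (cases "h = 0")
        case True
        then show ?thesis unfolding Omega_def h(1) using differential_in zero_differential_eq by simp
      next
        case False
        then show ?thesis unfolding Omega_def h(1) using differential_in iff[OF False] h(2) by blast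
      qed
    qed
  qed
qed

text \<open>Equal residues cancel the simple poles. So a position where two words agree is not a
  pole of the difference, and the Hamming distance is at least the number of poles in
  \<open>weight_bound\<close>.\<close>

lemma regular_if_residues_agree:
  assumes v: "v \<in> affine_points" and gh: "vge v (- 1) g" "vge v (- 1) h"
    and eq: "residue_at K v (differential K g x) = residue_at K v (differential K h x)"
  shows "vge v 0 (g - h)"
proof -
  obtain a b where "at_point a b v" using v unfolding affine_points_def by blast
  then interpret r: rational_place q K x y v a b by (rule rational_placeI)
  have ex: "\<exists>c\<in>K. vge v 1 (f * (x - a) - c)" if "vge v (- 1) f" for f
  proof -
    have "vge v (- 1 + 1) (f * (x - a))" by (rule r.vge_mult[OF that r.va])
    then have "vge v 0 (f * (x - a))" by simp
    then obtain c where "c \<in> K" "vge v 1 (f * (x - a) - c)" by (rule r.value_ex)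
    then show ?thesis by blast
  qed
  obtain c where c: "c \<in> K" "vge v 1 (g * (x - a) - c)" using ex[OF gh(1)] by blast
  obtain d where d: "d \<in> K" "vge v 1 (h * (x - a) - d)" using ex[OF gh(2)] by blast
  have "c = d" using eq r.residue_simple_pole[OF gh(1) c] r.residue_simple_pole[OF gh(2) d] by simp
  then have "(g - h) * (x - a) = (g * (x - a) - c) - (h * (x - a) - d)" by (simp add: algebra_simps)
  then have "vge v 1 ((g - h) * (x - a))" using r.vge_diff[OF c(2) d(2)] by simp
  from r.vge_divide[OF this r.xa_nz] show ?thesis using r.v_xa r.xa_nz by simp
qed

text \<open>On natural numbers \<open>Inf {} = 0\<close>, so a lower bound for the minimum distance
  requires two distinct words. One more factor \<open>N\<close> than \<open>2 * k\<close> gives a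
  sufficient order at \<open>P\<close>, since \<open>e \<le> q + 1\<close>, and the denominator
  gives a simple pole at every affine rational point.\<close>

lemma admissible_witness:
  assumes q3: "q \<ge> 3" and qe: "q = 3 * k + e + 2"
  obtains h where "admissible (int (2 * k * (q + 1) + e)) h" "\<forall>v\<in>affine_points. \<not> vge v 0 h"
proof -
  let ?t = "x ^ q\<^sup>2 - x"
  define h where "h = N ^ (2 * k + 1) / ?t"
  have tnz: "?t \<noteq> 0" using x_frob_nz[of 1] by simp
  have Nnz: "N ^ (2 * k + 1) \<noteq> 0" using P.N_nz by simp
  have hnz: "h \<noteq> 0" unfolding h_def using tnz Nnz by simp
  have vh: "v h = int (2 * k + 1) * v N - v ?t" if "is_place K v" for v
  proof -
    interpret place K v by (rule place.intro[OF K that])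
    show ?thesis unfolding h_def v_divide[OF Nnz tnz] v_power[OF P.N_nz] ..
  qed
  have t0: "vge v 0 ?t" if "is_place K v" "vge v 0 x" for v
  proof -
    interpret place K v by (rule place.intro[OF K that(1)])
    show ?thesis by (rule vge_diff[OF vge_power0[OF that(2)] that(2)])
  qed
  have t_unit: "v ?t = 0" if "is_place K v" "vge v 0 x" "\<not> vge v 1 ?t" for v
    using t0[OF that(1,2)] that(3) tnz unfolding vge_def by auto
  have hP: "vge P (int (2 * k * (q + 1) + e)) h"
  proof -
    have "P h = int (2 * k + 1) * (int q + 1)"
      unfolding vh[OF P.v] using t_unit[OF P.v P.vx P.not_rational] P.v_N by simp
    moreover have "2 * k * (q + 1) + e \<le> (2 * k + 1) * (q + 1)" using qe by simp
    then have "int (2 * k * (q + 1) + e) \<le> int ((2 * k + 1) * (q + 1))" by (simp only: of_nat_le_iff)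
    then have "int (2 * k * (q + 1) + e) \<le> int (2 * k + 1) * (int q + 1)" by (simp only: of_nat_mult of_nat_add of_nat_1)
    ultimately show ?thesis unfolding vge_def by simp
  qed
  have hD: "v h = - 1" if vA: "v \<in> affine_points" for v
  proof -
    obtain a b where "at_point a b v" using vA unfolding affine_points_def by blast
    then interpret r: rational_place q K x y v a b by (rule rational_placeI)
    have "v \<noteq> P" using vA P_not_affine_point by blast
    then show ?thesis unfolding vh[OF r.v] P.N_unit_elsewhere[OF r.v r.vx \<open>v \<noteq> P\<close>] r.rational_uniformizer by simp
  qed
  have hO: "vge v 0 h" if pv: "is_place K v" "vge v 0 x" "v \<noteq> P" "v \<notin> affine_points" for v
  proof -
    interpret affine_place q K x y v by (rule affine_placeI[OF pv(1,2)])
    have "\<not> vge v 1 ?t"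
    proof
      assume "vge v 1 ?t"
      then obtain a b where "at_point a b v" by (rule rational_of_frobenius)
      then show False using pv(4) unfolding affine_points_def by blast
    qed
    then have "v h = 0" unfolding vh[OF pv(1)] using t_unit[OF pv(1,2)] P.N_unit_elsewhere[OF pv(1-3)] by simp
    then show ?thesis unfolding vge_def by simp
  qed
  have hI: "vge Pinf (- ((int q - 2) * (int q + 1))) h"
  proof -
    define Q where "Q = int q"
    have Q3: "Q \<ge> 3" using q3 unfolding Q_def by simp
    \<comment> \<open>This bounds the pole of the numerator at infinity; the zero of order
      \<open>q ^ 3\<close> from the denominator outweighs it.\<close>
    have kQ: "3 * int (2 * k + 1) \<le> 2 * Q - 1" unfolding Q_def using qe by simp
    have "3 * int (2 * k + 1) * (Q + 1) \<le> (2 * Q - 1) * (Q + 1)" by (rule mult_right_mono[OF kQ]) (use Q3 in simp)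
    moreover have "Q ^ 2 * 3 \<le> Q ^ 3" "Q * 3 \<le> Q ^ 2"
      using Q3 unfolding power3_eq_cube power2_eq_square by (auto intro: mult_left_mono)
    moreover have "Pinf h = - (3 * int (2 * k + 1) * (Q + 1)) + Q ^ 3"
      unfolding vh[OF inf.v] v_inf_N v_inf_frob Q_def by (simp add: algebra_simps)
    moreover have "(2 * Q - 1) * (Q + 1) = 2 * Q ^ 2 + Q - 1" "(Q - 2) * (Q + 1) = Q ^ 2 - Q - 2"
      by (simp_all add: algebra_simps power2_eq_square power3_eq_cube)
    ultimately have "- ((Q - 2) * (Q + 1)) \<le> Pinf h" using Q3 by linarith
    then show ?thesis unfolding vge_def Q_def by (rule disjI2)
  qed
  have "admissible (int (2 * k * (q + 1) + e)) h" unfolding admissible_def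
    using hP hD hO hI by (simp add: vge_def)
  moreover have "\<forall>v\<in>affine_points. \<not> vge v 0 h"
  proof
    fix v assume "v \<in> affine_points"
    then show "\<not> vge v 0 h" using hD[of v] hnz unfolding vge_def by simp
  qed
  ultimately show ?thesis by (rule that)
qed

lemma minimum_distance_ge:
  assumes q3: "q \<ge> 3" and qe: "q = 3 * k + e + 2" and m: "m = int (2 * k * (q + 1) + e)"
  shows "(3 * int k + 1) * (3 * int k + 2) - (int e - 1) * (int e - 2)
    \<le> int (minimum_distance affine_points (differential_code K affine_points (place_multiple m P)))"
proof -
  let ?C = "differential_code K affine_points (place_multiple m P)"
  let ?w = "\<lambda>h. \<lambda>v\<in>affine_points. residue_at K v (differential K h x)"
  let ?D = "{hamming_distance affine_points a b | a b. a \<in> ?C \<and> b \<in> ?C \<and> a \<noteq> b}"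
  have C: "?C = {?w h | h. admissible m h}" unfolding differential_code_def Omega_eq by blast
  have adm: "vge v (- 1) h" if "admissible m h" "v \<in> affine_points" for v h using that unfolding admissible_def by blast
  have adm0: "admissible m 0" unfolding admissible_def vge_def by simp
  have bound: "(3 * int k + 1) * (3 * int k + 2) - (int e - 1) * (int e - 2)
    \<le> int (hamming_distance affine_points (?w g) (?w h))"
    if gh: "admissible m g" "admissible m h" "?w g \<noteq> ?w h" for g h
  proof -
    have d: "admissible m (g - h)" by (rule admissible_diff[OF gh(1,2)])
    have "g - h \<noteq> 0" using gh(3) by auto
    then have "(3 * int k + 1) * (3 * int k + 2) - (int e - 1) * (int e - 2)
      \<le> int (card {v \<in> affine_points. \<not> vge v 0 (g - h)})"
      using d unfolding admissible_def m by (intro weight_bound[OF q3 qe]) auto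
    moreover have "card {v \<in> affine_points. \<not> vge v 0 (g - h)} \<le> hamming_distance affine_points (?w g) (?w h)"
      unfolding hamming_distance_def
    proof (rule card_mono)
      show "{v \<in> affine_points. \<not> vge v 0 (g - h)} \<subseteq> {v \<in> affine_points. ?w g v \<noteq> ?w h v}"
        using regular_if_residues_agree[OF _ adm[OF gh(1)] adm[OF gh(2)]] by auto
    qed (use finite_affine_points in simp)
    ultimately show ?thesis by linarith
  qed
  obtain h where h: "admissible m h" "\<forall>v\<in>affine_points. \<not> vge v 0 h"
    unfolding m by (rule admissible_witness[OF q3 qe])
  obtain v where v: "v \<in> affine_points" using affine_points_nonempty by blast
  have "?w h v \<noteq> ?w 0 v"
  proof
    assume "?w h v = ?w 0 v"
    then have "residue_at K v (differential K h x) = residue_at K v (differential K 0 x)" using v by simp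
    from regular_if_residues_agree[OF v adm[OF h(1) v] adm[OF adm0 v] this] show False using h(2) v by simp
  qed
  then have "?w h \<noteq> ?w 0" by metis
  then have "?D \<noteq> {}" unfolding C using h(1) adm0 by blast
  then have "Inf ?D \<in> ?D" by (rule Inf_nat_def1)
  then obtain g g' where "admissible m g" "admissible m g'" "?w g \<noteq> ?w g'"
    "minimum_distance affine_points ?C = hamming_distance affine_points (?w g) (?w g')"
    unfolding minimum_distance_def C by auto
  then show ?thesis using bound by simp
qed

end

context hermitian_curve
begin

lemma cubic_placeE:
  assumes deg: "place_of_degree K 3 P"
  obtains N where "hermitian_cubic q K x y P N"
proof -
  have pv: "is_place K P" using deg by (simp add: place_of_degree_def)
  have "P \<noteq> Pinf"
  proof
    assume "P = Pinf"
    then have "place_of_degree K 3 Pinf" using deg by simp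
    then have "card K ^ 3 \<le> card K"
      by (rule inf.residue_constants_degree[OF finite_K]) (use inf.value_ex in blast)
    moreover have "card K ^ 1 < card K ^ 3" using card_K q2_gt_1 by (intro power_strict_increasing) auto
    ultimately show False by simp
  qed
  then have "vge P 0 x" using place_affine_or_inf[OF pv] by blast
  then interpret c: cubic_place q K x y P
    using affine_placeI[OF pv] deg by (intro cubic_place.intro cubic_place_axioms.intro)
  obtain N where N: "N - y ^ 3 \<in> lspan K {x ^ i * y ^ j | i j. j \<le> 2 \<and> i + j \<le> 3}" "vge P (int q + 1) N"
    by (rule c.tangent_cubic)
  have "hermitian_cubic q K x y P N"
    by (intro hermitian_cubic.intro hermitian_curve_axioms tangent_cubic_place.intro
        c.cubic_place_axioms tangent_cubic_place_axioms.intro N)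
  then show ?thesis by (rule that)
qed

end

theorem theorem4p1:
  fixes q :: nat
    and K :: "'f::field set" and x y :: 'f
    and P :: "'f place" and D :: "'f place set"
    and u m m\<^sub>0 m\<^sub>1 \<delta> :: int
  assumes "primepow q"
    and "hermitian_function_field q K x y"
    and "place_of_degree K 3 P"
    and "D = {Q. place_of_degree K 1 Q \<and> Q \<noteq> P_infinity K x y}"
    and "int q + 1 \<le> 6 * u" and "6 * u \<le> 2 * (int q + 1)"
    and "m = (2 * u - 1) * int q - u - 1"
    and "m = m\<^sub>1 * (int q + 1) + m\<^sub>0" and "0 \<le> m\<^sub>0" and "m\<^sub>0 \<le> int q"
    and "\<delta> = 3 * m - int q ^ 2 + int q + 2"
  shows "\<delta> + 3 * (int q + 1 - 3 * u)
           \<le> int (minimum_distance D (differential_code K D (place_multiple m P)))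
         \<and> \<delta> + 3 * (int q + 1 - 3 * u) = \<delta> + 3 * m\<^sub>0"
proof
  interpret hermitian q K x y using assms(1,2) by (rule hermitian.intro)
  interpret hermitian_curve q K x y by (rule hermitian_curve)
  obtain N where "hermitian_cubic q K x y P N" by (rule cubic_placeE[OF assms(3)])
  then interpret hermitian_cubic q K x y P N .
  have D: "D = affine_points" unfolding assms(4) affine_points_def degree_one_places ..
  \<comment> \<open>Division with remainder by \<open>q + 1\<close>: the bounds on \<open>u\<close>
    put \<open>q + 1 - 3 * u\<close> between 0 and \<open>q\<close>, so it is
    \<open>m\<^sub>0\<close>.\<close>
  have m': "m = (2 * u - 2) * (int q + 1) + (int q + 1 - 3 * u)" unfolding assms(7) by (simp add: algebra_simps)
  have u1: "1 \<le> u" using assms(5) by linarith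
  have "m\<^sub>0 = m mod (int q + 1)"
    using assms(8-10) by (simp add: mod_pos_pos_trivial)
  moreover have "int q + 1 - 3 * u = m mod (int q + 1)"
    unfolding m' mod_mult_self3 using assms(6) u1 by (intro mod_pos_pos_trivial[symmetric]) auto
  ultimately show "\<delta> + 3 * (int q + 1 - 3 * u) = \<delta> + 3 * m\<^sub>0" by simp
  \<comment> \<open>In this form the bound is 0 for \<open>q = 2\<close>. For larger
    \<open>q\<close> it equals \<open>(3 * k + 1) * (3 * k + 2) - (e - 1) * (e - 2)\<close> with
    \<open>k = u - 1\<close> and \<open>e = q + 1 - 3 * u\<close>.\<close>
  have bound: "\<delta> + 3 * (int q + 1 - 3 * u) = (int q - 2) * (6 * u - int q - 1)"
    unfolding assms(7,11) by (simp add: algebra_simps power2_eq_square)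
  show "\<delta> + 3 * (int q + 1 - 3 * u)
           \<le> int (minimum_distance D (differential_code K D (place_multiple m P)))"
  proof (cases "q \<ge> 3")
    case False
    then have "q = 2" using q_gt_1 by simp
    then show ?thesis unfolding bound by simp
  next
    case True
    define k e where "k = nat (u - 1)" and "e = nat (int q + 1 - 3 * u)"
    have k: "int k = u - 1" and e: "int e = int q + 1 - 3 * u" unfolding k_def e_def using u1 assms(6) by auto
    have "int q = int (3 * k + e + 2)" using k e by simp
    then have qe: "q = 3 * k + e + 2" by (simp only: of_nat_eq_iff)
    have "m = 2 * int k * (int q + 1) + int e" unfolding m' k e by (simp add: algebra_simps)
    then have "m = int (2 * k * (q + 1) + e)" by (simp only: of_nat_mult of_nat_add of_nat_1 of_nat_numeral)
    from minimum_distance_ge[OF True qe this] show ?thesis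
      unfolding D bound k e by (simp add: algebra_simps)
  qed
qed

end
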